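(* Let $s\ge 1$ and $N$ be positive integers, let $(\gamma_{\mathfrak u})_{\mathfrak u\subseteq\{1,\dots,s\}}$ be positive weights with $\gamma_\emptyset=1$, and let $\boldsymbol z=(z_1,\dots,z_s)\in\{1,\dots,N-1\}^s$ be arbitrary. Let $e_{N,s}(\boldsymbol z,\boldsymbol\Delta)$ denote the worst-case error, in the weighted unanchored Sobolev space $H_{s,\boldsymbol\gamma}$, of the shifted lattice rule with $N$ points, generating vector $\boldsymbol z$ and shift $\boldsymbol\Delta\in[0,1]^s$. Let $S_N=\{\tfrac{1}{2N},\tfrac{3}{2N},\dots,\tfrac{2N-1}{2N}\}$ and define $$[e_{N,s}^{\mathrm{sh}}(\boldsymbol z)]^2:=\int_{[0,1]^s}e_{N,s}^2(\boldsymbol z,\boldsymbol\Delta)\,\mathrm d\boldsymbol\Delta,\qquad [e_{N,s}^{\frac12\mathrm{sh}}(\boldsymbol z)]^2:=\frac{1}{N^s}\sum_{\boldsymbol\Delta\in S_N^s}e_{N,s}^2(\boldsymbol z,\boldsymbol\Delta).$$ Then $$\Big|[e_{N,s}^{\mathrm{sh}}(\boldsymbol z)]^2-[e_{N,s}^{\frac12\mathrm{sh}}(\boldsymbol z)]^2\Big|\le\frac{1}{4N^2}\sum_{\emptyset\ne\mathfrak u\subseteq\{1,\dots,s\}}\gamma_{\mathfrak u}\Big(\frac13\Big)^{|\mathfrak u|}|\mathfrak u|.$$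
   Context: For a real number $x$, $\{x\}\in[0,1)$ denotes its fractional part; for a vector, braces mean the fractional part is taken componentwise. Shifted lattice rule: for $\boldsymbol z\in\{1,\dots,N-1\}^s$ (generating vector) and $\boldsymbol\Delta\in[0,1]^s$ (shift), $$Q_{N,s}(\boldsymbol z,\boldsymbol\Delta;f):=\frac1N\sum_{k=1}^N f\Big(\Big\{\frac{k\boldsymbol z}{N}+\boldsymbol\Delta\Big\}\Big),$$ which approximates $I_s(f):=\int_{[0,1]^s}f(\boldsymbol x)\,\mathrm d\boldsymbol x$. Function space: $H_{s,\boldsymbol\gamma}$ is the weighted unanchored Sobolev (Hilbert) space of functions on the unit cube with square-integrable mixed first derivatives on $(0,1)^s$, with squared norm $$\|f\|_{H_{s,\boldsymbol\gamma}}^2:=\sum_{\mathfrak u\subseteq\{1,\dots,s\}}\gamma_{\mathfrak u}^{-1}\int_{[0,1]^{|\mathfrak u|}}\left(\int_{[0,1]^{s-|\mathfrak u|}}\frac{\partial^{|\mathfrak u|}f}{\partial\boldsymbol x_{\mathfrak u}}(\boldsymbol x_{\mathfrak u};\boldsymbol x_{\{1,\dots,s\}\setminus\mathfrak u})\,\mathrm d\boldsymbol x_{\{1,\dots,s\}\setminus\mathfrak u}\right)^2\mathrm d\boldsymbol x_{\mathfrak u},$$ where $\boldsymbol x_{\mathfrak u}$ denotes the variables $x_j$ with $j\in\mathfrak u$, and the weights $\gamma_{\mathfrak u}$ are positive numbers with $\gamma_\emptyset=1$. Worst-case error: $$e_{N,s}(\boldsymbol z,\boldsymbol\Delta):=\sup_{f\in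 H_{s,\boldsymbol\gamma},\ \|f\|_{H_{s,\boldsymbol\gamma}}\le1}|Q_{N,s}(\boldsymbol z,\boldsymbol\Delta;f)-I_s(f)|.$$ It is well known (and the paper takes as given) that its square has the explicit formula $$e_{N,s}^2(\boldsymbol z,\boldsymbol\Delta)=\frac1{N^2}\sum_{k=1}^N\sum_{k'=1}^N\ \sum_{\emptyset\ne\mathfrak u\subseteq\{1,\dots,s\}}\gamma_{\mathfrak u}\prod_{j\in\mathfrak u}\Big[\frac12B_2\Big(\Big\{\frac{(k-k')z_j}{N}\Big\}\Big)+A_{k,k',z_j}(\Delta_j)\Big],$$ where $B_2(x)=x^2-x+\frac16$ is the Bernoulli polynomial of degree 2 and $$A_{k,k',z}(\Delta):=\Big(\Big\{\frac{kz}{N}+\Delta\Big\}-\frac12\Big)\Big(\Big\{\frac{k'z}{N}+\Delta\Big\}-\frac12\Big).$$ The shift-averaged quantity also has the known expression $[e_{N,s}^{\mathrm{sh}}(\boldsymbol z)]^2=\frac1N\sum_{k=1}^N\sum_{\emptyset\ne\mathfrak u\subseteq\{1,\dots,s\}}\gamma_{\mathfrak u}\prod_{j\in\mathfrak u}B_2(\{kz_j/N\})$. *)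

theory Defs
  imports "HOL-Analysis.Analysis"
begin

text \<open>
  A point of \<open>\<real>\<^sup>s\<close> is an element of \<open>{1..s} \<rightarrow>\<^sub>E UNIV\<close> of type \<open>nat \<Rightarrow> real\<close>, so that the coordinates
  are labelled by \<open>{1..s}\<close> and \<open>x\<^sub>\<uu>\<close> (for \<open>\<uu> \<subseteq> {1..s}\<close>) lives in \<open>\<uu> \<rightarrow>\<^sub>E UNIV\<close>. On such sets the
  topology of the function type \<open>nat \<Rightarrow> real\<close> induces the usual Euclidean topology.
\<close>

definition unit_cube :: "nat set \<Rightarrow> (nat \<Rightarrow> real) set" where
  "unit_cube u = u \<rightarrow>\<^sub>E {0..1}"

definition cube_measure :: "nat set \<Rightarrow> (nat \<Rightarrow> real) measure" where
  "cube_measure u = PiM u (\<lambda>_. restrict_space lborel {0..1})"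


subsection \<open>Test functions and weak mixed derivatives\<close>

definition partial_deriv :: "nat \<Rightarrow> ((nat \<Rightarrow> real) \<Rightarrow> real) \<Rightarrow> (nat \<Rightarrow> real) \<Rightarrow> real" where
  "partial_deriv i f x = deriv (\<lambda>t. f (x(i := t))) (x i)"

definition smooth_fun :: "nat \<Rightarrow> ((nat \<Rightarrow> real) \<Rightarrow> real) \<Rightarrow> bool" where
  "smooth_fun s f \<longleftrightarrow>
     (\<forall>is. set is \<subseteq> {1..s} \<longrightarrow>
        continuous_on ({1..s} \<rightarrow>\<^sub>E UNIV) (foldr partial_deriv is f) \<and>
        (\<forall>i\<in>{1..s}. \<forall>x\<in>{1..s} \<rightarrow>\<^sub>E UNIV.
           (\<lambda>t. foldr partial_deriv is f (x(i := t))) differentiable at (x i)))"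

definition test_fun :: "nat \<Rightarrow> ((nat \<Rightarrow> real) \<Rightarrow> real) \<Rightarrow> bool" where
  "test_fun s \<phi> \<longleftrightarrow> smooth_fun s \<phi> \<and>
     (\<exists>K. compact K \<and> K \<subseteq> ({1..s} \<rightarrow>\<^sub>E {0<..<1}) \<and> (\<forall>x\<in>({1..s} \<rightarrow>\<^sub>E UNIV) - K. \<phi> x = 0))"

text \<open>The order of differentiation is immaterial for smooth functions.\<close>

definition mixed_partial :: "nat set \<Rightarrow> ((nat \<Rightarrow> real) \<Rightarrow> real) \<Rightarrow> (nat \<Rightarrow> real) \<Rightarrow> real" where
  "mixed_partial u \<phi> = foldr partial_deriv (sorted_list_of_set u) \<phi>"

definition square_integrable :: "nat \<Rightarrow> ((nat \<Rightarrow> real) \<Rightarrow> real) \<Rightarrow> bool" where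
  "square_integrable s g \<longleftrightarrow>
     g \<in> borel_measurable (cube_measure {1..s}) \<and> integrable (cube_measure {1..s}) (\<lambda>x. (g x)\<^sup>2)"

text \<open>
  \<open>g\<close> is the weak derivative \<open>\<partial>\<^sup>|\<^sup>\<uu>\<^sup>| f / \<partial>x\<^sub>\<uu>\<close> on \<open>(0,1)\<^sup>s\<close>; the boundary of the cube is a null set.
\<close>

definition has_weak_mixed_deriv ::
    "nat \<Rightarrow> nat set \<Rightarrow> ((nat \<Rightarrow> real) \<Rightarrow> real) \<Rightarrow> ((nat \<Rightarrow> real) \<Rightarrow> real) \<Rightarrow> bool" where
  "has_weak_mixed_deriv s u f g \<longleftrightarrow>
     (\<forall>\<phi>. test_fun s \<phi> \<longrightarrow>
        (\<integral>x. f x * mixed_partial u \<phi> x \<partial>cube_measure {1..s}) =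
        (- 1) ^ card u * (\<integral>x. g x * \<phi> x \<partial>cube_measure {1..s}))"


subsection \<open>The weighted unanchored Sobolev space\<close>

text \<open>
  Elements are represented by their continuous representative on the closed cube, which makes
  point evaluation meaningful. Since there are only finitely many weights and they are positive,
  the underlying set of functions does not depend on them; only the norm does.
\<close>

definition sobolev_space :: "nat \<Rightarrow> ((nat \<Rightarrow> real) \<Rightarrow> real) set" where
  "sobolev_space s =
     {f. continuous_on (unit_cube {1..s}) f \<and>
         (\<forall>u. u \<subseteq> {1..s} \<longrightarrow> (\<exists>g. square_integrable s g \<and> has_weak_mixed_deriv s u f g))}"

text \<open>The weak derivative is unique up to null sets, so the choice does not affect the norm.\<close>

definition weak_mixed_deriv ::
    "nat \<Rightarrow> nat set \<Rightarrow> ((nat \<Rightarrow> real) \<Rightarrow> real) \<Rightarrow> (nat \<Rightarrow> real) \<Rightarrow> real" where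
  "weak_mixed_deriv s u f = (SOME g. square_integrable s g \<and> has_weak_mixed_deriv s u f g)"

definition sobolev_norm :: "nat \<Rightarrow> (nat set \<Rightarrow> real) \<Rightarrow> ((nat \<Rightarrow> real) \<Rightarrow> real) \<Rightarrow> real" where
  "sobolev_norm s \<gamma> f = sqrt (\<Sum>u\<in>Pow {1..s}. inverse (\<gamma> u) *
     (\<integral>x. (\<integral>y. weak_mixed_deriv s u f (merge u ({1..s} - u) (x, y))
              \<partial>cube_measure ({1..s} - u))\<^sup>2 \<partial>cube_measure u))"


subsection \<open>Shifted lattice rules and their worst-case error\<close>

definition lattice_rule ::
    "nat \<Rightarrow> nat \<Rightarrow> (nat \<Rightarrow> nat) \<Rightarrow> (nat \<Rightarrow> real) \<Rightarrow> ((nat \<Rightarrow> real) \<Rightarrow> real) \<Rightarrow> real" where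
  "lattice_rule N s z \<Delta> f =
     1 / real N * (\<Sum>k=1..N. f (\<lambda>j\<in>{1..s}. frac (real k * real (z j) / real N + \<Delta> j)))"

definition cube_integral :: "nat \<Rightarrow> ((nat \<Rightarrow> real) \<Rightarrow> real) \<Rightarrow> real" where
  "cube_integral s f = (\<integral>x. f x \<partial>cube_measure {1..s})"

definition worst_case_error ::
    "nat \<Rightarrow> nat \<Rightarrow> (nat set \<Rightarrow> real) \<Rightarrow> (nat \<Rightarrow> nat) \<Rightarrow> (nat \<Rightarrow> real) \<Rightarrow> real" where
  "worst_case_error N s \<gamma> z \<Delta> =
     (SUP f\<in>{f \<in> sobolev_space s. sobolev_norm s \<gamma> f \<le> 1}.
        \<bar>lattice_rule N s z \<Delta> f - cube_integral s f\<bar>)"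

definition shift_avg_sq_error ::
    "nat \<Rightarrow> nat \<Rightarrow> (nat set \<Rightarrow> real) \<Rightarrow> (nat \<Rightarrow> nat) \<Rightarrow> real" where
  "shift_avg_sq_error N s \<gamma> z = (\<integral>\<Delta>. (worst_case_error N s \<gamma> z \<Delta>)\<^sup>2 \<partial>cube_measure {1..s})"

definition half_shifts :: "nat \<Rightarrow> real set" where
  "half_shifts N = (\<lambda>k. (2 * real k - 1) / (2 * real N)) ` {1..N}"

definition half_shift_avg_sq_error ::
    "nat \<Rightarrow> nat \<Rightarrow> (nat set \<Rightarrow> real) \<Rightarrow> (nat \<Rightarrow> nat) \<Rightarrow> real" where
  "half_shift_avg_sq_error N s \<gamma> z =
     1 / real N ^ s * (\<Sum>\<Delta>\<in>{1..s} \<rightarrow>\<^sub>E half_shifts N. (worst_case_error N s \<gamma> z \<Delta>)\<^sup>2)"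

end

theory Submission
  imports Defs "HOL-Probability.Probability" "HOL-Real_Asymp.Real_Asymp"
begin

text \<open>
  Let \<open>kap x t = t - [x < t]\<close>. Expanding a product of one-dimensional approximate Dirac masses
  \<open>\<delta> = 1 - (1 - \<delta>)\<close>, where \<open>1 - \<delta>\<close> is the derivative of a compactly supported function close to
  \<open>kap x\<close>, shows that every \<open>f\<close> of the Sobolev space satisfies \<open>f x = \<Sum>\<^sub>u \<integral> \<partial>\<^sub>u f \<Prod>\<^sub>j\<^sub>\<in>\<^sub>u kap (x j)\<close>. By the
  Cauchy-Schwarz inequality this bounds the quadrature error, and the bound is attained by the
  representer of the error functional, a combination of tensor products of
  \<open>eta x y = \<integral> kap x kap y\<close>. Hence the squared worst-case error is an explicit quadratic form in
  \<open>\<Prod>\<^sub>j\<^sub>\<in>\<^sub>u eta\<close>. As a function of one shift coordinate, \<open>eta\<close> is a quadratic polynomial with leading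
  coefficient 1 on each of \<open>N\<close> intervals whose midpoints are the half shifts, so its integral and
  its average over half shifts differ by exactly \<open>1 / (12 N\<^sup>2)\<close>; both are at most 1/3 in absolute
  value, and a telescoping product gives the claim.
\<close>

subsection \<open>Smooth functions of one variable\<close>

text \<open>The explicit formula for the squared error is derived from the definitions, and these
  shape the route. Weak derivatives are tested only against smooth functions with compact support in
  the open cube, so the kernel cannot be inserted directly: \<open>kap x\<close> jumps at x and its
  support is the whole interval. Hence the constant 1 of the expansion is replaced as well, by a
  compactly supported \<open>plateau\<close> of mass 1, and the expansion is exact before the limit
  is taken. Conversely, the norm refers to an arbitrarily chosen weak derivative, so its value at
  the extremal function requires uniqueness almost everywhere, that is, the fundamental lemma of the
  calculus of variations. Origin of the constants: the products k z_j are integers, so the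
  fractional parts jump only at multiples of 1/N. On an interval of length h = 1/N the midpoint rule
  misses exactly h^3/12 for t^2 + B t + C, and N intervals give 1/(12 N^2). Exchanging one of |u|
  factors, the others being at most 1/3, costs (1/3)^(|u|-1) / (12 N^2); summed over the factors
  this is (1/3)^|u| |u| / (4 N^2).\<close>

primrec Cdiff :: "nat \<Rightarrow> (real \<Rightarrow> real) \<Rightarrow> bool" where
  "Cdiff 0 f \<longleftrightarrow> True"
| "Cdiff (Suc n) f \<longleftrightarrow> (\<exists>f'. (\<forall>t. (f has_real_derivative f' t) (at t)) \<and> Cdiff n f')"

lemma Cdiff_SucI:
  assumes "\<And>t. (f has_real_derivative f' t) (at t)" "Cdiff n f'"
  shows "Cdiff (Suc n) f"
  using assms by auto

lemma Cdiff_SucD: "Cdiff (Suc n) f \<Longrightarrow> Cdiff n f"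
proof (induction n arbitrary: f)
  case (Suc n)
  then obtain f' where "\<forall>t. (f has_real_derivative f' t) (at t)" "Cdiff (Suc n) f'"
    by auto
  with Suc.IH show ?case by (auto simp del: Cdiff.simps(2) intro: Cdiff_SucI)
qed simp

lemma Cdiff_const: "Cdiff n (\<lambda>_. c)"
proof (induction n arbitrary: c)
  case (Suc n)
  show ?case by (rule Cdiff_SucI[OF _ Suc.IH[of 0]]) auto
qed simp

lemma Cdiff_ident: "Cdiff n (\<lambda>t. t)"
proof (cases n)
  case (Suc m)
  then show ?thesis by (auto intro!: exI[of _ "\<lambda>_. 1"] Cdiff_const)
qed simp

lemma Cdiff_add: "Cdiff n f \<Longrightarrow> Cdiff n g \<Longrightarrow> Cdiff n (\<lambda>t. f t + g t)"
proof (induction n arbitrary: f g)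
  case (Suc n)
  then obtain f' g' where "\<forall>t. (f has_real_derivative f' t) (at t)" "Cdiff n f'"
     "\<forall>t. (g has_real_derivative g' t) (at t)" "Cdiff n g'" by auto
  with Suc.IH show ?case
    by (intro Cdiff_SucI[where f' = "\<lambda>t. f' t + g' t"]) (auto intro: derivative_intros)
qed simp

lemma Cdiff_mult: "Cdiff n f \<Longrightarrow> Cdiff n g \<Longrightarrow> Cdiff n (\<lambda>t. f t * g t)"
proof (induction n arbitrary: f g)
  case (Suc n)
  then obtain f' g' where *: "\<forall>t. (f has_real_derivative f' t) (at t)" "Cdiff n f'"
     "\<forall>t. (g has_real_derivative g' t) (at t)" "Cdiff n g'" by auto
  show ?case
  proof (rule Cdiff_SucI)
    show "((\<lambda>t. f t * g t) has_real_derivative f' t * g t + g' t * f t) (at t)" for t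
      using * by (intro DERIV_mult) auto
    show "Cdiff n (\<lambda>t. f' t * g t + g' t * f t)"
      using * Suc.prems[THEN Cdiff_SucD] by (intro Cdiff_add Suc.IH) auto
  qed
qed simp

lemma Cdiff_cmult: "Cdiff n f \<Longrightarrow> Cdiff n (\<lambda>t. c * f t)"
  by (intro Cdiff_mult Cdiff_const)

lemma Cdiff_diff: "Cdiff n f \<Longrightarrow> Cdiff n g \<Longrightarrow> Cdiff n (\<lambda>t. f t - g t)"
  using Cdiff_add[of n f "\<lambda>t. (-1) * g t"] Cdiff_cmult[of n g "-1"] by simp

lemma Cdiff_affine: "Cdiff n f \<Longrightarrow> Cdiff n (\<lambda>t. f (a * t + b))"
proof (induction n arbitrary: f)
  case (Suc n)
  then obtain f' where *: "\<And>t. (f has_real_derivative f' t) (at t)" "Cdiff n f'" by auto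
  show ?case
  proof (rule Cdiff_SucI)
    show "((\<lambda>t. f (a * t + b)) has_real_derivative a * f' (a * t + b)) (at t)" for t
    proof -
      have "((\<lambda>t. a * t + b) has_real_derivative a) (at t)"
        by (auto intro!: derivative_eq_intros)
      from DERIV_chain2[where f = f and g = "\<lambda>t. a * t + b", OF *(1) this]
      show ?thesis by (simp add: mult.commute)
    qed
    show "Cdiff n (\<lambda>t. a * f' (a * t + b))" using * Suc.IH by (intro Cdiff_cmult) auto
  qed
qed simp

lemma Cdiff_inverse: "Cdiff n f \<Longrightarrow> (\<And>t. f t \<noteq> 0) \<Longrightarrow> Cdiff n (\<lambda>t. inverse (f t))"
proof (induction n arbitrary: f)
  case (Suc n)
  then obtain f' where *: "\<And>t. (f has_real_derivative f' t) (at t)" "Cdiff n f'" by auto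
  show ?case
  proof (rule Cdiff_SucI)
    \<comment> \<open>The derivative is spelled with \<open>inverse (f t)\<close> as a factor, so
      that the induction hypothesis applies to it at the lower order.\<close>
    show "((\<lambda>t. inverse (f t)) has_real_derivative (- 1) * (inverse (f t) * (f' t * inverse (f t)))) (at t)" for t
      using DERIV_inverse'[OF *(1)[of t]] Suc.prems(2) by (simp add: mult.assoc)
    show "Cdiff n (\<lambda>t. (- 1) * (inverse (f t) * (f' t * inverse (f t))))"
      using * Suc.IH[of f] Suc.prems Cdiff_SucD[OF Suc.prems(1)]
      by (intro Cdiff_cmult Cdiff_mult) auto
  qed
qed simp

section \<open>A smooth monotone transition from 0 to 1\<close>

definition flat :: "nat \<Rightarrow> real \<Rightarrow> real" where
  "flat k t = (if t \<le> 0 then 0 else exp (- 1 / t) / t ^ k)"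

lemma flat_over_tendsto: "((\<lambda>t::real. exp (- 1 / t) / t ^ k) \<longlongrightarrow> 0) (at_right 0)"
  by real_asymp

text \<open>The powers of t in the denominator are part of the family precisely so that its span is
  closed under differentiation; smoothness is then an induction on the order with \<open>k\<close>
  arbitrary.\<close>

lemma flat_deriv: "(flat k has_real_derivative flat (k + 2) t - real k * flat (k + 1) t) (at t)"
proof -
  consider "t < 0" | "t > 0" | "t = 0" by linarith
  then show ?thesis
  proof cases
    case 1
    have "((\<lambda>_. 0) has_real_derivative 0) (at t)" by simp
    then have "(flat k has_real_derivative 0) (at t)"
      by (rule has_field_derivative_transform_within_open[where S = "{..<0}"]) (use 1 in \<open>auto simp: flat_def\<close>)
    with 1 show ?thesis by (simp add: flat_def)
  next
    case 2
    have "((\<lambda>t. exp (- 1 / t) * inverse (t ^ k)) has_real_derivative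
        exp (- 1 / t) * (1 / t\<^sup>2) * inverse (t ^ k)
        + - (inverse (t ^ k) * (real k * t ^ (k - 1)) * inverse (t ^ k)) * exp (- 1 / t)) (at t)"
      using 2 by (auto intro!: derivative_eq_intros simp: power2_eq_square field_simps)
    moreover have "exp (- 1 / t) * (1 / t\<^sup>2) * inverse (t ^ k)
        + - (inverse (t ^ k) * (real k * t ^ (k - 1)) * inverse (t ^ k)) * exp (- 1 / t)
       = flat (k + 2) t - real k * flat (k + 1) t"
      using 2 by (cases k) (auto simp: flat_def field_simps power2_eq_square)
    ultimately have "((\<lambda>t. exp (- 1 / t) * inverse (t ^ k)) has_real_derivative
        flat (k + 2) t - real k * flat (k + 1) t) (at t)" by simp
    then show ?thesis
      by (rule has_field_derivative_transform_within_open[where S = "{0<..}"])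
         (use 2 in \<open>auto simp: flat_def field_simps\<close>)
  next
    case 3
    \<comment> \<open>For h > 0 the difference quotient at 0 is again a member of the family,
      \<open>flat (Suc k) h\<close>, and the exponential beats every power.\<close>
    have "((\<lambda>h. flat k h / h) \<longlongrightarrow> 0) (at_right 0)"
      by (rule tendsto_cong[THEN iffD1, OF _ flat_over_tendsto[of "Suc k"]])
         (auto simp: eventually_at_filter flat_def)
    moreover have "((\<lambda>h. flat k h / h) \<longlongrightarrow> 0) (at_left 0)"
      by (rule tendsto_cong[THEN iffD1, OF _ tendsto_const[of 0]])
         (auto simp: eventually_at_filter flat_def)
    ultimately have "((\<lambda>h. flat k h / h) \<longlongrightarrow> 0) (at 0)"
      using filterlim_split_at by blast
    with 3 show ?thesis by (simp add: DERIV_def flat_def)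
  qed
qed

lemma Cdiff_flat: "Cdiff n (flat k)"
proof (induction n arbitrary: k)
  case (Suc n)
  show ?case
    by (rule Cdiff_SucI[OF flat_deriv]) (intro Cdiff_diff Cdiff_cmult Suc.IH)
qed simp

text \<open>The standard partition-of-unity quotient. The argument is written as
  \<open>- 1 * t + 1\<close> to have the affine shape of \<open>Cdiff_affine\<close>.\<close>

definition step :: "real \<Rightarrow> real" where
  "step t = flat 0 t * inverse (flat 0 t + flat 0 (- 1 * t + 1))"

lemma flat_nonneg: "flat k t \<ge> 0" by (simp add: flat_def)

lemma flat_pos: "t > 0 \<Longrightarrow> flat k t > 0" by (simp add: flat_def)

lemma step_denom_pos: "flat 0 t + flat 0 (1 - t) > 0"
  using flat_nonneg[of 0 t] flat_pos[of t 0] flat_nonneg[of 0 "1 - t"] flat_pos[of "1 - t" 0]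
  by (cases "t > 0") auto

lemma step_eq_0: "t \<le> 0 \<Longrightarrow> step t = 0" and step_eq_1: "t \<ge> 1 \<Longrightarrow> step t = 1"
  by (auto simp: step_def flat_def)

lemma Cdiff_step: "Cdiff n step"
  unfolding step_def[abs_def]
  by (intro Cdiff_mult Cdiff_inverse Cdiff_add Cdiff_flat Cdiff_affine)
     (use step_denom_pos in \<open>auto simp: less_imp_neq[symmetric]\<close>)

text \<open>With p, q the two exponentials, the numerator of the quotient rule collapses to p' q + p
  q', a sum of nonnegative terms. Monotonicity is what makes \<open>approx_delta\<close>
  nonnegative.\<close>

lemma step_differentiable: "\<exists>D\<ge>0. (step has_real_derivative D) (at t)"
proof -
  define p where "p = flat 0 t"
  define q where "q = flat 0 (1 - t)"
  define p' where "p' = flat 2 t"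
  define q' where "q' = flat 2 (1 - t)"
  have pos: "p + q > 0" using step_denom_pos[of t] by (simp add: p_def q_def)
  have nn: "p \<ge> 0" "q \<ge> 0" "p' \<ge> 0" "q' \<ge> 0"
    by (auto simp: p_def q_def p'_def q'_def flat_nonneg)
  have 1: "(flat 0 has_real_derivative p') (at t)" using flat_deriv[of 0 t]
    by (simp add: p'_def numeral_2_eq_2)
  have 2: "((\<lambda>t. flat 0 (- 1 * t + 1)) has_real_derivative - q') (at t)"
  proof -
    have "(flat 0 has_real_derivative q') (at (- 1 * t + 1))"
      using flat_deriv[of 0 "1 - t"] by (simp add: q'_def numeral_2_eq_2)
    moreover have "((\<lambda>t. - 1 * t + 1) has_real_derivative - 1) (at t)"
      by (auto intro!: derivative_eq_intros)
    ultimately show ?thesis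
      using DERIV_chain2 by fastforce
  qed
  have "((\<lambda>t. flat 0 t / (flat 0 t + flat 0 (- 1 * t + 1))) has_real_derivative
     (p' * (p + q) - p * (p' - q')) / ((p + q) * (p + q))) (at t)"
    by (rule derivative_eq_intros 1 2 | use pos in \<open>simp add: p_def q_def\<close>)+
  then have "(step has_real_derivative (p' * (p + q) - p * (p' - q')) / ((p + q) * (p + q))) (at t)"
    by (simp add: step_def[abs_def] divide_inverse)
  moreover have "p' * (p + q) - p * (p' - q') = p' * q + p * q'" by (simp add: algebra_simps)
  then have "(p' * (p + q) - p * (p' - q')) / ((p + q) * (p + q)) \<ge> 0"
    using nn by simp
  ultimately show ?thesis by blast
qed

subsection \<open>Tensor products of test functions\<close>

definition smooth_real :: "(real \<Rightarrow> real) \<Rightarrow> bool" where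
  "smooth_real f \<longleftrightarrow> (\<forall>n. Cdiff n f)"

text \<open>Each order n comes with its own witness for the derivative; since derivatives are
  unique, all witnesses coincide with \<open>deriv f\<close>.\<close>

lemma smooth_real_deriv:
  assumes "smooth_real f"
  shows "(f has_real_derivative deriv f t) (at t)" "smooth_real (deriv f)"
proof -
  have *: "\<exists>f'. (\<forall>t. (f has_real_derivative f' t) (at t)) \<and> Cdiff n f'" for n
    using assms Cdiff.simps(2)[of n f] by (auto simp only: smooth_real_def)
  then obtain f' where "\<forall>t. (f has_real_derivative f' t) (at t)" by blast
  then show "(f has_real_derivative deriv f t) (at t)"
    by (metis DERIV_imp_deriv)
  have "Cdiff n (deriv f)" for n
  proof -
    obtain f' where "\<forall>t. (f has_real_derivative f' t) (at t)" "Cdiff n f'" using * by blast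
    then have "f' = deriv f" by (metis DERIV_imp_deriv ext)
    with \<open>Cdiff n f'\<close> show ?thesis by simp
  qed
  then show "smooth_real (deriv f)" by (simp add: smooth_real_def)
qed

lemma smooth_real_continuous: "smooth_real f \<Longrightarrow> continuous_on A f"
  using smooth_real_deriv(1) DERIV_isCont continuous_at_imp_continuous_on by blast

lemma smooth_real_measurable: "smooth_real f \<Longrightarrow> f \<in> borel_measurable borel"
  using smooth_real_continuous borel_measurable_continuous_onI by blast

definition bump :: "(real \<Rightarrow> real) \<Rightarrow> bool" where
  "bump f \<longleftrightarrow> smooth_real f \<and> (\<exists>a b. 0 < a \<and> b < 1 \<and> (\<forall>t. t \<notin> {a..b} \<longrightarrow> f t = 0))"

definition tensor :: "nat set \<Rightarrow> (nat \<Rightarrow> real \<Rightarrow> real) \<Rightarrow> (nat \<Rightarrow> real) \<Rightarrow> real" where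
  "tensor S F x = (\<Prod>j\<in>S. F j (x j))"

lemma tensor_remove:
  "finite S \<Longrightarrow> i \<in> S \<Longrightarrow> tensor S F (x(i := t)) = F i t * (\<Prod>j\<in>S - {i}. F j (x j))"
  unfolding tensor_def by (subst prod.remove[of S i]) (auto intro!: prod.cong)

lemma tensor_deriv:
  assumes "finite S" "i \<in> S" "\<And>t. (F i has_real_derivative F' t) (at t)"
  shows "((\<lambda>t. tensor S F (x(i := t))) has_real_derivative tensor S (F(i := F')) x) (at (x i))"
proof -
  have "((\<lambda>t. F i t * (\<Prod>j\<in>S - {i}. F j (x j))) has_real_derivative
       F' (x i) * (\<Prod>j\<in>S - {i}. F j (x j))) (at (x i))"
    using assms(3) by (intro DERIV_cmult_right)
  moreover have "tensor S (F(i := F')) x = F' (x i) * (\<Prod>j\<in>S - {i}. F j (x j))"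
    using tensor_remove[OF assms(1,2), of "F(i := F')" x "x i"] by simp
  ultimately show ?thesis using tensor_remove[OF assms(1,2)] by simp
qed

lemma partial_deriv_tensor:
  assumes "finite S" "i \<in> S" "smooth_real (F i)"
  shows "partial_deriv i (tensor S F) = tensor S (F(i := deriv (F i)))"
  using tensor_deriv[of S i F "deriv (F i)", OF assms(1,2) smooth_real_deriv(1)[OF assms(3)]]
  by (auto simp: partial_deriv_def fun_eq_iff intro: DERIV_imp_deriv)

lemma foldr_partial_deriv_tensor:
  assumes "finite S" "set is \<subseteq> S" "\<And>j. j \<in> S \<Longrightarrow> smooth_real (F j)"
  obtains G where "\<And>j. j \<in> S \<Longrightarrow> smooth_real (G j)" "foldr partial_deriv is (tensor S F) = tensor S G"
proof -
  have "\<exists>G. (\<forall>j\<in>S. smooth_real (G j)) \<and> foldr partial_deriv is (tensor S F) = tensor S G"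
    using assms(2)
  proof (induction "is")
    case Nil
    with assms(3) show ?case by auto
  next
    case (Cons i "is")
    then obtain G where G: "\<forall>j\<in>S. smooth_real (G j)" "foldr partial_deriv is (tensor S F) = tensor S G"
      by auto
    have "foldr partial_deriv (i # is) (tensor S F) = tensor S (G(i := deriv (G i)))"
      using G Cons.prems partial_deriv_tensor[OF assms(1)] by simp
    moreover have "\<forall>j\<in>S. smooth_real ((G(i := deriv (G i))) j)"
      using G smooth_real_deriv(2) by simp
    ultimately show ?case by blast
  qed
  with that show thesis by blast
qed

lemma continuous_on_tensor:
  assumes "finite S" "\<And>j. j \<in> S \<Longrightarrow> continuous_on UNIV (F j)"
  shows "continuous_on A (tensor S F)"
proof -
  have "continuous_on A (\<lambda>x. F j (x j))" if "j \<in> S" for j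
    using continuous_on_subset[OF continuous_on_product_coordinates]
    by (intro continuous_on_compose2[OF assms(2)[OF that]]) auto
  then show ?thesis
    unfolding tensor_def by (intro continuous_on_prod) auto
qed

lemma smooth_fun_tensor:
  assumes "\<And>j. j \<in> {1..s} \<Longrightarrow> smooth_real (F j)"
  shows "smooth_fun s (tensor {1..s} F)"
  unfolding smooth_fun_def
proof (intro allI impI conjI ballI)
  fix "is" assume "set is \<subseteq> {1..s}"
  then obtain G where G: "\<And>j. j \<in> {1..s} \<Longrightarrow> smooth_real (G j)"
      "foldr partial_deriv is (tensor {1..s} F) = tensor {1..s} G"
    using foldr_partial_deriv_tensor[of "{1..s}" "is" F] assms by auto
  show "continuous_on ({1..s} \<rightarrow>\<^sub>E UNIV) (foldr partial_deriv is (tensor {1..s} F))"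
    using G smooth_real_continuous by (auto intro!: continuous_on_tensor)
  fix i and x :: "nat \<Rightarrow> real" assume "i \<in> {1..s}"
  then show "(\<lambda>t. foldr partial_deriv is (tensor {1..s} F) (x(i := t))) differentiable at (x i)"
    using tensor_deriv[of "{1..s}" i G "deriv (G i)" x] G smooth_real_deriv(1)
    by (metis finite_atLeastAtMost real_differentiable_def)
qed

text \<open>Extensional functions form a full product whose factors outside \<open>S\<close> are the
  singleton \<open>{undefined}\<close>, so Tychonoff's theorem applies.\<close>

lemma compact_box: "compact (S \<rightarrow>\<^sub>E {a..b::real})"
proof -
  define X where "X i = (if i \<in> S then {a..b} else {undefined})" for i :: 'a
  have "(S \<rightarrow>\<^sub>E {a..b}) = PiE UNIV X"
    by (auto simp: X_def PiE_iff extensional_def split: if_splits)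
  moreover have "compactin (product_topology (\<lambda>i. euclidean) UNIV) (PiE UNIV X)"
    unfolding compactin_PiE by (auto simp: X_def)
  ultimately show ?thesis
    by (simp add: euclidean_product_topology)
qed

lemma test_fun_tensor:
  assumes "\<And>j. j \<in> {1..s} \<Longrightarrow> bump (F j)"
  shows "test_fun s (tensor {1..s} F)"
proof -
  have "\<forall>j\<in>{1..s}. \<exists>a b. 0 < a \<and> b < 1 \<and> (\<forall>t. t \<notin> {a..b} \<longrightarrow> F j t = 0)"
    using assms by (auto simp: bump_def)
  then obtain a b where ab: "\<And>j. j \<in> {1..s} \<Longrightarrow> 0 < a j \<and> b j < 1 \<and> (\<forall>t. t \<notin> {a j..b j} \<longrightarrow> F j t = 0)"
    by metis
  \<comment> \<open>A common support interval for all coordinates. The inserted values 1 and 0 make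
    the minimum and maximum meaningful for s = 0 while keeping 0 < a' and b' < 1.\<close>
  define a' where "a' = Min (insert 1 (a ` {1..s}))"
  define b' where "b' = Max (insert 0 (b ` {1..s}))"
  have a': "0 < a'" "\<And>j. j \<in> {1..s} \<Longrightarrow> a' \<le> a j" and b': "b' < 1" "\<And>j. j \<in> {1..s} \<Longrightarrow> b j \<le> b'"
    using ab unfolding a'_def b'_def
    by (auto simp del: Min_insert Max_insert intro!: Min_le Max_ge)
  define K where "K = ({1..s} \<rightarrow>\<^sub>E {a'..b'})"
  have "compact K" by (simp add: K_def compact_box)
  moreover have "K \<subseteq> {1..s} \<rightarrow>\<^sub>E {0<..<1}" using a' b' by (auto simp: K_def PiE_iff) force+
  moreover have "tensor {1..s} F x = 0" if x: "x \<in> ({1..s} \<rightarrow>\<^sub>E UNIV) - K" for x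
  proof -
    obtain j where j: "j \<in> {1..s}" "x j \<notin> {a'..b'}" using x by (auto simp: K_def PiE_iff)
    then have "x j \<notin> {a j..b j}" using a'(2)[of j] b'(2)[of j] by force
    then have "F j (x j) = 0" using ab j(1) by blast
    with j(1) show ?thesis by (auto simp: tensor_def)
  qed
  moreover have "smooth_fun s (tensor {1..s} F)"
    using assms unfolding bump_def by (intro smooth_fun_tensor) blast
  ultimately show ?thesis unfolding test_fun_def by blast
qed

text \<open>Distinctness of the list guarantees that each factor is differentiated at most
  once.\<close>

lemma mixed_partial_tensor:
  assumes "finite S" "u \<subseteq> S" "\<And>j. j \<in> S \<Longrightarrow> smooth_real (F j)"
  shows "mixed_partial u (tensor S F) = tensor S (\<lambda>j. if j \<in> u then deriv (F j) else F j)"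
proof -
  have "foldr partial_deriv is (tensor S F) = tensor S (\<lambda>j. if j \<in> set is then deriv (F j) else F j)"
    if "distinct is" "set is \<subseteq> S" for "is"
    using that
  proof (induction "is")
    case (Cons i "is")
    let ?G = "\<lambda>j. if j \<in> set is then deriv (F j) else F j"
    have "foldr partial_deriv (i # is) (tensor S F) = partial_deriv i (tensor S ?G)"
      using Cons by simp
    also have "\<dots> = tensor S (?G(i := deriv (?G i)))"
      using Cons.prems assms by (intro partial_deriv_tensor) auto
    also have "?G(i := deriv (?G i)) = (\<lambda>j. if j \<in> set (i # is) then deriv (F j) else F j)"
      using Cons.prems by auto
    finally show ?case .
  qed simp
  from this[of "sorted_list_of_set u"] assms finite_subset[OF assms(2,1)] show ?thesis
    by (simp add: mixed_partial_def)
qed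

subsection \<open>Integration over the cube\<close>

abbreviation unit_measure :: "real measure" where
  "unit_measure \<equiv> restrict_space lborel {0..1}"

lemma prob_space_unit: "prob_space unit_measure"
  by (rule prob_space_restrict_space) auto

interpretation unit: prob_space unit_measure by (rule prob_space_unit)

interpretation unit_prod: product_sigma_finite "\<lambda>_::nat. unit_measure"
  by (simp add: product_sigma_finite_def unit.sigma_finite_measure_axioms)

lemma prob_space_cube: "prob_space (cube_measure u)"
  unfolding cube_measure_def by (intro prob_space_PiM prob_space_unit)

interpretation cube: prob_space "cube_measure u" for u by (rule prob_space_cube)

lemma space_unit: "space unit_measure = {0..1}"
  by (simp add: space_restrict_space)

lemma space_cube: "space (cube_measure u) = unit_cube u"
  by (simp add: cube_measure_def space_PiM unit_cube_def space_unit)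

lemma measurable_unit: "f \<in> borel_measurable borel \<Longrightarrow> f \<in> borel_measurable unit_measure"
  by (intro measurable_restrict_space1) simp

lemma measurable_cube_component:
  "j \<in> u \<Longrightarrow> (\<lambda>x. x j) \<in> measurable (cube_measure u) unit_measure"
  unfolding cube_measure_def by (rule measurable_component_singleton)

lemma measurable_cube_comp:
  "j \<in> u \<Longrightarrow> f \<in> borel_measurable unit_measure \<Longrightarrow> (\<lambda>x. f (x j)) \<in> borel_measurable (cube_measure u)"
  by (rule measurable_compose[OF measurable_cube_component])

lemma measurable_tensor:
  "(\<And>j. j \<in> u \<Longrightarrow> F j \<in> borel_measurable unit_measure) \<Longrightarrow> v \<subseteq> u \<Longrightarrow>
    tensor v F \<in> borel_measurable (cube_measure u)"
  unfolding tensor_def by (intro borel_measurable_prod measurable_cube_comp) auto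

text \<open>Relates the product sigma-algebra to the topology of the function space: the index type
  is countable, so measurability of all coordinates makes the inclusion Borel measurable.
  Coordinates outside \<open>u\<close> are constantly \<open>undefined\<close> on the cube.\<close>

lemma continuous_on_cube_measurable:
  assumes "continuous_on (unit_cube u) f"
  shows "f \<in> borel_measurable (cube_measure u)"
proof -
  have id: "(\<lambda>x. x) \<in> measurable (cube_measure u) (borel :: (nat \<Rightarrow> real) measure)"
  proof (rule measurable_coordinatewise_then_product)
    fix i show "(\<lambda>x. x i) \<in> borel_measurable (cube_measure u)"
    proof (cases "i \<in> u")
      case True
      then show ?thesis by (intro measurable_cube_comp[of _ _ "\<lambda>x. x"] measurable_unit) auto
    next
      case False
      have "(\<lambda>x. undefined) \<in> borel_measurable (cube_measure u)" by simp
      then show ?thesis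
        by (rule measurable_cong[THEN iffD1, rotated])
           (use False in \<open>auto simp: space_cube unit_cube_def PiE_iff extensional_def\<close>)
    qed
  qed
  have "(\<lambda>x. x) \<in> measurable (cube_measure u) (restrict_space borel (unit_cube u))"
    by (rule measurable_restrict_space2[OF _ id]) (simp add: space_cube)
  with borel_measurable_continuous_on_restrict[OF assms] show ?thesis
    using measurable_compose by blast
qed

lemma continuous_on_cube_bounded:
  assumes "continuous_on (unit_cube u) (f :: _ \<Rightarrow> real)"
  obtains B where "0 \<le> B" "\<And>x. x \<in> unit_cube u \<Longrightarrow> \<bar>f x\<bar> \<le> B"
proof -
  have "compact (f ` unit_cube u)"
    using compact_continuous_image[OF assms] compact_box[of u 0 1] by (simp add: unit_cube_def)
  then obtain B where "\<forall>y\<in>f ` unit_cube u. norm y \<le> B"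
    using compact_imp_bounded bounded_iff by metis
  then show thesis
    by (intro that[of "max 0 B"]) (auto simp: le_max_iff_disj)
qed

lemma bounded_cube_integrable:
  fixes f :: "_ \<Rightarrow> real"
  assumes "f \<in> borel_measurable (cube_measure u)" "\<And>x. x \<in> unit_cube u \<Longrightarrow> \<bar>f x\<bar> \<le> B"
  shows "integrable (cube_measure u) f"
  by (rule cube.integrable_const_bound[of _ B]) (use assms in \<open>auto simp: space_cube intro!: AE_I2\<close>)

lemma continuous_on_cube_integrable:
  fixes f :: "_ \<Rightarrow> real"
  assumes "continuous_on (unit_cube u) f"
  shows "integrable (cube_measure u) f"
  using continuous_on_cube_bounded[OF assms] bounded_cube_integrable continuous_on_cube_measurable[OF assms]
  by metis

lemma AE_unit_interior: "AE t in unit_measure. 0 < t \<and> t < 1"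
proof -
  have "AE t in lborel. t \<noteq> (0::real) \<and> t \<noteq> 1"
    using AE_lborel_singleton[of "0::real"] AE_lborel_singleton[of "1::real"] by eventually_elim auto
  then show ?thesis
    by (subst AE_restrict_space_iff) (auto elim: eventually_mono)
qed

lemma AE_cube_interior:
  "finite u \<Longrightarrow> AE x in cube_measure u. \<forall>j\<in>u. 0 < x j \<and> x j < 1"
  unfolding cube_measure_def
  by (intro AE_finite_allI AE_PiM_component[where P = "\<lambda>t. 0 < t \<and> t < 1"] prob_space_unit AE_unit_interior)

lemma bounded_unit_integrable:
  fixes f :: "_ \<Rightarrow> real"
  assumes "f \<in> borel_measurable unit_measure" "\<And>x. x \<in> {0..1} \<Longrightarrow> \<bar>f x\<bar> \<le> B"
  shows "integrable unit_measure f"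
  by (rule unit.integrable_const_bound[of _ B]) (use assms in \<open>auto simp: space_unit intro!: AE_I2\<close>)

lemma unit_integral_eq:
  fixes f :: "_ \<Rightarrow> real"
  assumes "f \<in> borel_measurable unit_measure" "\<And>x. x \<in> {0..1} \<Longrightarrow> \<bar>f x\<bar> \<le> B"
    "(f has_integral I) {0..1}"
  shows "integral\<^sup>L unit_measure f = I"
proof -
  have "integrable unit_measure f" by (rule bounded_unit_integrable) fact+
  then have "set_integrable lborel {0..1} f"
    by (subst (asm) integrable_restrict_space) (auto simp: set_integrable_def)
  from set_borel_integral_eq_integral(2)[OF this] show ?thesis
    using assms(3) by (subst integral_restrict_space) (auto simp: set_lebesgue_integral_def integral_unique)
qed

text \<open>The finite exceptional set accommodates the kink of \<open>eta x\<close> and the jump of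
  \<open>kap x\<close>.\<close>

lemma unit_integral_FTC:
  fixes f :: "_ \<Rightarrow> real"
  assumes "f \<in> borel_measurable unit_measure" "\<And>x. x \<in> {0..1} \<Longrightarrow> \<bar>f x\<bar> \<le> B" "finite S"
    "\<And>t. t \<in> {0<..<1} - S \<Longrightarrow> (F has_real_derivative f t) (at t)" "continuous_on {0..1} F"
  shows "integral\<^sup>L unit_measure f = F 1 - F 0"
proof (rule unit_integral_eq[OF assms(1,2)])
  show "(f has_integral F 1 - F 0) {0..1}"
    using assms(4) has_real_derivative_iff_has_vector_derivative
    by (intro fundamental_theorem_of_calculus_interior_strong[OF assms(3) _ _ assms(5)]) auto
qed

lemma integral_tensor:
  assumes "finite u" "\<And>j. j \<in> u \<Longrightarrow> integrable unit_measure (F j)"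
  shows "(\<integral>x. tensor u F x \<partial>cube_measure u) = (\<Prod>j\<in>u. integral\<^sup>L unit_measure (F j))"
  unfolding tensor_def cube_measure_def by (rule unit_prod.product_integral_prod[OF assms])

text \<open>The reproducing kernel of the one-dimensional space with weight \<open>g\<close> is \<open>1 + g * eta x y\<close>.\<close>

definition kap :: "real \<Rightarrow> real \<Rightarrow> real" where
  "kap x t = t - (if x < t then 1 else 0)"

text \<open>On the unit square this equals B_2({x - t}) / 2 + (x - 1/2) (t - 1/2), the bracket of
  the known error formula. In the form with \<open>max\<close> it is visible that a common
  translation of x and t creates no kink.\<close>

definition eta :: "real \<Rightarrow> real \<Rightarrow> real" where
  "eta x t = (x\<^sup>2 + t\<^sup>2) / 2 - max x t + 1 / 3"

lemma kap_measurable [measurable]: "kap x \<in> borel_measurable borel"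
  unfolding kap_def[abs_def] by measurable

lemma eta_measurable [measurable]: "eta x \<in> borel_measurable borel"
  unfolding eta_def[abs_def] by measurable

lemma kap_bound: "t \<in> {0..1} \<Longrightarrow> \<bar>kap x t\<bar> \<le> 1"
  by (auto simp: kap_def)

text \<open>With m the maximum, both squares are at most m^2 and m^2 is at most m, giving the upper
  bound; below, the value is at least (m - 1)^2 / 2 - 1/6. The upper bound 1/3 is attained at the
  corners (0,0) and (1,1).\<close>

lemma eta_bound:
  assumes "x \<in> {0..1}" "t \<in> {0..1}"
  shows "\<bar>eta x t\<bar> \<le> 1 / 3"
proof -
  define m where "m = max x t"
  have m: "0 \<le> m" "m \<le> 1" using assms by (auto simp: m_def)
  have "x\<^sup>2 \<le> m\<^sup>2" "t\<^sup>2 \<le> m\<^sup>2" using assms by (auto simp: m_def intro!: power_mono)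
  moreover have "m\<^sup>2 \<le> m" using m by (simp add: power2_eq_square mult_left_le)
  ultimately have "eta x t \<le> 1 / 3" by (simp add: eta_def m_def)
  moreover have "x\<^sup>2 + t\<^sup>2 \<ge> m\<^sup>2" by (auto simp: m_def max_def)
  then have "eta x t \<ge> m\<^sup>2 / 2 - m + 1 / 3" by (simp add: eta_def m_def)
  moreover have "m\<^sup>2 / 2 - m + 1 / 2 \<ge> 0"
    using zero_le_power2[of "m - 1"] by (simp add: power2_eq_square algebra_simps)
  ultimately show ?thesis by simp
qed

lemma max_deriv:
  fixes c t :: real
  assumes "t \<noteq> c"
  shows "((\<lambda>t. max c t) has_real_derivative (if c < t then 1 else 0)) (at t)"
proof (cases "c < t")
  case True
  have "((\<lambda>t. t) has_real_derivative 1) (at t)" by simp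
  then have "((\<lambda>t. max c t) has_real_derivative 1) (at t)"
    by (rule has_field_derivative_transform_within_open[where S = "{c<..}"]) (use True in auto)
  with True show ?thesis by simp
next
  case False
  have "((\<lambda>t. c) has_real_derivative 0) (at t)" by simp
  then have "((\<lambda>t. max c t) has_real_derivative 0) (at t)"
    by (rule has_field_derivative_transform_within_open[where S = "{..<c}"]) (use False assms in auto)
  with False show ?thesis by simp
qed

lemma eta_deriv: "t \<noteq> x \<Longrightarrow> (eta x has_real_derivative kap x t) (at t)"
  unfolding eta_def[abs_def] kap_def
  by (auto intro!: derivative_eq_intros max_deriv[where c = x])

lemma eta_continuous: "continuous_on A (eta x)"
  unfolding eta_def[abs_def] by (intro continuous_intros) auto

lemma integral_eta:
  assumes "x \<in> {0..1}"
  shows "integral\<^sup>L unit_measure (eta x) = 0"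
proof -
  \<comment> \<open>The bracket with \<open>max\<close> is a continuous primitive of
    \<open>max x t\<close>: up to t = x it grows with slope x, afterwards with slope t.\<close>
  define F where "F t = (x\<^sup>2 * t + t ^ 3 / 3) / 2 - ((max x t)\<^sup>2 / 2 + x * (t + x - max x t)) + t / 3" for t
  have "integral\<^sup>L unit_measure (eta x) = F 1 - F 0"
  proof (rule unit_integral_FTC[where S = "{x}" and B = "1 / 3"])
    show "(F has_real_derivative eta x t) (at t)" if "t \<in> {0<..<1} - {x}" for t
      using that unfolding F_def[abs_def] eta_def
      by (auto intro!: derivative_eq_intros max_deriv[where c = x] simp: field_simps power2_eq_square)
    show "continuous_on {0..1} F"
      unfolding F_def[abs_def] by (intro continuous_intros) auto
  qed (use eta_bound[OF assms] in \<open>auto intro!: measurable_unit\<close>)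
  also have "\<dots> = 0" using assms by (simp add: F_def max_def power2_eq_square field_simps)
  finally show ?thesis .
qed

lemma integral_kap_kap:
  assumes "x \<in> {0..1}" "y \<in> {0..1}"
  shows "(\<integral>t. kap x t * kap y t \<partial>unit_measure) = eta x y"
proof -
  \<comment> \<open>Primitive of t^2 - t [x < t] - t [y < t] + [max x y < t]; the product of the two
    indicators is the indicator for the larger threshold.\<close>
  define F where "F t = t ^ 3 / 3 - (max x t)\<^sup>2 / 2 - (max y t)\<^sup>2 / 2 + max (max x y) t" for t
  have "(\<integral>t. kap x t * kap y t \<partial>unit_measure) = F 1 - F 0"
  proof (rule unit_integral_FTC[where S = "{x, y}" and B = 1])
    show "(F has_real_derivative kap x t * kap y t) (at t)" if "t \<in> {0<..<1} - {x, y}" for t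
      using that unfolding F_def[abs_def] kap_def
      by (auto intro!: derivative_eq_intros max_deriv[where c = x] max_deriv[where c = y]
           max_deriv[where c = "max x y"] simp: field_simps power2_eq_square)
    show "continuous_on {0..1} F"
      unfolding F_def[abs_def] by (intro continuous_intros) auto
    show "\<bar>kap x t * kap y t\<bar> \<le> 1" if "t \<in> {0..1}" for t
      using kap_bound[OF that, of x] kap_bound[OF that, of y] by (auto simp: abs_mult intro!: mult_le_one)
  qed (auto intro!: measurable_unit)
  also have "\<dots> = eta x y"
    using assms by (cases "x \<le> 0"; cases "y \<le> 0")
      (auto simp add: F_def eta_def max_def power2_eq_square field_simps)
  finally show ?thesis .
qed

subsection \<open>Approximate units on the unit interval\<close>

lemma step_bounds: "0 \<le> step t" "step t \<le> 1"
  using flat_nonneg[of 0 t] flat_nonneg[of 0 "1 - t"] step_denom_pos[of t]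
  by (auto simp: step_def field_simps)

lemma smooth_real_step: "smooth_real step"
  by (simp add: smooth_real_def Cdiff_step)

lemma smooth_real_affine: "smooth_real f \<Longrightarrow> smooth_real (\<lambda>t. f (a * t + b))"
  by (simp add: smooth_real_def Cdiff_affine)

lemma smooth_real_diff: "smooth_real f \<Longrightarrow> smooth_real g \<Longrightarrow> smooth_real (\<lambda>t. f t - g t)"
  by (simp add: smooth_real_def Cdiff_diff)

lemma smooth_real_cmult: "smooth_real f \<Longrightarrow> smooth_real (\<lambda>t. c * f t)"
  by (simp add: smooth_real_def Cdiff_cmult)

lemma deriv_step_nonneg: "deriv step t \<ge> 0"
  using step_differentiable[of t] DERIV_imp_deriv by metis

text \<open>A smoothed positive part in closed form. Its derivative is a smooth transition from 0 to
  1 with an elementary primitive, so that the primitive of \<open>plateau\<close> can be written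
  down explicitly in \<open>approx_kap\<close>.\<close>

definition ramp :: "real \<Rightarrow> real" where
  "ramp t = t * step t"

lemma smooth_real_ramp: "smooth_real ramp"
  unfolding smooth_real_def ramp_def[abs_def] by (auto intro!: Cdiff_mult Cdiff_ident Cdiff_step)

lemma ramp_eq: "t \<le> 0 \<Longrightarrow> ramp t = 0" "t \<ge> 1 \<Longrightarrow> ramp t = t"
  by (auto simp: ramp_def step_eq_0 step_eq_1)

lemma deriv_eq_on_open:
  assumes "(f has_real_derivative D) (at t)" "open S" "t \<in> S" "\<And>u. u \<in> S \<Longrightarrow> f u = g u"
  shows "deriv g t = D"
  using has_field_derivative_transform_within_open[OF assms] by (intro DERIV_imp_deriv)

lemma deriv_ramp_eq: "t < 0 \<Longrightarrow> deriv ramp t = 0" "t > 1 \<Longrightarrow> deriv ramp t = 1"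
  by (rule deriv_eq_on_open[where f = "\<lambda>_. 0" and S = "{..<0}"]; auto simp: ramp_eq)
     (rule deriv_eq_on_open[where f = "\<lambda>t. t" and S = "{1<..}"]; auto simp: ramp_eq)

lemma deriv_step_eq: "t < 0 \<Longrightarrow> deriv step t = 0" "t > 1 \<Longrightarrow> deriv step t = 0"
  by (rule deriv_eq_on_open[where f = "\<lambda>_. 0" and S = "{..<0}"]; auto simp: step_eq_0)
     (rule deriv_eq_on_open[where f = "\<lambda>_. 1" and S = "{1<..}"]; auto simp: step_eq_1)

lemma deriv_ramp_bounded: obtains C where "C \<ge> 0" "\<And>t. \<bar>deriv ramp t\<bar> \<le> C"
proof -
  have "continuous_on {0..1} (deriv ramp)"
    using smooth_real_deriv(2)[OF smooth_real_ramp] smooth_real_continuous by blast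
  then have "compact (deriv ramp ` {0..1})" by (intro compact_continuous_image) auto
  then obtain B where B: "\<forall>y\<in>deriv ramp ` {0..1}. norm y \<le> B"
    using compact_imp_bounded bounded_iff by metis
  have "\<bar>deriv ramp t\<bar> \<le> max B 1" for t
    using B deriv_ramp_eq[of t] by (cases "t < 0"; cases "t > 1") (auto simp: le_max_iff_disj)
  then show thesis by (intro that[of "max B 1"]) auto
qed

text \<open>For \<open>r \<rightarrow> \<infinity>\<close>, \<open>plateau r\<close> tends to 1 on \<open>(0,1)\<close> with total mass 1, \<open>approx_delta r x\<close> to the
  Dirac mass at \<open>x\<close>, and \<open>approx_kap r x\<close>, the primitive of their difference, to \<open>kap x\<close>. The
  breakpoints are chosen such that this primitive has compact support.\<close>

definition plateau :: "real \<Rightarrow> real \<Rightarrow> real" where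
  "plateau r t = r / (r - 3) * (deriv ramp (r * t + (- 1)) - deriv ramp (r * t + (2 - r)))"

definition approx_kap :: "real \<Rightarrow> real \<Rightarrow> real \<Rightarrow> real" where
  "approx_kap r x t =
     1 / (r - 3) * (ramp (r * t + (- 1)) - ramp (r * t + (2 - r))) - step (r * t + (- r * x - 1))"

definition approx_delta :: "real \<Rightarrow> real \<Rightarrow> real \<Rightarrow> real" where
  "approx_delta r x t = r * deriv step (r * t + (- r * x - 1))"

text \<open>Rises to 1 just to the right of x and returns to 0 before 1. This compactly supported
  substitute for the indicator of t > x supplies the test functions of the fundamental
  lemma.\<close>

definition approx_ray :: "real \<Rightarrow> real \<Rightarrow> real \<Rightarrow> real" where
  "approx_ray r x t = step (r * t + (- r * x - 1)) - step (r * t + (2 - r))"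

lemma smooth_real_approx:
  "smooth_real (plateau r)" "smooth_real (approx_kap r x)" "smooth_real (approx_delta r x)"
  "smooth_real (approx_ray r x)"
  unfolding plateau_def[abs_def] approx_kap_def[abs_def] approx_delta_def[abs_def] approx_ray_def[abs_def]
  by (intro smooth_real_cmult smooth_real_diff smooth_real_affine smooth_real_ramp smooth_real_step
      smooth_real_deriv(2))+

lemma chain_affine:
  assumes "smooth_real f"
  shows "((\<lambda>t. f (a * t + b)) has_real_derivative deriv f (a * t + b) * a) (at t)"
proof -
  have "((\<lambda>t. a * t + b) has_real_derivative a) (at t)"
    by (auto intro!: derivative_eq_intros)
  from DERIV_chain2[where f = f and g = "\<lambda>t. a * t + b", OF smooth_real_deriv(1)[OF assms] this]
  show ?thesis .
qed

lemma deriv_approx_kap: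
  "deriv (approx_kap r x) t = plateau r t - approx_delta r x t"
proof (rule DERIV_imp_deriv)
  show "(approx_kap r x has_real_derivative plateau r t - approx_delta r x t) (at t)"
    unfolding approx_kap_def[abs_def]
    by (rule derivative_eq_intros chain_affine smooth_real_ramp smooth_real_step refl)+
       (simp add: plateau_def approx_delta_def field_simps)
qed

lemma scale_bounds:
  assumes "r \<ge> (4::real)" 
  shows "t < 1 / r \<Longrightarrow> r * t < 1" "t > 1 - 1 / r \<Longrightarrow> r * t > r - 1"
  using assms by (auto simp: field_simps)

lemma bumpI:
  assumes "smooth_real f" "r \<ge> 4" "\<And>t. r * t < 1 \<Longrightarrow> f t = 0" "\<And>t. r * t > r - 1 \<Longrightarrow> f t = 0"
  shows "bump f"
  unfolding bump_def
  using assms scale_bounds[OF assms(2)]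
  by (intro conjI exI[of _ "1 / r"] exI[of _ "1 - 1 / r"]) force+

lemma bump_plateau: "r \<ge> 4 \<Longrightarrow> bump (plateau r)"
  by (rule bumpI[OF smooth_real_approx(1)]) (auto simp: plateau_def deriv_ramp_eq)

text \<open>Left of 1/r every term vanishes. Right of 1 - 1/r the two ramps differ by exactly r - 3,
  which the prefactor turns into 1, while r (1 - x) >= 3 ensures that the shifted step has also
  reached 1; the two cancel. In the ray, two steps equal to 1 cancel.\<close>

lemma bump_approx:
  assumes "r \<ge> 4" "0 \<le> x" "r * (1 - x) \<ge> 3"
  shows "bump (approx_kap r x)" "bump (approx_ray r x)"
proof -
  have "r * x \<ge> 0" using assms by simp
  moreover have "r * x \<le> r - 3" using assms by (simp add: algebra_simps)
  ultimately show "bump (approx_kap r x)" "bump (approx_ray r x)"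
    using assms(1)
    by (auto intro!: bumpI[where r = r] smooth_real_approx
        simp: approx_kap_def approx_ray_def ramp_eq step_eq_0 step_eq_1 field_simps)
qed

text \<open>The offset 4 keeps r - 3 at least 1 and r / (r - 3) at most 4 for every n.\<close>

definition radius :: "nat \<Rightarrow> real" where
  "radius n = real n + 4"

lemma radius_ge: "radius n \<ge> 4" by (simp add: radius_def)

lemma radius_large: 
  assumes "a < b"
  shows "eventually (\<lambda>n. radius n * (b - a) > c) sequentially"
proof -
  have "b - a > 0" using assms by simp
  then show ?thesis unfolding radius_def by real_asymp
qed

lemma plateau_bound: obtains C where "\<And>n t. \<bar>plateau (radius n) t\<bar> \<le> C"
proof -
  obtain C where C: "C \<ge> 0" "\<And>t. \<bar>deriv ramp t\<bar> \<le> C" using deriv_ramp_bounded by blast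
  have "\<bar>plateau (radius n) t\<bar> \<le> 4 * (2 * C)" for n t
  proof -
    have "\<bar>radius n / (radius n - 3)\<bar> \<le> 4" using radius_ge[of n] by (simp add: field_simps)
    moreover have "\<bar>deriv ramp a - deriv ramp b\<bar> \<le> 2 * C" for a b
      using C(2)[of a] C(2)[of b] by linarith
    ultimately show ?thesis
      using C(1) unfolding plateau_def abs_mult by (intro mult_mono) auto
  qed
  then show thesis using that by blast
qed

lemma ramp_bound: "t \<le> c \<Longrightarrow> 0 \<le> c \<Longrightarrow> \<bar>ramp t\<bar> \<le> c"
  using step_bounds[of t] ramp_eq(1)[of t] mult_mono[of t c "step t" 1]
  by (cases "t \<le> 0") (auto simp: ramp_def)

lemma approx_kap_bound:
  assumes "t \<in> {0..1}"
  shows "\<bar>approx_kap (radius n) x t\<bar> \<le> 10"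
proof -
  define r where "r = radius n"
  have r: "r \<ge> 4" using radius_ge[of n] by (simp add: r_def)
  have rt: "r * t \<le> r" using assms r by (simp add: mult_left_le)
  have "\<bar>ramp (r * t + (- 1))\<bar> \<le> r" using rt r by (intro ramp_bound) linarith+
  moreover have "\<bar>ramp (r * t + (2 - r))\<bar> \<le> 2" using rt r by (intro ramp_bound) linarith+
  \<comment> \<open>The triangle inequality gives r + 2, which is at most 9 (r - 3) for r >= 4. The
    final bound 10 is this 9 plus 1 for the step.\<close>
  ultimately have "\<bar>ramp (r * t + (- 1)) - ramp (r * t + (2 - r))\<bar> \<le> 9 * (r - 3)"
    using r abs_triangle_ineq4[of "ramp (r * t + (- 1))" "ramp (r * t + (2 - r))"] by simp
  then have "\<bar>1 / (r - 3) * (ramp (r * t + (- 1)) - ramp (r * t + (2 - r)))\<bar> \<le> 9"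
    using r by (simp add: abs_mult field_simps)
  then show ?thesis
    using step_bounds[of "r * t + (- r * x - 1)"] unfolding approx_kap_def r_def by linarith
qed

lemma approx_ray_bound: "\<bar>approx_ray r x t\<bar> \<le> 1"
  using step_bounds[of "r * t + (- r * x - 1)"] step_bounds[of "r * t + (2 - r)"]
  by (simp add: approx_ray_def)

lemma plateau_tendsto:
  assumes "0 < t" "t < 1"
  shows "(\<lambda>n. plateau (radius n) t) \<longlonglongrightarrow> 1"
proof -
  have "\<forall>\<^sub>F n in sequentially. radius n / (radius n - 3) = plateau (radius n) t"
    using radius_large[OF assms(1), of 2] radius_large[OF assms(2), of 2]
    by eventually_elim (auto simp: plateau_def deriv_ramp_eq algebra_simps)
  moreover have "(\<lambda>n. radius n / (radius n - 3)) \<longlonglongrightarrow> 1"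
    unfolding radius_def by real_asymp
  ultimately show ?thesis by (rule Lim_transform_eventually[rotated])
qed

text \<open>The offset -1 makes the value at t = x equal to 0 for every n, which agrees with the
  strict inequality in \<open>kap\<close>.\<close>

lemma step_tendsto:
  "(\<lambda>n. step (radius n * t + (- radius n * x - 1))) \<longlonglongrightarrow> (if x < t then 1 else 0)"
proof (cases "x < t")
  case True
  have "\<forall>\<^sub>F n in sequentially. 1 = step (radius n * t + (- radius n * x - 1))"
    using radius_large[OF True, of 2] by eventually_elim (auto simp: step_eq_1 algebra_simps)
  then show ?thesis using True by (auto intro: Lim_transform_eventually[OF tendsto_const])
next
  case False
  have "step (radius n * t + (- radius n * x - 1)) = 0" for n
  proof (rule step_eq_0)
    have "radius n * t \<le> radius n * x"
      using False radius_ge[of n] by (intro mult_left_mono) auto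
    then show "radius n * t + (- radius n * x - 1) \<le> 0" by simp
  qed
  with False show ?thesis by simp
qed

lemma approx_ray_tendsto:
  assumes "0 < t" "t < 1"
  shows "(\<lambda>n. approx_ray (radius n) x t) \<longlonglongrightarrow> indicator {x<..} t"
proof -
  have "\<forall>\<^sub>F n in sequentially. step (radius n * t + (- radius n * x - 1)) = approx_ray (radius n) x t"
    using radius_large[OF assms(2), of 2]
    by eventually_elim (auto simp: approx_ray_def step_eq_0 algebra_simps)
  from Lim_transform_eventually[OF step_tendsto this] show ?thesis
    by (auto simp: indicator_def)
qed

lemma approx_kap_tendsto:
  assumes "0 < t" "t < 1"
  shows "(\<lambda>n. approx_kap (radius n) x t) \<longlonglongrightarrow> kap x t"
proof -
  have "\<forall>\<^sub>F n in sequentially. (radius n * t - 1) / (radius n - 3)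
      = 1 / (radius n - 3) * (ramp (radius n * t + (- 1)) - ramp (radius n * t + (2 - radius n)))"
    using radius_large[OF assms(1), of 2] radius_large[OF assms(2), of 2]
    by eventually_elim (auto simp: ramp_eq algebra_simps)
  moreover have "(\<lambda>n. (radius n * t - 1) / (radius n - 3)) \<longlonglongrightarrow> t"
    unfolding radius_def by real_asymp
  ultimately have "(\<lambda>n. 1 / (radius n - 3) *
      (ramp (radius n * t + (- 1)) - ramp (radius n * t + (2 - radius n)))) \<longlonglongrightarrow> t"
    by (rule Lim_transform_eventually[rotated])
  from tendsto_diff[OF this step_tendsto] show ?thesis
    by (simp add: approx_kap_def kap_def)
qed

lemma approx_delta_nonneg: "r \<ge> 4 \<Longrightarrow> approx_delta r x t \<ge> 0"
  by (simp add: approx_delta_def deriv_step_nonneg)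

text \<open>The mass lies between x + 1/r and x + 2/r, strictly to the right of x. Therefore x = 0
  is admissible, while x = 1 is excluded throughout.\<close>

lemma approx_delta_support:
  assumes "r \<ge> 4" "approx_delta r x t \<noteq> 0"
  shows "\<bar>t - x\<bar> \<le> 2 / r"
proof -
  have "0 \<le> r * t + (- r * x - 1)" "r * t + (- r * x - 1) \<le> 1"
    using assms deriv_step_eq[of "r * t + (- r * x - 1)"] by (force simp: approx_delta_def)+
  then have "0 \<le> r * (t - x)" "r * (t - x) \<le> 2" by (auto simp: algebra_simps)
  then have "0 \<le> t - x" "t - x \<le> 2 / r" using assms(1)
    by (auto simp: zero_le_mult_iff field_simps)
  then show ?thesis by simp
qed

lemma smooth_real_bounded_unit:
  assumes "smooth_real f"
  obtains B where "\<And>t. t \<in> {0..1} \<Longrightarrow> \<bar>f t\<bar> \<le> B"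
proof -
  have "compact (f ` {0..1})" by (intro compact_continuous_image smooth_real_continuous assms) auto
  then obtain B where "\<forall>y\<in>f ` {0..1}. norm y \<le> B"
    using compact_imp_bounded bounded_iff by metis
  then have "\<And>t. t \<in> {0..1} \<Longrightarrow> \<bar>f t\<bar> \<le> B" by auto
  then show thesis by (rule that)
qed

lemma smooth_real_integrable: "smooth_real f \<Longrightarrow> integrable unit_measure f"
  using smooth_real_bounded_unit bounded_unit_integrable measurable_unit smooth_real_measurable by metis

lemma integral_approx_delta:
  assumes "r \<ge> 4" "0 \<le> x" "r * (1 - x) \<ge> 3"
  shows "integral\<^sup>L unit_measure (approx_delta r x) = 1"
proof -
  obtain B where B: "\<And>t. t \<in> {0..1} \<Longrightarrow> \<bar>approx_delta r x t\<bar> \<le> B"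
    using smooth_real_bounded_unit[OF smooth_real_approx(3)] by blast
  have "r * x \<ge> 0" using assms by simp
  have "integral\<^sup>L unit_measure (approx_delta r x)
      = step (r * 1 + (- r * x - 1)) - step (r * 0 + (- r * x - 1))"
  proof (rule unit_integral_FTC[where S = "{}" and B = B])
    show "((\<lambda>t. step (r * t + (- r * x - 1))) has_real_derivative approx_delta r x t) (at t)" for t
      using chain_affine[OF smooth_real_step, of r "- r * x - 1" t]
      by (simp add: approx_delta_def mult.commute)
    show "continuous_on {0..1} (\<lambda>t. step (r * t + (- r * x - 1)))"
      by (intro smooth_real_continuous smooth_real_affine smooth_real_step)
  qed (use B in \<open>auto intro!: measurable_unit smooth_real_measurable smooth_real_approx\<close>)
  also have "\<dots> = 1"
  proof -
    have "step (- (r * x) - 1) = 0" using \<open>r * x \<ge> 0\<close> by (intro step_eq_0) linarith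
    moreover have "step (r - r * x - 1) = 1" using assms by (intro step_eq_1) (simp add: algebra_simps)
    ultimately show ?thesis by (simp add: algebra_simps)
  qed
  finally show ?thesis .
qed

subsection \<open>The reproducing formula\<close>

text \<open>A basic open set of the product topology restricts each coordinate separately. Points of
  the cube agree outside \<open>u\<close>, so only the finitely many radii for coordinates in
  \<open>u\<close> count, and their minimum is the required distance.\<close>

lemma continuous_on_cube_delta:
  assumes "finite u" "continuous_on (unit_cube u) f" "x \<in> unit_cube u" "0 < (e::real)"
  obtains d where "0 < d" "\<And>y. y \<in> unit_cube u \<Longrightarrow> (\<And>j. j \<in> u \<Longrightarrow> \<bar>y j - x j\<bar> < d) \<Longrightarrow> \<bar>f y - f x\<bar> < e"
proof -
  have "open (ball (f x) e)" "f x \<in> ball (f x) e" using assms(4) by auto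
  then obtain A where A: "open A" "x \<in> A" "\<And>y. y \<in> unit_cube u \<Longrightarrow> y \<in> A \<Longrightarrow> f y \<in> ball (f x) e"
    using assms(2,3) unfolding continuous_on_topological by metis
  then obtain X where X: "x \<in> PiE UNIV X" "\<And>i. open (X i)" "PiE UNIV X \<subseteq> A"
    using product_topology_open_contains_basis[of "\<lambda>_. euclidean" UNIV A x]
    by (auto simp: open_fun_def)
  have "\<exists>d>0. ball (x j) d \<subseteq> X j" for j
    using X(1,2) by (meson PiE_mem UNIV_I open_contains_ball)
  then obtain d where d: "\<And>j. d j > 0" "\<And>j. ball (x j) (d j) \<subseteq> X j" by metis
  define d' where "d' = Min (insert 1 (d ` u))"
  have d': "d' > 0" "\<And>j. j \<in> u \<Longrightarrow> d' \<le> d j" using assms(1) d by (auto simp: d'_def intro!: Min_le)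
  show thesis
  proof (rule that[OF d'(1)])
    fix y assume y: "y \<in> unit_cube u" "\<And>j. j \<in> u \<Longrightarrow> \<bar>y j - x j\<bar> < d'"
    have "y j \<in> X j" for j
    proof (cases "j \<in> u")
      case True
      then have "y j \<in> ball (x j) (d j)" using y(2)[of j] d'(2)[of j] by (simp add: dist_real_def abs_minus_commute)
      then show ?thesis using d(2) by blast
    next
      case False
      then have "y j = x j" using y(1) assms(3) by (simp add: unit_cube_def PiE_iff extensional_def)
      then show ?thesis using X(1) by auto
    qed
    then have "y \<in> PiE UNIV X" by (simp add: PiE_iff)
    then have "y \<in> A" using X(3) by blast
    from A(3)[OF y(1) this] show "\<bar>f y - f x\<bar> < e" by (simp add: dist_real_def abs_minus_commute)
  qed
qed

lemma tensor_bound: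
  assumes "finite S" "\<And>j. j \<in> S \<Longrightarrow> \<bar>F j (x j)\<bar> \<le> C" 
  shows "\<bar>tensor S F x\<bar> \<le> C ^ card S"
proof -
  have "\<bar>tensor S F x\<bar> = (\<Prod>j\<in>S. \<bar>F j (x j)\<bar>)" by (simp add: tensor_def abs_prod)
  also have "\<dots> \<le> (\<Prod>j\<in>S. C)" using assms(2) by (intro prod_mono) auto
  finally show ?thesis by simp
qed

lemma unit_cubeD: "x \<in> unit_cube u \<Longrightarrow> j \<in> u \<Longrightarrow> x j \<in> {0..1}"
  by (auto simp: unit_cube_def)

lemma integrable_mult_bounded:
  fixes f g :: "_ \<Rightarrow> real"
  assumes "integrable (cube_measure S) g" "f \<in> borel_measurable (cube_measure S)"
    "\<And>x. x \<in> unit_cube S \<Longrightarrow> \<bar>f x\<bar> \<le> B"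
  shows "integrable (cube_measure S) (\<lambda>x. g x * f x)"
proof (rule Bochner_Integration.integrable_bound)
  show "integrable (cube_measure S) (\<lambda>x. B * g x)" using assms(1) by simp
  show "(\<lambda>x. g x * f x) \<in> borel_measurable (cube_measure S)"
    by (rule borel_measurable_times[OF borel_measurable_integrable[OF assms(1)] assms(2)])
  show "AE x in cube_measure S. norm (g x * f x) \<le> norm (B * g x)"
  proof (rule AE_I2)
    fix x assume "x \<in> space (cube_measure S)"
    then have "\<bar>f x\<bar> \<le> \<bar>B\<bar>" using assms(3)[of x] by (simp add: space_cube)
    then show "norm (g x * f x) \<le> norm (B * g x)"
      by (simp add: abs_mult mult.commute mult_right_mono)
  qed
qed

text \<open>Dominated convergence with majorant C^|S| |g|. Convergence of the factors in the open
  interval suffices because the boundary of the cube is a null set.\<close>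

lemma integral_tensor_limit:
  assumes "finite S" "integrable (cube_measure S) g"
    and "\<And>n j. j \<in> S \<Longrightarrow> F n j \<in> borel_measurable borel"
    and "\<And>n j t. j \<in> S \<Longrightarrow> t \<in> {0..1} \<Longrightarrow> \<bar>F n j t\<bar> \<le> C"
    and "\<And>j. j \<in> S \<Longrightarrow> H j \<in> borel_measurable borel"
    and "\<And>j t. j \<in> S \<Longrightarrow> 0 < t \<Longrightarrow> t < 1 \<Longrightarrow> (\<lambda>n. F n j t) \<longlonglongrightarrow> H j t"
  shows "(\<lambda>n. \<integral>x. g x * tensor S (F n) x \<partial>cube_measure S)
      \<longlonglongrightarrow> (\<integral>x. g x * tensor S H x \<partial>cube_measure S)"
proof (rule integral_dominated_convergence)
  have meas: "(\<lambda>x. g x * tensor S K x) \<in> borel_measurable (cube_measure S)"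
    if "\<And>j. j \<in> S \<Longrightarrow> K j \<in> borel_measurable borel" for K
    using that borel_measurable_integrable[OF assms(2)]
    by (intro borel_measurable_times measurable_tensor measurable_unit) auto
  show "(\<lambda>x. g x * tensor S H x) \<in> borel_measurable (cube_measure S)"
    "(\<lambda>x. g x * tensor S (F n) x) \<in> borel_measurable (cube_measure S)" for n
    using meas assms(3,5) by auto
  show "integrable (cube_measure S) (\<lambda>x. C ^ card S * \<bar>g x\<bar>)" using assms(2) by simp
  show "AE x in cube_measure S. (\<lambda>n. g x * tensor S (F n) x) \<longlonglongrightarrow> g x * tensor S H x"
    using AE_cube_interior[OF assms(1)]
    by eventually_elim (auto simp: tensor_def intro!: tendsto_intros assms(6))
  show "AE x in cube_measure S. norm (g x * tensor S (F n) x) \<le> C ^ card S * \<bar>g x\<bar>" for n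
  proof (rule AE_I2)
    fix x assume "x \<in> space (cube_measure S)"
    then have "\<bar>tensor S (F n) x\<bar> \<le> C ^ card S"
      using unit_cubeD by (intro tensor_bound assms(1,4)) (auto simp: space_cube)
    then show "norm (g x * tensor S (F n) x) \<le> C ^ card S * \<bar>g x\<bar>"
      using mult_left_mono[of "\<bar>tensor S (F n) x\<bar>" "C ^ card S" "\<bar>g x\<bar>"]
      by (simp add: abs_mult mult.commute)
  qed
qed

lemma tensor_uminus_split:
  assumes "finite S" "X \<subseteq> S"
  shows "(\<Prod>j\<in>X. - F j (y j)) * (\<Prod>j\<in>S - X. G j (y j))
    = (- 1) ^ card X * tensor S (\<lambda>j. if j \<in> X then F j else G j) y"
proof -
  have "(\<Prod>j\<in>X. - F j (y j)) = (- 1) ^ card X * (\<Prod>j\<in>X. F j (y j))"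
    by (simp add: prod_uminus)
  moreover have "tensor S (\<lambda>j. if j \<in> X then F j else G j) y
      = (\<Prod>j\<in>X. F j (y j)) * (\<Prod>j\<in>S - X. G j (y j))"
    unfolding tensor_def using assms
    by (subst prod.subset_diff[of X S]) (auto simp: mult.commute intro!: arg_cong2[where f = "(*)"] prod.cong)
  ultimately show ?thesis by (simp add: mult.assoc)
qed

lemma tensor_restrict:
  assumes "finite S" "u \<subseteq> S"
  shows "tensor S (\<lambda>j. if j \<in> u then F j else (\<lambda>_. 1)) = tensor u F"
proof
  fix y show "tensor S (\<lambda>j. if j \<in> u then F j else (\<lambda>_. 1)) y = tensor u F y"
    unfolding tensor_def using assms by (intro prod.mono_neutral_cong_right) auto
qed

lemma eventually_radius_bump:
  assumes "finite S" "\<And>j. j \<in> S \<Longrightarrow> x j < 1"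
  shows "eventually (\<lambda>n. \<forall>j\<in>S. radius n * (1 - x j) \<ge> 3) sequentially"
  unfolding eventually_ball_finite_distrib[OF assms(1)]
  using radius_large[of _ 1 3] assms(2) by (force elim: eventually_mono)

lemma approx_delta_tendsto_eval:
  assumes "finite S" "continuous_on (unit_cube S) f" "x \<in> S \<rightarrow>\<^sub>E {0..<1}"
  shows "(\<lambda>n. \<integral>y. f y * tensor S (\<lambda>j. approx_delta (radius n) (x j)) y \<partial>cube_measure S) \<longlonglongrightarrow> f x"
    (is "(\<lambda>n. \<integral>y. f y * ?D n y \<partial>_) \<longlonglongrightarrow> _")
proof (rule tendstoI)
  fix e :: real assume "e > 0"
  then have e2: "e / 2 > 0" by simp
  have x: "x \<in> unit_cube S" "\<And>j. j \<in> S \<Longrightarrow> 0 \<le> x j" "\<And>j. j \<in> S \<Longrightarrow> x j < 1"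
    using assms(3) by (auto simp: unit_cube_def PiE_iff less_imp_le)
  obtain d where d: "0 < d" "\<And>y. y \<in> unit_cube S \<Longrightarrow> (\<And>j. j \<in> S \<Longrightarrow> \<bar>y j - x j\<bar> < d) \<Longrightarrow> \<bar>f y - f x\<bar> < e / 2"
    using continuous_on_cube_delta[OF assms(1,2) x(1) e2] by blast
  have cont: "continuous_on (unit_cube S) (?D n)" for n
    by (intro continuous_on_tensor assms(1) smooth_real_continuous smooth_real_approx)
  have "\<forall>\<^sub>F n in sequentially. radius n * (d - 0) > 2" by (rule radius_large[OF d(1)])
  moreover have "\<forall>\<^sub>F n in sequentially. \<forall>j\<in>S. radius n * (1 - x j) \<ge> 3"
    by (rule eventually_radius_bump[OF assms(1) x(3)])
  ultimately show "\<forall>\<^sub>F n in sequentially. dist (\<integral>y. f y * ?D n y \<partial>cube_measure S) (f x) < e"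
  proof eventually_elim
    case (elim n)
    have r: "radius n \<ge> 4" by (rule radius_ge)
    have nn: "?D n y \<ge> 0" for y
      unfolding tensor_def by (intro prod_nonneg ballI approx_delta_nonneg r)
    have int: "integrable (cube_measure S) (?D n)" "integrable (cube_measure S) (\<lambda>y. f y * ?D n y)"
       "integrable (cube_measure S) (\<lambda>y. f x * ?D n y)"
      by (intro continuous_on_cube_integrable continuous_on_mult assms(2) cont continuous_on_const)+
    have one: "(\<integral>y. ?D n y \<partial>cube_measure S) = 1"
      using elim x r by (subst integral_tensor)
        (auto simp: assms(1) integral_approx_delta smooth_real_integrable smooth_real_approx)
    have "(\<integral>y. f y * ?D n y \<partial>cube_measure S) - f x
        = (\<integral>y. f y * ?D n y - f x * ?D n y \<partial>cube_measure S)"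
      using int one by simp
    moreover have "\<bar>\<integral>y. f y * ?D n y - f x * ?D n y \<partial>cube_measure S\<bar>
        \<le> (\<integral>y. e / 2 * ?D n y \<partial>cube_measure S)"
    proof (rule order_trans[OF integral_abs_bound integral_mono])
      fix y assume "y \<in> space (cube_measure S)"
      then have y: "y \<in> unit_cube S" by (simp add: space_cube)
      show "\<bar>f y * ?D n y - f x * ?D n y\<bar> \<le> e / 2 * ?D n y"
      proof (cases "?D n y = 0")
        case False
        then have "approx_delta (radius n) (x j) (y j) \<noteq> 0" if "j \<in> S" for j
          using that assms(1) by (auto simp: tensor_def)
        then have "\<bar>y j - x j\<bar> \<le> 2 / radius n" if "j \<in> S" for j
          using approx_delta_support[OF r] that by blast
        moreover have "2 / radius n < d" using elim(1) r by (simp add: field_simps)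
        ultimately have "\<bar>f y - f x\<bar> < e / 2" using d(2)[OF y] by force
        then have "\<bar>f y - f x\<bar> * ?D n y \<le> e / 2 * ?D n y"
          using nn by (intro mult_right_mono) auto
        then show ?thesis using nn[of y] by (simp add: left_diff_distrib[symmetric] abs_mult)
      qed simp
    qed (use int in \<open>auto intro!: integrable_abs Bochner_Integration.integrable_diff\<close>)
    ultimately have "\<bar>(\<integral>y. f y * ?D n y \<partial>cube_measure S) - f x\<bar> \<le> e / 2"
      using one by simp
    then show ?case using \<open>e > 0\<close> by (simp add: dist_real_def)
  qed
qed

text \<open>Testing the weak derivative against a tensor product whose mixed derivative is
  \<open>P u\<close> moves all derivatives onto f. The sign (-1)^|u| this produces cancels the one
  from expanding the product of Dirac masses.\<close>

lemma reproducing: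
  assumes f: "continuous_on (unit_cube {1..s}) f"
    and g: "\<And>u. u \<subseteq> {1..s} \<Longrightarrow> u \<noteq> {} \<Longrightarrow>
       integrable (cube_measure {1..s}) (g u) \<and> has_weak_mixed_deriv s u f (g u)"
    and x: "x \<in> {1..s} \<rightarrow>\<^sub>E {0..<1}"
  shows "f x = cube_integral s f + (\<Sum>u\<in>Pow {1..s} - {{}}.
     \<integral>y. g u y * tensor u (\<lambda>j. kap (x j)) y \<partial>cube_measure {1..s})"
proof -
  define S where "S = {1..s}"
  have fin: "finite S" by (simp add: S_def)
  have x': "\<And>j. j \<in> S \<Longrightarrow> 0 \<le> x j" "\<And>j. j \<in> S \<Longrightarrow> x j < 1"
    using x by (auto simp: S_def PiE_iff)
  have fint: "integrable (cube_measure S) f"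
    using continuous_on_cube_integrable f by (simp add: S_def)
  \<comment> \<open>For the empty set f itself takes the place of a weak derivative, so that this
    term converges to the integral of f.\<close>
  define G where "G u = (if u = {} then f else g u)" for u
  have Gint: "integrable (cube_measure S) (G u)" if "u \<subseteq> S" for u
    using that fint g by (auto simp: G_def S_def)
  define F where "F n u j = (if j \<in> u then approx_kap (radius n) (x j) else plateau (radius n))" for n u j
  have F: "smooth_real (F n u j)" for n u j
    by (simp add: F_def smooth_real_approx)
  obtain C where C: "\<And>n t. \<bar>plateau (radius n) t\<bar> \<le> C" using plateau_bound by blast
  define A where "A u n = (\<integral>y. G u y * tensor S (F n u) y \<partial>cube_measure S)" for u n
  define D where "D n = tensor S (\<lambda>j. approx_delta (radius n) (x j))" for n
  have expand: "(\<integral>y. f y * D n y \<partial>cube_measure S) = (\<Sum>u\<in>Pow S. A u n)"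
    if n: "\<forall>j\<in>S. radius n * (1 - x j) \<ge> 3" for n
  proof -
    define P where "P u = tensor S (\<lambda>j. if j \<in> u then deriv (F n u j) else F n u j)" for u
    have bump: "bump (F n u j)" if "j \<in> S" for u j
      using n x' radius_ge[of n] that by (simp add: F_def bump_plateau bump_approx)
    have P: "P u = mixed_partial u (tensor S (F n u))" if "u \<subseteq> S" for u
      using mixed_partial_tensor[OF fin that, of "F n u"] F by (simp add: P_def)
    have "D n y = (\<Sum>u\<in>Pow S. (- 1) ^ card u * P u y)" for y
    proof -
      \<comment> \<open>In each coordinate the approximate Dirac mass is \<open>plateau\<close>
        minus the derivative of \<open>approx_kap\<close>; multiplying out chooses the set u of
        coordinates in which the derivative is taken.\<close>
      have "D n y = (\<Prod>j\<in>S. - deriv (approx_kap (radius n) (x j)) (y j) + plateau (radius n) (y j))"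
        by (simp add: D_def tensor_def deriv_approx_kap)
      also have "\<dots> = (\<Sum>u\<in>Pow S. (- 1) ^ card u * P u y)"
        unfolding prod_add[OF fin]
        by (intro sum.cong refl, subst tensor_uminus_split[OF fin])
           (auto simp: P_def F_def intro!: arg_cong[where f = "\<lambda>F. tensor S F y"])
      finally show ?thesis .
    qed
    then have "(\<integral>y. f y * D n y \<partial>cube_measure S)
        = (\<integral>y. (\<Sum>u\<in>Pow S. (- 1) ^ card u * (f y * P u y)) \<partial>cube_measure S)"
      by (simp add: sum_distrib_left algebra_simps)
    also have "\<dots> = (\<Sum>u\<in>Pow S. (- 1) ^ card u * (\<integral>y. f y * P u y \<partial>cube_measure S))"
    proof (subst Bochner_Integration.integral_sum)
      fix u assume "u \<in> Pow S"
      have "continuous_on (unit_cube S) (P u)"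
        unfolding P_def by (intro continuous_on_tensor fin)
          (auto intro!: smooth_real_continuous smooth_real_deriv(2) F)
      then show "integrable (cube_measure S) (\<lambda>y. (- 1) ^ card u * (f y * P u y))"
        using f by (intro continuous_on_cube_integrable continuous_on_mult) (auto simp: S_def)
    qed simp
    also have "\<dots> = (\<Sum>u\<in>Pow S. A u n)"
    proof (intro sum.cong refl)
      fix u assume u: "u \<in> Pow S"
      show "(- 1) ^ card u * (\<integral>y. f y * P u y \<partial>cube_measure S) = A u n"
      proof (cases "u = {}")
        case True
        then show ?thesis by (simp add: A_def G_def P_def)
      next
        case False
        have "test_fun s (tensor S (F n u))"
          unfolding S_def by (rule test_fun_tensor) (auto simp: bump S_def)
        then have "(\<integral>y. f y * P u y \<partial>cube_measure S) = (- 1) ^ card u * A u n"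
          using g[of u] False u P[of u] by (auto simp: has_weak_mixed_deriv_def A_def G_def S_def)
        then show ?thesis by (simp add: mult.assoc[symmetric] power_mult_distrib[symmetric])
      qed
    qed
    finally show ?thesis .
  qed
  have lim: "(\<lambda>n. A u n) \<longlonglongrightarrow> (\<integral>y. G u y * tensor u (\<lambda>j. kap (x j)) y \<partial>cube_measure S)"
    if u: "u \<subseteq> S" for u
  proof -
    have "(\<lambda>n. \<integral>y. G u y * tensor S (F n u) y \<partial>cube_measure S) \<longlonglongrightarrow>
      (\<integral>y. G u y * tensor S (\<lambda>j. if j \<in> u then kap (x j) else (\<lambda>_. 1)) y \<partial>cube_measure S)"
    proof (rule integral_tensor_limit[OF fin Gint[OF u]])
      show "\<bar>F n u j t\<bar> \<le> max 10 C" if "t \<in> {0..1}" for n j t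
        using approx_kap_bound[OF that, of n "x j"] C[of n t] by (auto simp: F_def le_max_iff_disj)
    qed (auto simp: F_def approx_kap_tendsto plateau_tendsto
          intro!: smooth_real_measurable smooth_real_approx)
    then show ?thesis by (simp add: A_def tensor_restrict[OF fin u])
  qed
  have "(\<lambda>n. \<integral>y. f y * D n y \<partial>cube_measure S) \<longlonglongrightarrow>
     (\<Sum>u\<in>Pow S. \<integral>y. G u y * tensor u (\<lambda>j. kap (x j)) y \<partial>cube_measure S)"
  proof (rule Lim_transform_eventually)
    show "(\<lambda>n. \<Sum>u\<in>Pow S. A u n) \<longlonglongrightarrow>
        (\<Sum>u\<in>Pow S. \<integral>y. G u y * tensor u (\<lambda>j. kap (x j)) y \<partial>cube_measure S)"
      using lim by (intro tendsto_sum) auto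
    show "\<forall>\<^sub>F n in sequentially. (\<Sum>u\<in>Pow S. A u n) = (\<integral>y. f y * D n y \<partial>cube_measure S)"
      by (rule eventually_mono[OF eventually_radius_bump[of S x, OF fin x'(2)] expand[symmetric]])
  qed
  moreover have "(\<lambda>n. \<integral>y. f y * D n y \<partial>cube_measure S) \<longlonglongrightarrow> f x"
    unfolding D_def using approx_delta_tendsto_eval[OF fin] f x by (simp add: S_def)
  ultimately have "f x = (\<Sum>u\<in>Pow S. \<integral>y. G u y * tensor u (\<lambda>j. kap (x j)) y \<partial>cube_measure S)"
    using LIMSEQ_unique by blast
  also have "\<dots> = (\<integral>y. G {} y * tensor {} (\<lambda>j. kap (x j)) y \<partial>cube_measure S)
     + (\<Sum>u\<in>Pow S - {{}}. \<integral>y. G u y * tensor u (\<lambda>j. kap (x j)) y \<partial>cube_measure S)"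
    using fin by (subst sum.remove[of _ "{}"]) auto
  also have "\<dots> = cube_integral s f + (\<Sum>u\<in>Pow S - {{}}.
     \<integral>y. g u y * tensor u (\<lambda>j. kap (x j)) y \<partial>cube_measure S)"
    by (auto simp: G_def tensor_def cube_integral_def S_def intro!: sum.cong)
  finally show ?thesis by (simp add: S_def)
qed

subsection \<open>The fundamental lemma of the calculus of variations\<close>

text \<open>If some threshold is at least 1, the box is empty inside the cube. Otherwise negative
  thresholds are raised to 0, as \<open>approx_ray\<close> demands, which leaves the indicator on
  the open interval unchanged, and the indicator is a limit of test functions.\<close>

lemma integral_ray_zero:
  assumes d: "integrable (cube_measure {1..s}) d"
    and z: "\<And>\<phi>. test_fun s \<phi> \<Longrightarrow> (\<integral>x. d x * \<phi> x \<partial>cube_measure {1..s}) = 0"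
  shows "(\<integral>x. d x * tensor {1..s} (\<lambda>j. indicator {a j<..}) x \<partial>cube_measure {1..s}) = 0"
proof (cases "\<exists>j\<in>{1..s}. a j \<ge> 1")
  case True
  then obtain j where j: "j \<in> {1..s}" "a j \<ge> 1" by blast
  have "tensor {1..s} (\<lambda>j. indicator {a j<..}) x = 0" if "x \<in> space (cube_measure {1..s})" for x
  proof -
    have "x j \<le> 1" using unit_cubeD[of x "{1..s}" j] that j by (simp add: space_cube)
    then have "indicator {a j<..} (x j) = (0::real)" using j by (simp add: indicator_def)
    with j(1) show ?thesis by (auto simp: tensor_def)
  qed
  then have "(\<integral>x. d x * tensor {1..s} (\<lambda>j. indicator {a j<..}) x \<partial>cube_measure {1..s})
      = (\<integral>x. 0 \<partial>cube_measure {1..s})"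
    by (intro Bochner_Integration.integral_cong) auto
  then show ?thesis by simp
next
  case False
  define b where "b j = max 0 (a j)" for j
  have b: "b j < 1" if "j \<in> {1..s}" for j using False that by (auto simp: b_def not_le)
  have "(\<lambda>n. \<integral>x. d x * tensor {1..s} (\<lambda>j. approx_ray (radius n) (b j)) x \<partial>cube_measure {1..s})
      \<longlonglongrightarrow> (\<integral>x. d x * tensor {1..s} (\<lambda>j. indicator {a j<..}) x \<partial>cube_measure {1..s})"
  proof (rule integral_tensor_limit[OF _ d])
    fix j and t :: real assume t: "0 < t" "t < 1"
    then have "indicator {a j<..} t = (indicator {b j<..} t :: real)"
      by (auto simp: b_def indicator_def)
    then show "(\<lambda>n. approx_ray (radius n) (b j) t) \<longlonglongrightarrow> indicator {a j<..} t"
      using approx_ray_tendsto[OF t] by simp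
  qed (auto intro!: smooth_real_measurable smooth_real_approx approx_ray_bound)
  moreover have "\<forall>\<^sub>F n in sequentially. 0 =
      (\<integral>x. d x * tensor {1..s} (\<lambda>j. approx_ray (radius n) (b j)) x \<partial>cube_measure {1..s})"
    using eventually_radius_bump[of "{1..s}" b, OF _ b]
  proof (rule eventually_mono)
    fix n assume n: "\<forall>j\<in>{1..s}. 3 \<le> radius n * (1 - b j)"
    have "test_fun s (tensor {1..s} (\<lambda>j. approx_ray (radius n) (b j)))"
      using n radius_ge by (intro test_fun_tensor bump_approx) (auto simp: b_def)
    from z[OF this]
    show "0 = (\<integral>x. d x * tensor {1..s} (\<lambda>j. approx_ray (radius n) (b j)) x \<partial>cube_measure {1..s})" ..
  qed auto
  then have "(\<lambda>n. \<integral>x. d x * tensor {1..s} (\<lambda>j. approx_ray (radius n) (b j)) x \<partial>cube_measure {1..s})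
     \<longlonglongrightarrow> 0"
    by (rule Lim_transform_eventually[OF tendsto_const])
  ultimately show ?thesis using LIMSEQ_unique by blast
qed

text \<open>An intersection-stable generator of the sigma-algebra. Thresholds are arbitrary reals,
  so the value -1 switches off a coordinate and the whole cube is a member.\<close>

definition rays :: "nat set \<Rightarrow> (nat \<Rightarrow> real) set set" where
  "rays u = {{x \<in> unit_cube u. \<forall>j\<in>u. a j < x j} | a. True}"

lemma Int_stable_rays: "Int_stable (rays u)"
proof (rule Int_stableI)
  fix A B assume "A \<in> rays u" "B \<in> rays u"
  then obtain a b where "A = {x \<in> unit_cube u. \<forall>j\<in>u. a j < x j}" "B = {x \<in> unit_cube u. \<forall>j\<in>u. b j < x j}"
    by (auto simp: rays_def)
  then have "A \<inter> B = {x \<in> unit_cube u. \<forall>j\<in>u. max (a j) (b j) < x j}" by auto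
  then show "A \<inter> B \<in> rays u" by (auto simp: rays_def intro: exI[of _ "\<lambda>j. max (a j) (b j)"])
qed

lemma rays_subset: "rays u \<subseteq> Pow (unit_cube u)"
  by (auto simp: rays_def)

lemma sets_cube_rays:
  assumes "finite u"
  shows "sets (cube_measure u) = sigma_sets (unit_cube u) (rays u)"
proof
  let ?N = "sigma (unit_cube u) (rays u)"
  have N: "space ?N = unit_cube u" "sets ?N = sigma_sets (unit_cube u) (rays u)"
    by (simp_all only: space_measure_of[OF rays_subset] sets_measure_of[OF rays_subset])
  have proj: "(\<lambda>x. x i) \<in> borel_measurable ?N" if i: "i \<in> u" for i
    unfolding borel_measurable_iff_greater
  proof
    fix c :: real
    have "{x \<in> unit_cube u. c < x i} = {x \<in> unit_cube u. \<forall>j\<in>u. (if j = i then c else - 1) < x j}"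
    proof -
      have "- 1 < x j" if "x \<in> unit_cube u" "j \<in> u" for x j using unit_cubeD[OF that] by auto
      with i show ?thesis by auto
    qed
    then have "{x \<in> unit_cube u. c < x i} \<in> rays u" unfolding rays_def
      by (intro CollectI exI[of _ "\<lambda>j. if j = i then c else - 1"] conjI TrueI)
    then show "{x \<in> space ?N. c < x i} \<in> sets ?N" unfolding N by (rule sigma_sets.Basic)
  qed
  have "sets (\<Pi>\<^sub>M i\<in>u. unit_measure) \<subseteq> sets ?N"
  proof (rule sets_PiM_in_sets)
    show "space ?N = (\<Pi>\<^sub>E i\<in>u. space unit_measure)" unfolding N(1) by (simp add: unit_cube_def space_unit)
    fix i and A :: "real set" assume i: "i \<in> u" and A: "A \<in> sets unit_measure"
    then obtain B where "B \<in> sets borel" "A = {0..1} \<inter> B" by (auto simp: sets_restrict_space)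
    then have "A \<in> sets borel" by auto
    have "{x \<in> space ?N. x i \<in> A} = (\<lambda>x. x i) -` A \<inter> space ?N" by auto
    also have "\<dots> \<in> sets ?N" using measurable_sets[OF proj[OF i] \<open>A \<in> sets borel\<close>] .
    finally show "{x \<in> space ?N. x i \<in> A} \<in> sets ?N" .
  qed
  then show "sets (cube_measure u) \<subseteq> sigma_sets (unit_cube u) (rays u)"
    unfolding cube_measure_def N(2)[symmetric] .
  show "sigma_sets (unit_cube u) (rays u) \<subseteq> sets (cube_measure u)"
    unfolding space_cube[symmetric]
  proof (rule sets.sigma_sets_subset, rule subsetI)
    fix A assume "A \<in> rays u"
    then obtain a where a: "A = {x \<in> unit_cube u. \<forall>j\<in>u. a j < x j}" by (auto simp: rays_def)
    have "(\<lambda>x. x j) \<in> borel_measurable (cube_measure u)" if "j \<in> u" for j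
      by (rule measurable_cube_comp[OF that, of "\<lambda>t. t", OF measurable_unit]) measurable
    then have "{x \<in> space (cube_measure u). a j < x j} \<in> sets (cube_measure u)" if "j \<in> u" for j
      by (rule borel_measurable_iff_greater[THEN iffD1, THEN spec]) (rule that)
    then have "{x \<in> space (cube_measure u). \<forall>j\<in>u. a j < x j} \<in> sets (cube_measure u)"
      using assms by (intro sets.sets_Collect_finite_All) auto
    then show "A \<in> sets (cube_measure u)" by (simp add: a space_cube)
  qed
qed

text \<open>The sets over which d integrates to 0 contain the rays and are closed under complements
  and countable disjoint unions; by the Dynkin argument they are all measurable sets, which forces d
  = 0 almost everywhere. Complements use that the total integral is 0.\<close>

lemma fundamental_lemma:
  assumes d: "integrable (cube_measure {1..s}) d"
    and z: "\<And>\<phi>. test_fun s \<phi> \<Longrightarrow> (\<integral>x. d x * \<phi> x \<partial>cube_measure {1..s}) = 0"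
  shows "AE x in cube_measure {1..s}. d x = 0"
proof -
  let ?M = "cube_measure {1..s}"
  have dA: "set_integrable ?M A d" if "A \<in> sets ?M" for A
    using integrable_mult_indicator[OF that d] by (simp add: set_integrable_def)
  have ray: "(LINT x:A|?M. d x) = 0" if A: "A \<in> rays {1..s}" for A
  proof -
    obtain a where a: "A = {x \<in> unit_cube {1..s}. \<forall>j\<in>{1..s}. a j < x j}"
      using A by (auto simp: rays_def)
    have "indicator A x *\<^sub>R d x = d x * tensor {1..s} (\<lambda>j. indicator {a j<..}) x" if "x \<in> space ?M" for x
      using that by (auto simp: a space_cube tensor_def indicator_def)
    then have "(LINT x:A|?M. d x) = (\<integral>x. d x * tensor {1..s} (\<lambda>j. indicator {a j<..}) x \<partial>?M)"
      unfolding set_lebesgue_integral_def by (intro Bochner_Integration.integral_cong) auto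
    with integral_ray_zero[OF d z] show ?thesis by simp
  qed
  have total: "integral\<^sup>L ?M d = 0"
  proof -
    have "{x \<in> unit_cube {1..s}. \<forall>j\<in>{1..s}. - 1 < x j} = unit_cube {1..s}"
    proof -
      have "- 1 < x j" if "x \<in> unit_cube {1..s}" "j \<in> {1..s}" for x j using unit_cubeD[OF that] by auto
      then show ?thesis by blast
    qed
    then have "unit_cube {1..s} \<in> rays {1..s}"
      unfolding rays_def by (auto intro!: exI[of _ "\<lambda>_. - 1"])
    moreover have "(LINT x:unit_cube {1..s}|?M. d x) = integral\<^sup>L ?M d"
      unfolding set_lebesgue_integral_def
      by (intro Bochner_Integration.integral_cong) (auto simp: space_cube)
    ultimately show ?thesis using ray by simp
  qed
  have "(LINT x:A|?M. d x) = 0" if "A \<in> sets ?M" for A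
    using Int_stable_rays rays_subset that[unfolded sets_cube_rays[OF finite_atLeastAtMost]]
  proof (induction rule: sigma_sets_induct_disjoint)
    case (basic A)
    then show ?case by (rule ray)
  next
    case empty
    then show ?case by (simp add: set_lebesgue_integral_def)
  next
    case (compl A)
    then have A: "A \<in> sets ?M" by (simp add: sets_cube_rays)
    have "(LINT x:(unit_cube {1..s} - A)|?M. d x) + (LINT x:A|?M. d x)
        = (LINT x:((unit_cube {1..s} - A) \<union> A)|?M. d x)"
      using A by (intro set_integral_Un[symmetric] dA) (auto simp: space_cube[symmetric])
    also have "(unit_cube {1..s} - A) \<union> A = space ?M"
      using sets.sets_into_space[OF A] by (auto simp: space_cube)
    also have "(LINT x:space ?M|?M. d x) = 0"
      using total by (simp add: set_lebesgue_integral_def cong: Bochner_Integration.integral_cong)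
    finally show ?case using compl by simp
  next
    case (union A)
    then have A: "A i \<in> sets ?M" for i by (auto simp: sets_cube_rays)
    have "(LINT x:(\<Union>i. A i)|?M. d x) = (\<Sum>i. (LINT x:(A i)|?M. d x))"
      using A union(1) by (intro lebesgue_integral_countable_add dA) (auto simp: disjoint_family_on_def)
    then show ?case using union(3) by simp
  qed
  then show ?thesis
    by (intro density_unique_real[OF d]) (auto simp: set_lebesgue_integral_def)
qed

subsection \<open>Weak derivatives of tensor products\<close>

text \<open>A smooth function vanishing outside the open cube; unlike compactness of the support, this
  is visibly inherited by partial derivatives.\<close>

definition vanishing_fun :: "nat \<Rightarrow> ((nat \<Rightarrow> real) \<Rightarrow> real) \<Rightarrow> bool" where
  "vanishing_fun s \<phi> \<longleftrightarrow> smooth_fun s \<phi> \<and>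
     (\<forall>x\<in>{1..s} \<rightarrow>\<^sub>E UNIV. (\<exists>j\<in>{1..s}. x j \<notin> {0<..<1}) \<longrightarrow> \<phi> x = 0)"

lemma test_fun_imp_vanishing: "test_fun s \<phi> \<Longrightarrow> vanishing_fun s \<phi>"
proof -
  assume "test_fun s \<phi>"
  then obtain K where K: "smooth_fun s \<phi>" "K \<subseteq> {1..s} \<rightarrow>\<^sub>E {0<..<1}"
      "\<And>x. x \<in> ({1..s} \<rightarrow>\<^sub>E UNIV) - K \<Longrightarrow> \<phi> x = 0"
    unfolding test_fun_def by blast
  have "\<phi> x = 0" if "x \<in> {1..s} \<rightarrow>\<^sub>E UNIV" "j \<in> {1..s}" "x j \<notin> {0<..<1}" for x j
  proof -
    have "x \<notin> K" using K(2) PiE_mem that(2,3) by blast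
    with K(3) that(1) show ?thesis by blast
  qed
  with K(1) show ?thesis unfolding vanishing_fun_def by blast
qed

lemma smooth_fun_D:
  assumes "smooth_fun s \<phi>"
  shows "continuous_on ({1..s} \<rightarrow>\<^sub>E UNIV) \<phi>"
    and "i \<in> {1..s} \<Longrightarrow> smooth_fun s (partial_deriv i \<phi>)"
    and "i \<in> {1..s} \<Longrightarrow> x \<in> {1..s} \<rightarrow>\<^sub>E UNIV \<Longrightarrow>
      ((\<lambda>t. \<phi> (x(i := t))) has_real_derivative partial_deriv i \<phi> (x(i := t))) (at t)"
proof -
  show "continuous_on ({1..s} \<rightarrow>\<^sub>E UNIV) \<phi>"
    using assms[unfolded smooth_fun_def, rule_format, of "[]"] by simp
  show "smooth_fun s (partial_deriv i \<phi>)" if "i \<in> {1..s}"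
    unfolding smooth_fun_def
  proof (rule allI, rule impI)
    fix "is" assume "set is \<subseteq> {1..s}"
    \<comment> \<open>In \<open>foldr\<close> the last list element acts first, so appending i
      differentiates by x_i before everything else.\<close>
    with that have "set (is @ [i]) \<subseteq> {1..s}" by auto
    from assms[unfolded smooth_fun_def, rule_format, OF this]
    show "continuous_on ({1..s} \<rightarrow>\<^sub>E UNIV) (foldr partial_deriv is (partial_deriv i \<phi>)) \<and>
        (\<forall>i'\<in>{1..s}. \<forall>x\<in>{1..s} \<rightarrow>\<^sub>E UNIV.
           (\<lambda>t. foldr partial_deriv is (partial_deriv i \<phi>) (x(i' := t))) differentiable at (x i'))"
      by simp
  qed
  show "((\<lambda>t. \<phi> (x(i := t))) has_real_derivative partial_deriv i \<phi> (x(i := t))) (at t)"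
    if "i \<in> {1..s}" "x \<in> {1..s} \<rightarrow>\<^sub>E UNIV"
  proof -
    have "x(i := t) \<in> {1..s} \<rightarrow>\<^sub>E UNIV" using that by (auto simp: PiE_iff extensional_def)
    moreover have "\<forall>i\<in>{1..s}. \<forall>x\<in>{1..s} \<rightarrow>\<^sub>E UNIV. (\<lambda>t. \<phi> (x(i := t))) differentiable at (x i)"
      using assms[unfolded smooth_fun_def, rule_format, of "[]"] by simp
    ultimately have "(\<lambda>t'. \<phi> ((x(i := t))(i := t'))) differentiable at ((x(i := t)) i)"
      using that(1) by blast
    then have "(\<lambda>t'. \<phi> (x(i := t'))) differentiable at t" by simp
    then show ?thesis
      by (auto simp: partial_deriv_def real_differentiable_def dest: DERIV_imp_deriv)
  qed
qed

lemma deriv_zero_within: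
  assumes "(f has_real_derivative D) (at t)" "\<And>u. u \<in> A \<Longrightarrow> f u = 0" "t \<in> A" "at t within A \<noteq> bot"
  shows "D = 0"
proof -
  have "(f has_real_derivative D) (at t within A)" using assms(1) by (rule DERIV_subset) simp
  moreover have "((\<lambda>_. 0) has_real_derivative 0) (at t within A)" by simp
  then have "(f has_real_derivative 0) (at t within A)"
    by (rule has_field_derivative_transform_within[of _ _ _ _ 1]) (use assms(2,3) in auto)
  ultimately show ?thesis
    using has_field_derivative_unique assms(4) by blast
qed

lemma at_within_ray_neq_bot: "at t within {..t::real} \<noteq> bot" "at t within {t..} \<noteq> bot"
proof -
  have "at_left t \<le> at t within {..t}" "at_right t \<le> at t within {t..}"
    by (auto intro!: at_le)
  then show "at t within {..t} \<noteq> bot" "at t within {t..} \<noteq> bot"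
    using trivial_limit_at_left_real[of t] trivial_limit_at_right_real[of t]
    by (metis bot.extremum_unique)+
qed

text \<open>If a coordinate other than i lies outside the open interval, the function vanishes on
  the whole line in direction i. If coordinate i itself does, the function vanishes on the closed
  half line pointing away from the cube, and the one-sided difference quotient determines the
  derivative.\<close>

lemma vanishing_fun_partial_deriv:
  assumes "vanishing_fun s \<phi>" "i \<in> {1..s}"
  shows "vanishing_fun s (partial_deriv i \<phi>)"
proof -
  have \<phi>: "smooth_fun s \<phi>" and zero: "\<And>x j. x \<in> {1..s} \<rightarrow>\<^sub>E UNIV \<Longrightarrow> j \<in> {1..s} \<Longrightarrow> x j \<notin> {0<..<1} \<Longrightarrow> \<phi> x = 0"
    using assms(1) by (auto simp: vanishing_fun_def)
  have "partial_deriv i \<phi> x = 0" if x: "x \<in> {1..s} \<rightarrow>\<^sub>E UNIV" and j: "j \<in> {1..s}" "x j \<notin> {0<..<1}" for x j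
  proof -
    have x': "x(i := t) \<in> {1..s} \<rightarrow>\<^sub>E UNIV" for t
      using x assms(2) by (auto simp: PiE_iff extensional_def)
    have D: "((\<lambda>t. \<phi> (x(i := t))) has_real_derivative partial_deriv i \<phi> x) (at (x i))"
      using smooth_fun_D(3)[OF \<phi> assms(2) x, of "x i"] by simp
    consider "j \<noteq> i" | "j = i" "x i \<le> 0" | "j = i" "x i \<ge> 1" using j by force
    then show ?thesis
    proof cases
      case 1
      then have "\<phi> (x(i := t)) = 0" for t using zero[OF x' j(1)] j(2) by simp
      with deriv_zero_within[OF D, of UNIV] show ?thesis by simp
    next
      case 2
      then have "\<phi> (x(i := t)) = 0" if "t \<le> x i" for t using zero[OF x' assms(2)] that by simp
      with deriv_zero_within[OF D, of "{..x i}"] at_within_ray_neq_bot show ?thesis by simp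
    next
      case 3
      then have "\<phi> (x(i := t)) = 0" if "t \<ge> x i" for t using zero[OF x' assms(2)] that by simp
      with deriv_zero_within[OF D, of "{x i..}"] at_within_ray_neq_bot show ?thesis by simp
    qed
  qed
  then show ?thesis
    using smooth_fun_D(2)[OF \<phi> assms(2)] by (auto simp: vanishing_fun_def)
qed

section \<open>Integration by parts for factors with finitely many kinks\<close>

definition bounded_meas :: "(real \<Rightarrow> real) \<Rightarrow> bool" where
  "bounded_meas c \<longleftrightarrow> c \<in> borel_measurable borel \<and> (\<exists>B. \<forall>t\<in>{0..1}. \<bar>c t\<bar> \<le> B)"

text \<open>Continuity together with differentiability off a finite set is what the fundamental
  theorem of calculus asks for. The pairs that occur are \<open>eta x\<close> with
  \<open>kap x\<close> and the constant 1 with 0.\<close>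

definition piecewise_deriv :: "(real \<Rightarrow> real) \<Rightarrow> (real \<Rightarrow> real) \<Rightarrow> bool" where
  "piecewise_deriv c c' \<longleftrightarrow> bounded_meas c \<and> bounded_meas c' \<and> continuous_on {0..1} c \<and>
     (\<exists>T. finite T \<and> (\<forall>t\<in>{0<..<1} - T. (c has_real_derivative c' t) (at t)))"

lemma bounded_meas_integrable: "bounded_meas c \<Longrightarrow> integrable unit_measure c"
  unfolding bounded_meas_def using bounded_unit_integrable measurable_unit by metis

lemma piecewise_deriv_one: "piecewise_deriv (\<lambda>_. 1) (\<lambda>_. 0)"
  by (auto simp: piecewise_deriv_def bounded_meas_def intro: exI[of _ "{}"])

lemma piecewise_deriv_eta: "x \<in> {0..1} \<Longrightarrow> piecewise_deriv (eta x) (kap x)"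
  unfolding piecewise_deriv_def bounded_meas_def
  using eta_bound[of x] kap_bound[of _ x]
  by (intro conjI eta_measurable kap_measurable eta_continuous exI[of _ "{x}"] exI[of _ 1] exI[of _ "1 / 3"])
     (simp_all add: eta_deriv)

lemma continuous_on_unit_integrable:
  fixes f :: "real \<Rightarrow> real"
  assumes "continuous_on {0..1} f"
  shows "f \<in> borel_measurable unit_measure" "\<exists>B. \<forall>t\<in>{0..1}. \<bar>f t\<bar> \<le> B"
proof -
  have "f \<in> borel_measurable (restrict_space borel {0..1})"
    by (rule borel_measurable_continuous_on_restrict[OF assms])
  then show "f \<in> borel_measurable unit_measure"
    by (simp add: measurable_def sets_restrict_space space_restrict_space)
  have "compact (f ` {0..1})" by (rule compact_continuous_image[OF assms]) simp
  then obtain B where "\<forall>y\<in>f ` {0..1}. norm y \<le> B"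
    using compact_imp_bounded bounded_iff by metis
  then show "\<exists>B. \<forall>t\<in>{0..1}. \<bar>f t\<bar> \<le> B" by (intro exI[of _ B]) auto
qed

lemma unit_integral_by_parts:
  assumes c: "piecewise_deriv c c'"
    and \<psi>: "\<And>t. (\<psi> has_real_derivative \<psi>' t) (at t)" "continuous_on {0..1} \<psi>'" "\<psi> 0 = 0" "\<psi> 1 = 0"
  shows "(\<integral>t. c t * \<psi>' t \<partial>unit_measure) = - (\<integral>t. c' t * \<psi> t \<partial>unit_measure)"
proof -
  obtain B B' T where B: "\<And>t. t \<in> {0..1} \<Longrightarrow> \<bar>c t\<bar> \<le> B" "\<And>t. t \<in> {0..1} \<Longrightarrow> \<bar>c' t\<bar> \<le> B'"
    and T: "finite T" "\<And>t. t \<in> {0<..<1} - T \<Longrightarrow> (c has_real_derivative c' t) (at t)"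
    using c unfolding piecewise_deriv_def bounded_meas_def by metis
  have meas: "c \<in> borel_measurable unit_measure" "c' \<in> borel_measurable unit_measure"
    using c by (auto simp: piecewise_deriv_def bounded_meas_def intro!: measurable_unit)
  have cont: "continuous_on {0..1} \<psi>" "continuous_on {0..1} c"
    using \<psi>(1) DERIV_isCont continuous_at_imp_continuous_on c unfolding piecewise_deriv_def by blast+
  note \<psi>_meas = continuous_on_unit_integrable(1)[OF \<psi>(2)] continuous_on_unit_integrable(1)[OF cont(1)]
  obtain E E' where E: "\<And>t. t \<in> {0..1} \<Longrightarrow> \<bar>\<psi> t\<bar> \<le> E" "\<And>t. t \<in> {0..1} \<Longrightarrow> \<bar>\<psi>' t\<bar> \<le> E'"
    using continuous_on_unit_integrable(2)[OF \<psi>(2)] continuous_on_unit_integrable(2)[OF cont(1)] by metis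
  have bnd: "\<bar>c t * \<psi>' t\<bar> \<le> B * E'" "\<bar>c' t * \<psi> t\<bar> \<le> B' * E" if "t \<in> {0..1}" for t
    using mult_mono[OF B(1)[OF that] E(2)[OF that]] mult_mono[OF B(2)[OF that] E(1)[OF that]]
      B(1)[OF that] B(2)[OF that] by (auto simp: abs_mult)
  have int: "integrable unit_measure (\<lambda>t. c t * \<psi>' t)" "integrable unit_measure (\<lambda>t. c' t * \<psi> t)"
    by (rule bounded_unit_integrable[OF borel_measurable_times[OF meas(1) \<psi>_meas(1)] bnd(1)], assumption)
       (rule bounded_unit_integrable[OF borel_measurable_times[OF meas(2) \<psi>_meas(2)] bnd(2)])
  have "(\<integral>t. c t * \<psi>' t + c' t * \<psi> t \<partial>unit_measure) = c 1 * \<psi> 1 - c 0 * \<psi> 0"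
  proof (rule unit_integral_FTC[OF _ _ T(1)])
    show "\<bar>c t * \<psi>' t + c' t * \<psi> t\<bar> \<le> B * E' + B' * E" if "t \<in> {0..1}" for t
      using bnd[OF that] by linarith
    show "((\<lambda>t. c t * \<psi> t) has_real_derivative c t * \<psi>' t + c' t * \<psi> t) (at t)"
      if "t \<in> {0<..<1} - T" for t
      using DERIV_mult[OF T(2)[OF that] \<psi>(1)[of t]] by (simp add: algebra_simps)
    show "continuous_on {0..1} (\<lambda>t. c t * \<psi> t)" using cont by (intro continuous_on_mult)
  qed (use meas \<psi>_meas in auto)
  then show ?thesis using int \<psi>(3,4) by simp
qed

lemma tensor_bounded_meas:
  assumes "finite S" "\<And>j. j \<in> S \<Longrightarrow> bounded_meas (e j)"
  obtains B where "\<And>x. x \<in> unit_cube S \<Longrightarrow> \<bar>tensor S e x\<bar> \<le> B"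
proof -
  from assms(2) have "\<forall>j\<in>S. \<exists>B. \<forall>t\<in>{0..1}. \<bar>e j t\<bar> \<le> B" by (auto simp: bounded_meas_def)
  then obtain B where B: "\<And>j t. j \<in> S \<Longrightarrow> t \<in> {0..1} \<Longrightarrow> \<bar>e j t\<bar> \<le> B j" by metis
  have "\<bar>tensor S e x\<bar> \<le> (\<Prod>j\<in>S. B j)" if "x \<in> unit_cube S" for x
    unfolding tensor_def abs_prod using B unit_cubeD[OF that] by (intro prod_mono) auto
  with that show thesis by blast
qed

lemma tensor_bounded_meas_measurable:
  "v \<subseteq> S \<Longrightarrow> (\<And>j. j \<in> v \<Longrightarrow> bounded_meas (e j)) \<Longrightarrow> tensor v e \<in> borel_measurable (cube_measure S)"
  unfolding tensor_def by (intro borel_measurable_prod measurable_cube_comp measurable_unit)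
    (auto simp: bounded_meas_def)

lemma integrable_tensor_vanishing:
  assumes "\<And>j. j \<in> {1..s} \<Longrightarrow> bounded_meas (e j)" "smooth_fun s \<phi>"
  shows "integrable (cube_measure {1..s}) (\<lambda>x. tensor {1..s} e x * \<phi> x)"
proof -
  obtain B where B: "\<And>x. x \<in> unit_cube {1..s} \<Longrightarrow> \<bar>tensor {1..s} e x\<bar> \<le> B"
    using tensor_bounded_meas[of "{1..s}" e] assms(1) by blast
  have "continuous_on (unit_cube {1..s}) \<phi>"
    using smooth_fun_D(1)[OF assms(2)] by (rule continuous_on_subset) (auto simp: unit_cube_def)
  then have "integrable (cube_measure {1..s}) \<phi>" by (rule continuous_on_cube_integrable)
  from integrable_mult_bounded[OF this tensor_bounded_meas_measurable B] assms(1)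
  show ?thesis by (simp add: mult.commute)
qed

lemma continuous_on_fun_upd: "continuous_on A (\<lambda>t. x(i := t :: real))"
proof (rule continuous_on_coordinatewise_then_product)
  fix j show "continuous_on A (\<lambda>t. (x(i := t)) j)"
    by (cases "j = i") (auto intro: continuous_intros)
qed

text \<open>Fubini isolates coordinate i, where the boundary terms vanish. The other factors are
  constants there and only have to be bounded and measurable, so the rule can be iterated past
  factors that have already become discontinuous derivatives.\<close>

lemma tensor_by_parts:
  assumes e: "\<And>j. j \<in> {1..s} \<Longrightarrow> bounded_meas (e j)" and i: "i \<in> {1..s}"
    and c: "piecewise_deriv (e i) c'" and \<phi>: "vanishing_fun s \<phi>"
  shows "(\<integral>x. tensor {1..s} e x * partial_deriv i \<phi> x \<partial>cube_measure {1..s})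
      = - (\<integral>x. tensor {1..s} (e(i := c')) x * \<phi> x \<partial>cube_measure {1..s})"
proof -
  let ?I = "{1..s} - {i}"
  have ins: "insert i ?I = {1..s}" using i by auto
  have sm: "smooth_fun s \<phi>" "smooth_fun s (partial_deriv i \<phi>)"
    using \<phi> vanishing_fun_partial_deriv[OF \<phi> i] by (auto simp: vanishing_fun_def)
  have c': "bounded_meas c'" using c by (simp add: piecewise_deriv_def)
  have fubini: "(\<integral>x. f x \<partial>cube_measure {1..s})
      = (\<integral>x. (\<integral>t. f (x(i := t)) \<partial>unit_measure) \<partial>cube_measure ?I)"
    if "integrable (cube_measure {1..s}) f" for f :: "_ \<Rightarrow> real"
    using unit_prod.product_integral_insert[of ?I i f] that
    unfolding ins by (simp add: cube_measure_def)
  have "(\<integral>x. tensor {1..s} e x * partial_deriv i \<phi> x \<partial>cube_measure {1..s})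
    = (\<integral>x. (\<integral>t. tensor {1..s} e (x(i := t)) * partial_deriv i \<phi> (x(i := t)) \<partial>unit_measure) \<partial>cube_measure ?I)"
    by (rule fubini[OF integrable_tensor_vanishing[OF e sm(2)]])
  also have "\<dots> = (\<integral>x. - (\<integral>t. tensor {1..s} (e(i := c')) (x(i := t)) * \<phi> (x(i := t)) \<partial>unit_measure) \<partial>cube_measure ?I)"
  proof (rule Bochner_Integration.integral_cong[OF refl])
    fix x assume "x \<in> space (cube_measure ?I)"
    then have x: "x(i := t) \<in> {1..s} \<rightarrow>\<^sub>E UNIV" for t
      using i by (auto simp: space_cube unit_cube_def PiE_iff extensional_def)
    define P where "P = (\<Prod>j\<in>?I. e j (x j))"
    have "(\<integral>t. e i t * partial_deriv i \<phi> (x(i := t)) \<partial>unit_measure)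
        = - (\<integral>t. c' t * \<phi> (x(i := t)) \<partial>unit_measure)"
    proof (rule unit_integral_by_parts[OF c])
      show "((\<lambda>t. \<phi> (x(i := t))) has_real_derivative partial_deriv i \<phi> (x(i := t))) (at t)" for t
        using smooth_fun_D(3)[OF sm(1) i x[of undefined], of t] by simp
      show "continuous_on {0..1} (\<lambda>t. partial_deriv i \<phi> (x(i := t)))"
        using x by (intro continuous_on_compose2[OF smooth_fun_D(1)[OF sm(2)] continuous_on_fun_upd]) blast
      show "\<phi> (x(i := 0)) = 0" "\<phi> (x(i := 1)) = 0"
        using \<phi> x i unfolding vanishing_fun_def by (metis fun_upd_same greaterThanLessThan_iff less_irrefl)+
    qed
    then show "(\<integral>t. tensor {1..s} e (x(i := t)) * partial_deriv i \<phi> (x(i := t)) \<partial>unit_measure)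
        = - (\<integral>t. tensor {1..s} (e(i := c')) (x(i := t)) * \<phi> (x(i := t)) \<partial>unit_measure)"
    proof -
      have 1: "tensor {1..s} e (x(i := t)) * q = P * (e i t * q)"
        and 2: "tensor {1..s} (e(i := c')) (x(i := t)) * q = P * (c' t * q)" for t q
        using tensor_remove[OF _ i, of e x t] tensor_remove[OF _ i, of "e(i := c')" x t]
        by (simp_all add: P_def)
      assume "(\<integral>t. e i t * partial_deriv i \<phi> (x(i := t)) \<partial>unit_measure)
        = - (\<integral>t. c' t * \<phi> (x(i := t)) \<partial>unit_measure)"
      then show ?thesis unfolding 1 2 by simp
    qed
  qed
  also have "\<dots> = - (\<integral>x. tensor {1..s} (e(i := c')) x * \<phi> x \<partial>cube_measure {1..s})"
    using e c' by (subst fubini[OF integrable_tensor_vanishing[OF _ sm(1)]]) auto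
  finally show ?thesis .
qed

lemma tensor_weak_deriv_aux:
  assumes "distinct is" "set is \<subseteq> {1..s}" "vanishing_fun s \<phi>"
    "\<And>j. j \<in> {1..s} \<Longrightarrow> bounded_meas (e j)" "\<And>j. j \<in> set is \<Longrightarrow> piecewise_deriv (e j) (e' j)"
  shows "(\<integral>x. tensor {1..s} e x * foldr partial_deriv is \<phi> x \<partial>cube_measure {1..s})
    = (- 1) ^ length is * (\<integral>x. tensor {1..s} (\<lambda>j. if j \<in> set is then e' j else e j) x * \<phi> x \<partial>cube_measure {1..s})"
  using assms
\<comment> \<open>The factors are generalized because after one step factor i has become
  \<open>e' i\<close>; by distinctness it is not differentiated again.\<close>
proof (induction "is" arbitrary: e)
  case (Cons i "is")
  have van: "vanishing_fun s (foldr partial_deriv is \<phi>)"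
    using Cons.prems(2,3) by (induction "is") (auto intro: vanishing_fun_partial_deriv)
  have "(\<integral>x. tensor {1..s} e x * foldr partial_deriv (i # is) \<phi> x \<partial>cube_measure {1..s})
    = - (\<integral>x. tensor {1..s} (e(i := e' i)) x * foldr partial_deriv is \<phi> x \<partial>cube_measure {1..s})"
    using tensor_by_parts[of s e i "e' i", OF _ _ _ van] Cons.prems by simp
  also have "(\<integral>x. tensor {1..s} (e(i := e' i)) x * foldr partial_deriv is \<phi> x \<partial>cube_measure {1..s})
    = (- 1) ^ length is * (\<integral>x. tensor {1..s} (\<lambda>j. if j \<in> set is then e' j else (e(i := e' i)) j) x * \<phi> x
        \<partial>cube_measure {1..s})"
    using Cons.prems by (intro Cons.IH) (auto simp: piecewise_deriv_def)
  also have "(\<lambda>j. if j \<in> set is then e' j else (e(i := e' i)) j) = (\<lambda>j. if j \<in> set (i # is) then e' j else e j)"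
    by auto
  finally show ?case by simp
qed simp

lemma tensor_weak_deriv:
  assumes "u \<subseteq> {1..s}" "\<And>j. j \<in> {1..s} \<Longrightarrow> piecewise_deriv (e j) (e' j)"
  shows "has_weak_mixed_deriv s u (tensor {1..s} e) (tensor {1..s} (\<lambda>j. if j \<in> u then e' j else e j))"
  unfolding has_weak_mixed_deriv_def mixed_partial_def
proof (intro allI impI)
  fix \<phi> assume "test_fun s \<phi>"
  moreover have "finite u" using assms(1) finite_subset by blast
  moreover have "bounded_meas (e j)" if "j \<in> {1..s}" for j
    using assms(2)[OF that] unfolding piecewise_deriv_def by blast
  ultimately show "(\<integral>x. tensor {1..s} e x * foldr partial_deriv (sorted_list_of_set u) \<phi> x \<partial>cube_measure {1..s})
    = (- 1) ^ card u * (\<integral>x. tensor {1..s} (\<lambda>j. if j \<in> u then e' j else e j) x * \<phi> x \<partial>cube_measure {1..s})"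
    using tensor_weak_deriv_aux[of "sorted_list_of_set u" s \<phi> e e', OF _ _ test_fun_imp_vanishing] assms
    by (simp add: subset_iff)
qed

subsection \<open>The quadrature error functional\<close>

text \<open>The inner integral of \<open>sobolev_norm\<close>, with the coordinates outside
  \<open>u\<close> averaged out.\<close>

definition cube_section :: "nat set \<Rightarrow> nat set \<Rightarrow> ((nat \<Rightarrow> real) \<Rightarrow> real) \<Rightarrow> (nat \<Rightarrow> real) \<Rightarrow> real" where
  "cube_section S u f x = (\<integral>y. f (merge u (S - u) (x, y)) \<partial>cube_measure (S - u))"

lemma pair_sigma_finite_cube: "pair_sigma_finite (cube_measure u) (cube_measure v)"
  by (intro pair_sigma_finite.intro prob_space_imp_sigma_finite prob_space_cube)

lemma measurable_merge_cube:
  assumes "u \<subseteq> S"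
  shows "merge u (S - u) \<in> measurable (cube_measure u \<Otimes>\<^sub>M cube_measure (S - u)) (cube_measure S)"
proof -
  have "u \<union> (S - u) = S" using assms by auto
  with measurable_merge[of u "S - u" "\<lambda>_. unit_measure"] show ?thesis
    by (simp add: cube_measure_def)
qed

lemma distr_merge_cube:
  assumes "finite S" "u \<subseteq> S"
  shows "distr (cube_measure u \<Otimes>\<^sub>M cube_measure (S - u)) (cube_measure S) (merge u (S - u)) = cube_measure S"
proof -
  have "u \<union> (S - u) = S" "finite u" using assms finite_subset by auto
  with unit_prod.distr_merge[of u "S - u"] assms show ?thesis
    by (simp add: cube_measure_def)
qed

lemma integrable_merge_cube:
  fixes f :: "_ \<Rightarrow> real"
  assumes "finite S" "u \<subseteq> S" "integrable (cube_measure S) f"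
  shows "integrable (cube_measure u \<Otimes>\<^sub>M cube_measure (S - u)) (\<lambda>p. f (merge u (S - u) p))"
  using integrable_distr[OF measurable_merge_cube[OF assms(2)], of f] assms
  by (simp add: distr_merge_cube)

lemma integral_cube_section:
  assumes "finite S" "u \<subseteq> S" "integrable (cube_measure S) f"
  shows "(\<integral>x. f x \<partial>cube_measure S) = (\<integral>x. cube_section S u f x \<partial>cube_measure u)"
proof -
  have "u \<union> (S - u) = S" "finite u" using assms finite_subset by auto
  with unit_prod.product_integral_fold[of u "S - u" f] assms show ?thesis
    by (simp add: cube_measure_def cube_section_def)
qed

lemma AE_cube_section:
  assumes "finite S" "u \<subseteq> S" "AE x in cube_measure S. P x"
  shows "AE x in cube_measure u. AE y in cube_measure (S - u). P (merge u (S - u) (x, y))"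
proof -
  have "AE x in distr (cube_measure u \<Otimes>\<^sub>M cube_measure (S - u)) (cube_measure S) (merge u (S - u)). P x"
    unfolding distr_merge_cube[OF assms(1,2)] by (rule assms(3))
  then have "AE p in cube_measure u \<Otimes>\<^sub>M cube_measure (S - u). P (merge u (S - u) p)"
    by (rule AE_distrD[OF measurable_merge_cube[OF assms(2)]])
  then show ?thesis by (rule pair_sigma_finite.AE_pair[OF pair_sigma_finite_cube])
qed

lemma measurable_cube_section:
  assumes "u \<subseteq> S" "f \<in> borel_measurable (cube_measure S)"
  shows "cube_section S u f \<in> borel_measurable (cube_measure u)"
proof -
  have "(\<lambda>p. f (merge u (S - u) p)) \<in> borel_measurable (cube_measure u \<Otimes>\<^sub>M cube_measure (S - u))"
    by (rule measurable_compose[OF measurable_merge_cube[OF assms(1)] assms(2)])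
  then have "case_prod (\<lambda>x y. f (merge u (S - u) (x, y))) \<in> borel_measurable (cube_measure u \<Otimes>\<^sub>M cube_measure (S - u))"
    by (simp add: case_prod_beta)
  from sigma_finite_measure.borel_measurable_lebesgue_integral[OF prob_space_imp_sigma_finite[OF prob_space_cube] this]
  show ?thesis by (simp add: cube_section_def[abs_def])
qed

text \<open>Shows that the inner integral of the norm is insensitive, up to null sets, to the
  version of the weak derivative.\<close>

lemma cube_section_cong_AE:
  assumes "finite S" "u \<subseteq> S" "f \<in> borel_measurable (cube_measure S)" "g \<in> borel_measurable (cube_measure S)"
    "AE x in cube_measure S. f x = g x"
  shows "AE x in cube_measure u. cube_section S u f x = cube_section S u g x"
  using AE_cube_section[OF assms(1,2,5)] AE_space
proof eventually_elim
  case (elim x)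
  have meas: "(\<lambda>y. h (merge u (S - u) (x, y))) \<in> borel_measurable (cube_measure (S - u))"
    if "h \<in> borel_measurable (cube_measure S)" for h :: "_ \<Rightarrow> real"
    by (rule measurable_compose[OF measurable_Pair1'[OF elim(2)]
          measurable_compose[OF measurable_merge_cube[OF assms(2)] that]])
  show ?case
    unfolding cube_section_def by (rule integral_cong_AE[OF meas[OF assms(3)] meas[OF assms(4)] elim(1)])
qed

lemma square_integrable_imp_integrable:
  assumes "square_integrable s g"
  shows "integrable (cube_measure {1..s}) g"
  using assms unfolding square_integrable_def
  by (intro cube.square_integrable_imp_integrable[where f = g]) auto

text \<open>Variance is nonnegative: on a probability space the square of a mean is at most the mean
  of the square, which provides an integrable majorant.\<close>

lemma integrable_cube_section_sq:
  assumes "finite S" "u \<subseteq> S" "integrable (cube_measure S) f" "integrable (cube_measure S) (\<lambda>x. (f x)\<^sup>2)"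
  shows "integrable (cube_measure u) (\<lambda>x. (cube_section S u f x)\<^sup>2)"
proof (rule Bochner_Integration.integrable_bound)
  show "integrable (cube_measure u) (cube_section S u (\<lambda>x. (f x)\<^sup>2))"
    using pair_sigma_finite.integrable_fst'[OF pair_sigma_finite_cube integrable_merge_cube[OF assms(1,2,4)]]
    by (simp add: cube_section_def[abs_def])
  show "(\<lambda>x. (cube_section S u f x)\<^sup>2) \<in> borel_measurable (cube_measure u)"
    using measurable_cube_section[OF assms(2) borel_measurable_integrable[OF assms(3)]] by simp
  show "AE x in cube_measure u. norm ((cube_section S u f x)\<^sup>2) \<le> norm (cube_section S u (\<lambda>x. (f x)\<^sup>2) x)"
    using pair_sigma_finite.AE_integrable_fst'[OF pair_sigma_finite_cube integrable_merge_cube[OF assms(1,2,3)]]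
      pair_sigma_finite.AE_integrable_fst'[OF pair_sigma_finite_cube integrable_merge_cube[OF assms(1,2,4)]]
  proof eventually_elim
    case (elim x)
    have "(cube_section S u f x)\<^sup>2 \<le> cube_section S u (\<lambda>x. (f x)\<^sup>2) x"
      using cube.variance_eq[OF elim] cube.variance_positive[where X = "\<lambda>y. f (merge u (S - u) (x, y))" and u = "S - u"]
      by (simp add: cube_section_def)
    then show ?case by simp
  qed
qed

lemma tensor_merge: "u \<inter> v = {} \<Longrightarrow> tensor u F (merge u v (x, y)) = tensor u F x"
  and tensor_merge': "u \<inter> v = {} \<Longrightarrow> tensor v F (merge u v (x, y)) = tensor v F y"
  by (auto simp: tensor_def merge_def intro!: prod.cong)

text \<open>The component of the error functional belonging to u: the error pairs it in L2 with the
  averaged mixed derivative of the integrand (\<open>rule_error_eq\<close>). Its squared L2 norm is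
  \<open>error_form\<close>, and the weighted sum of these, \<open>sq_error\<close>, is the squared
  dual norm.\<close>

definition mean_kap :: "nat \<Rightarrow> (nat \<Rightarrow> nat \<Rightarrow> real) \<Rightarrow> nat set \<Rightarrow> (nat \<Rightarrow> real) \<Rightarrow> real" where
  "mean_kap N X u y = 1 / real N * (\<Sum>k=1..N. tensor u (\<lambda>j. kap (X k j)) y)"

definition error_form :: "nat \<Rightarrow> (nat \<Rightarrow> nat \<Rightarrow> real) \<Rightarrow> nat set \<Rightarrow> real" where
  "error_form N X u = 1 / (real N)\<^sup>2 * (\<Sum>k=1..N. \<Sum>l=1..N. \<Prod>j\<in>u. eta (X k j) (X l j))"

definition sq_error :: "nat \<Rightarrow> nat \<Rightarrow> (nat set \<Rightarrow> real) \<Rightarrow> (nat \<Rightarrow> nat \<Rightarrow> real) \<Rightarrow> real" where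
  "sq_error N s \<gamma> X = (\<Sum>u\<in>Pow {1..s} - {{}}. \<gamma> u * error_form N X u)"

lemma bounded_meas_kap: "bounded_meas (kap x)"
  using kap_bound[of _ x] by (auto simp: bounded_meas_def intro: exI[of _ 1])

lemma mean_kap_measurable:
  "u \<subseteq> S \<Longrightarrow> mean_kap N X u \<in> borel_measurable (cube_measure S)"
  unfolding mean_kap_def[abs_def]
  by (intro borel_measurable_times borel_measurable_sum borel_measurable_const
      tensor_bounded_meas_measurable bounded_meas_kap)

lemma tensor_kap_bound:
  assumes "finite S" "u \<subseteq> S" "y \<in> unit_cube S"
  shows "\<bar>tensor u (\<lambda>j. kap (x j)) y\<bar> \<le> 1"
proof -
  have "\<bar>tensor u (\<lambda>j. kap (x j)) y\<bar> \<le> 1 ^ card u"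
    using assms finite_subset by (intro tensor_bound kap_bound) (auto dest: unit_cubeD)
  then show ?thesis by simp
qed

lemma mean_kap_bound:
  assumes "finite S" "u \<subseteq> S" "y \<in> unit_cube S"
  shows "\<bar>mean_kap N X u y\<bar> \<le> 1"
proof -
  have "\<bar>\<Sum>k=1..N. tensor u (\<lambda>j. kap (X k j)) y\<bar> \<le> (\<Sum>k=1..N. 1)"
    by (rule order_trans[OF sum_abs sum_mono]) (rule tensor_kap_bound[OF assms])
  then have "\<bar>mean_kap N X u y\<bar> \<le> 1 / real N * real N"
    unfolding mean_kap_def abs_mult by (intro mult_mono) auto
  also have "\<dots> \<le> 1" by simp
  finally show ?thesis .
qed

lemma integrable_mean_kap_sq:
  assumes "finite u" shows "integrable (cube_measure u) (\<lambda>y. (mean_kap N X u y)\<^sup>2)"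
proof (rule bounded_cube_integrable)
  show "(\<lambda>y. (mean_kap N X u y)\<^sup>2) \<in> borel_measurable (cube_measure u)"
    by (intro borel_measurable_power mean_kap_measurable) simp
  show "\<bar>(mean_kap N X u y)\<^sup>2\<bar> \<le> 1" if "y \<in> unit_cube u" for y
    using mean_kap_bound[OF assms order_refl that, of N X] by (simp add: abs_square_le_1)
qed

text \<open>The square expands into a double sum over pairs of nodes; each summand is a tensor
  product whose integral factorizes into integrals of \<open>kap\<close> times
  \<open>kap\<close>.\<close>

lemma integral_mean_kap_sq:
  assumes "finite u" "\<And>k j. k \<in> {1..N} \<Longrightarrow> j \<in> u \<Longrightarrow> X k j \<in> {0..1}"
  shows "(\<integral>y. (mean_kap N X u y)\<^sup>2 \<partial>cube_measure u) = error_form N X u"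
proof -
  let ?K = "\<lambda>k l j t. kap (X k j) t * kap (X l j) t"
  have bm: "bounded_meas (?K k l j)" for k l j
    unfolding bounded_meas_def
  proof (intro conjI exI[of _ 1] ballI)
    show "?K k l j \<in> borel_measurable borel" by measurable
    fix t :: real assume t: "t \<in> {0..1}"
    show "\<bar>?K k l j t\<bar> \<le> 1"
      unfolding abs_mult by (rule mult_le_one[OF kap_bound[OF t] abs_ge_zero kap_bound[OF t]])
  qed
  have "(mean_kap N X u y)\<^sup>2 = 1 / (real N)\<^sup>2 * (\<Sum>k=1..N. \<Sum>l=1..N. tensor u (?K k l) y)" for y
    unfolding mean_kap_def power_mult_distrib power_one_over power2_eq_square[of "sum _ _"] sum_product
    by (simp only: tensor_def prod.distrib)
  then have "(\<integral>y. (mean_kap N X u y)\<^sup>2 \<partial>cube_measure u)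
      = 1 / (real N)\<^sup>2 * (\<integral>y. (\<Sum>k=1..N. \<Sum>l=1..N. tensor u (?K k l) y) \<partial>cube_measure u)"
    by (simp only: integral_mult_right_zero)
  also have "(\<integral>y. (\<Sum>k=1..N. \<Sum>l=1..N. tensor u (?K k l) y) \<partial>cube_measure u)
      = (\<Sum>k=1..N. \<Sum>l=1..N. \<integral>y. tensor u (?K k l) y \<partial>cube_measure u)"
  proof -
    have "integrable (cube_measure u) (tensor u (?K k l))" for k l
    proof -
      obtain B where "\<And>x. x \<in> unit_cube u \<Longrightarrow> \<bar>tensor u (?K k l) x\<bar> \<le> B"
        by (rule tensor_bounded_meas[where e = "?K k l", OF assms(1) bm]) (rule that)
      then show ?thesis
        by (rule bounded_cube_integrable[OF tensor_bounded_meas_measurable[OF order_refl bm]])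
    qed
    note int = this
    have "(\<integral>y. (\<Sum>k=1..N. \<Sum>l=1..N. tensor u (?K k l) y) \<partial>cube_measure u)
        = (\<Sum>k=1..N. \<integral>y. (\<Sum>l=1..N. tensor u (?K k l) y) \<partial>cube_measure u)"
      by (rule Bochner_Integration.integral_sum) (intro Bochner_Integration.integrable_sum int)
    also have "\<dots> = (\<Sum>k=1..N. \<Sum>l=1..N. \<integral>y. tensor u (?K k l) y \<partial>cube_measure u)"
      by (intro sum.cong refl Bochner_Integration.integral_sum int)
    finally show ?thesis .
  qed
  also have "\<dots> = (\<Sum>k=1..N. \<Sum>l=1..N. \<Prod>j\<in>u. eta (X k j) (X l j))"
  proof (intro sum.cong refl)
    fix k l assume "k \<in> {1..N}" "l \<in> {1..N}"
    show "(\<integral>y. tensor u (?K k l) y \<partial>cube_measure u) = (\<Prod>j\<in>u. eta (X k j) (X l j))"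
      using assms(2)[OF \<open>k \<in> {1..N}\<close>] assms(2)[OF \<open>l \<in> {1..N}\<close>]
      by (subst integral_tensor[OF assms(1) bounded_meas_integrable[OF bm]])
        (intro prod.cong refl integral_kap_kap)
  qed
  finally show ?thesis unfolding error_form_def .
qed

lemma sq_error_nonneg:
  assumes "\<And>u. u \<subseteq> {1..s} \<Longrightarrow> \<gamma> u > 0"
    and "\<And>k j. k \<in> {1..N} \<Longrightarrow> j \<in> {1..s} \<Longrightarrow> X k j \<in> {0..1}"
  shows "sq_error N s \<gamma> X \<ge> 0"
  unfolding sq_error_def
proof (intro sum_nonneg mult_nonneg_nonneg)
  fix u assume "u \<in> Pow {1..s} - {{}}"
  then have u: "u \<subseteq> {1..s}" "finite u" using finite_subset by auto
  then show "0 \<le> \<gamma> u" using assms(1) less_imp_le by blast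
  have "error_form N X u = (\<integral>y. (mean_kap N X u y)\<^sup>2 \<partial>cube_measure u)"
    using u assms(2) by (intro integral_mean_kap_sq[symmetric]) auto
  then show "0 \<le> error_form N X u" by simp
qed

section \<open>The error of an equal-weight rule with arbitrary nodes\<close>

definition rule_error :: "nat \<Rightarrow> nat \<Rightarrow> (nat \<Rightarrow> nat \<Rightarrow> real) \<Rightarrow> ((nat \<Rightarrow> real) \<Rightarrow> real) \<Rightarrow> real" where
  "rule_error N s X f = 1 / real N * (\<Sum>k=1..N. f (X k)) - cube_integral s f"

lemma sobolev_norm_section:
  "sobolev_norm s \<gamma> f = sqrt (\<Sum>u\<in>Pow {1..s}. inverse (\<gamma> u) *
     (\<integral>x. (cube_section {1..s} u (weak_mixed_deriv s u f) x)\<^sup>2 \<partial>cube_measure u))"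
  by (simp add: sobolev_norm_def cube_section_def)

lemma weak_mixed_deriv_props:
  assumes "f \<in> sobolev_space s" "u \<subseteq> {1..s}"
  shows "square_integrable s (weak_mixed_deriv s u f)" "has_weak_mixed_deriv s u f (weak_mixed_deriv s u f)"
proof -
  have "\<exists>g. square_integrable s g \<and> has_weak_mixed_deriv s u f g"
    using assms by (auto simp: sobolev_space_def)
  from someI_ex[OF this]
  show "square_integrable s (weak_mixed_deriv s u f)" "has_weak_mixed_deriv s u f (weak_mixed_deriv s u f)"
    by (simp_all add: weak_mixed_deriv_def)
qed

lemma rule_error_eq:
  assumes f: "f \<in> sobolev_space s" and N: "N \<ge> 1"
    and X: "\<And>k. k \<in> {1..N} \<Longrightarrow> X k \<in> {1..s} \<rightarrow>\<^sub>E {0..<1}"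
  shows "rule_error N s X f = (\<Sum>u\<in>Pow {1..s} - {{}}.
     \<integral>x. cube_section {1..s} u (weak_mixed_deriv s u f) x * mean_kap N X u x \<partial>cube_measure u)"
proof -
  define S where "S = {1..s}"
  have fin: "finite S" by (simp add: S_def)
  let ?D = "\<lambda>u. weak_mixed_deriv s u f"
  have D: "integrable (cube_measure S) (?D u)" if "u \<subseteq> S" for u
    using square_integrable_imp_integrable weak_mixed_deriv_props(1)[OF f] that by (simp add: S_def)
  have cont: "continuous_on (unit_cube {1..s}) f" using f by (simp add: sobolev_space_def)
  have DK: "integrable (cube_measure S) (\<lambda>y. ?D u y * tensor u (\<lambda>j. kap (X k j)) y)" if "u \<subseteq> S" for u k
    using tensor_kap_bound[OF fin that] D[OF that] that
    by (intro integrable_mult_bounded tensor_bounded_meas_measurable bounded_meas_kap)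
  have "(\<Sum>k=1..N. f (X k)) = (\<Sum>k=1..N. cube_integral s f + (\<Sum>u\<in>Pow S - {{}}.
     \<integral>y. ?D u y * tensor u (\<lambda>j. kap (X k j)) y \<partial>cube_measure S))"
    unfolding S_def using D weak_mixed_deriv_props(2)[OF f]
    by (intro sum.cong refl reproducing[OF cont _ X]) (simp_all add: S_def)
  also have "\<dots> = real N * cube_integral s f + (\<Sum>u\<in>Pow S - {{}}. \<Sum>k=1..N.
     \<integral>y. ?D u y * tensor u (\<lambda>j. kap (X k j)) y \<partial>cube_measure S)"
    unfolding sum.distrib sum.swap[of _ "{1..N}" "Pow S - {{}}"] by simp
  finally have "rule_error N s X f = (\<Sum>u\<in>Pow S - {{}}. 1 / real N * (\<Sum>k=1..N.
     \<integral>y. ?D u y * tensor u (\<lambda>j. kap (X k j)) y \<partial>cube_measure S))"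
    using N by (simp add: rule_error_def distrib_left sum_distrib_left)
  also have "\<dots> = (\<Sum>u\<in>Pow S - {{}}. \<integral>x. cube_section S u (?D u) x * mean_kap N X u x \<partial>cube_measure u)"
  proof (intro sum.cong refl)
    fix u assume "u \<in> Pow S - {{}}"
    then have u: "u \<subseteq> S" by auto
    have "1 / real N * (\<Sum>k=1..N. \<integral>y. ?D u y * tensor u (\<lambda>j. kap (X k j)) y \<partial>cube_measure S)
       = (\<integral>y. 1 / real N * (\<Sum>k=1..N. ?D u y * tensor u (\<lambda>j. kap (X k j)) y) \<partial>cube_measure S)"
      using DK[OF u] by (simp add: Bochner_Integration.integral_sum)
    also have "\<dots> = (\<integral>y. ?D u y * mean_kap N X u y \<partial>cube_measure S)"
      by (simp add: mean_kap_def sum_distrib_left algebra_simps)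
    also have "\<dots> = (\<integral>x. cube_section S u (\<lambda>y. ?D u y * mean_kap N X u y) x \<partial>cube_measure u)"
      using mean_kap_bound[OF fin u] D[OF u] u
      by (intro integral_cube_section fin integrable_mult_bounded mean_kap_measurable)
    \<comment> \<open>\<open>mean_kap N X u\<close> depends only on the coordinates in u and can be
      pulled out of the inner integral.\<close>
    also have "\<dots> = (\<integral>x. cube_section S u (?D u) x * mean_kap N X u x \<partial>cube_measure u)"
      by (simp add: cube_section_def mean_kap_def tensor_merge)
    finally show "1 / real N * (\<Sum>k=1..N. \<integral>y. ?D u y * tensor u (\<lambda>j. kap (X k j)) y \<partial>cube_measure S)
       = (\<integral>x. cube_section S u (?D u) x * mean_kap N X u x \<partial>cube_measure u)" .
  qed
  finally show ?thesis by (simp add: S_def)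
qed

text \<open>Cauchy-Schwarz in the form of Young's inequality with a parameter r above the root of
  \<open>sq_error\<close>, followed by letting r decrease to it. Strict inequality gives r > 0, so
  an error of 0 needs no separate case.\<close>

lemma rule_error_le:
  assumes f: "f \<in> sobolev_space s" "sobolev_norm s \<gamma> f \<le> 1" and N: "N \<ge> 1"
    and \<gamma>: "\<And>u. u \<subseteq> {1..s} \<Longrightarrow> \<gamma> u > 0"
    and X: "\<And>k. k \<in> {1..N} \<Longrightarrow> X k \<in> {1..s} \<rightarrow>\<^sub>E {0..<1}"
  shows "\<bar>rule_error N s X f\<bar> \<le> sqrt (sq_error N s \<gamma> X)"
proof -
  define S where "S = {1..s}"
  have fin: "finite S" by (simp add: S_def)
  let ?a = "\<lambda>u. cube_section S u (weak_mixed_deriv s u f)"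
  have X01: "X k j \<in> {0..1}" if "k \<in> {1..N}" "j \<in> {1..s}" for k j
    using X[OF that(1)] that(2) by (force simp: PiE_iff)
  have E: "sq_error N s \<gamma> X \<ge> 0" using \<gamma> X01 by (intro sq_error_nonneg)
  have a_int: "integrable (cube_measure u) (\<lambda>x. (?a u x)\<^sup>2)" if "u \<subseteq> S" for u
  proof (rule integrable_cube_section_sq[OF fin that])
    have "square_integrable s (weak_mixed_deriv s u f)"
      using weak_mixed_deriv_props(1)[OF f(1)] that by (simp add: S_def)
    then show "integrable (cube_measure S) (weak_mixed_deriv s u f)"
      "integrable (cube_measure S) (\<lambda>x. (weak_mixed_deriv s u f x)\<^sup>2)"
      unfolding S_def by (rule square_integrable_imp_integrable, simp only: square_integrable_def)
  qed
  have "(\<Sum>u\<in>Pow S. inverse (\<gamma> u) * (\<integral>x. (?a u x)\<^sup>2 \<partial>cube_measure u)) \<le> 1"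
    using f(2) by (simp add: sobolev_norm_section S_def)
  moreover have "(\<Sum>u\<in>Pow S - {{}}. inverse (\<gamma> u) * (\<integral>x. (?a u x)\<^sup>2 \<partial>cube_measure u))
      \<le> (\<Sum>u\<in>Pow S. inverse (\<gamma> u) * (\<integral>x. (?a u x)\<^sup>2 \<partial>cube_measure u))"
    using fin \<gamma> by (intro sum_mono2 mult_nonneg_nonneg) (auto simp: S_def less_imp_le)
  ultimately have norm: "(\<Sum>u\<in>Pow S - {{}}. inverse (\<gamma> u) * (\<integral>x. (?a u x)\<^sup>2 \<partial>cube_measure u)) \<le> 1"
    by linarith
  have bound: "\<bar>rule_error N s X f\<bar> \<le> r" if r: "r > sqrt (sq_error N s \<gamma> X)" for r
  proof -
    have r0: "r > 0" using r E by (meson le_less_trans real_sqrt_ge_zero)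
    have each: "\<bar>\<integral>x. ?a u x * mean_kap N X u x \<partial>cube_measure u\<bar>
       \<le> r / 2 * (inverse (\<gamma> u) * (\<integral>x. (?a u x)\<^sup>2 \<partial>cube_measure u)) + 1 / (2 * r) * (\<gamma> u * error_form N X u)"
      if "u \<in> Pow S - {{}}" for u
    proof -
      have u: "u \<subseteq> S" "finite u" using that fin finite_subset by auto
      have g: "\<gamma> u > 0" using \<gamma> u by (simp add: S_def)
      have pw: "\<bar>?a u x * mean_kap N X u x\<bar>
          \<le> r / 2 * inverse (\<gamma> u) * (?a u x)\<^sup>2 + 1 / (2 * r) * \<gamma> u * (mean_kap N X u x)\<^sup>2" for x
      proof -
        \<comment> \<open>This ratio turns the two sums over u into r/2 times a squared norm of at
          most 1 and \<open>sq_error\<close> / (2 r); each is at most r/2.\<close>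
        define p where "p = r / \<gamma> u"
        have p: "p > 0" using r0 g by (simp add: p_def)
        have "0 \<le> (p * \<bar>?a u x\<bar> - \<bar>mean_kap N X u x\<bar>)\<^sup>2" by simp
        then have "2 * p * \<bar>?a u x * mean_kap N X u x\<bar> \<le> p\<^sup>2 * (?a u x)\<^sup>2 + (mean_kap N X u x)\<^sup>2"
          by (simp add: power2_diff power_mult_distrib abs_mult algebra_simps)
        then have "\<bar>?a u x * mean_kap N X u x\<bar> \<le> (p\<^sup>2 * (?a u x)\<^sup>2 + (mean_kap N X u x)\<^sup>2) / (2 * p)"
          using p by (simp add: field_simps)
        also have "\<dots> = r / 2 * inverse (\<gamma> u) * (?a u x)\<^sup>2 + 1 / (2 * r) * \<gamma> u * (mean_kap N X u x)\<^sup>2"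
          using r0 g by (simp add: p_def field_simps power2_eq_square)
        finally show ?thesis .
      qed
      let ?R = "\<lambda>x. r / 2 * inverse (\<gamma> u) * (?a u x)\<^sup>2 + 1 / (2 * r) * \<gamma> u * (mean_kap N X u x)\<^sup>2"
      have R: "integrable (cube_measure u) ?R"
        using a_int[OF u(1)] integrable_mean_kap_sq[OF u(2)] by auto
      have "integrable (cube_measure u) (\<lambda>x. ?a u x * mean_kap N X u x)"
      proof (rule Bochner_Integration.integrable_bound[OF R])
        have "weak_mixed_deriv s u f \<in> borel_measurable (cube_measure S)"
          using weak_mixed_deriv_props(1)[OF f(1)] u by (auto simp: square_integrable_def S_def)
        then show "(\<lambda>x. ?a u x * mean_kap N X u x) \<in> borel_measurable (cube_measure u)"
          using u by (intro borel_measurable_times measurable_cube_section mean_kap_measurable) auto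
        show "AE x in cube_measure u. norm (?a u x * mean_kap N X u x) \<le> norm (?R x)"
          using pw by (intro AE_I2) (metis abs_ge_self order_trans real_norm_def)
      qed
      then have "\<bar>\<integral>x. ?a u x * mean_kap N X u x \<partial>cube_measure u\<bar> \<le> (\<integral>x. ?R x \<partial>cube_measure u)"
        using R pw by (intro order_trans[OF integral_abs_bound integral_mono] integrable_abs)
      also have "\<dots> = r / 2 * inverse (\<gamma> u) * (\<integral>x. (?a u x)\<^sup>2 \<partial>cube_measure u)
          + 1 / (2 * r) * \<gamma> u * (\<integral>x. (mean_kap N X u x)\<^sup>2 \<partial>cube_measure u)"
        using a_int[OF u(1)] integrable_mean_kap_sq[OF u(2)] by simp
      also have "(\<integral>x. (mean_kap N X u x)\<^sup>2 \<partial>cube_measure u) = error_form N X u"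
        using u X01 by (intro integral_mean_kap_sq) (auto simp: S_def)
      finally show ?thesis by (simp add: mult.assoc)
    qed
    have "\<bar>rule_error N s X f\<bar> \<le> (\<Sum>u\<in>Pow S - {{}}. \<bar>\<integral>x. ?a u x * mean_kap N X u x \<partial>cube_measure u\<bar>)"
    proof -
      have "rule_error N s X f = (\<Sum>u\<in>Pow S - {{}}. \<integral>x. ?a u x * mean_kap N X u x \<partial>cube_measure u)"
        unfolding S_def by (rule rule_error_eq[OF f(1) N]) (rule X)
      then show ?thesis by (simp only: sum_abs)
    qed
    also have "\<dots> \<le> (\<Sum>u\<in>Pow S - {{}}. r / 2 * (inverse (\<gamma> u) * (\<integral>x. (?a u x)\<^sup>2 \<partial>cube_measure u))
        + 1 / (2 * r) * (\<gamma> u * error_form N X u))"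
      by (rule sum_mono[OF each])
    also have "\<dots> = r / 2 * (\<Sum>u\<in>Pow S - {{}}. inverse (\<gamma> u) * (\<integral>x. (?a u x)\<^sup>2 \<partial>cube_measure u))
        + 1 / (2 * r) * sq_error N s \<gamma> X"
      by (simp only: sum.distrib sum_distrib_left[symmetric] sq_error_def S_def)
    also have "\<dots> \<le> r / 2 * 1 + 1 / (2 * r) * r\<^sup>2"
    proof (intro add_mono mult_left_mono norm)
      have "(sqrt (sq_error N s \<gamma> X))\<^sup>2 \<le> r\<^sup>2" using r E by (intro power_mono) auto
      then show "sq_error N s \<gamma> X \<le> r\<^sup>2" using E by simp
    qed (use r0 in auto)
    also have "\<dots> = r" using r0 by (simp add: power2_eq_square)
    finally show ?thesis .
  qed
  then show ?thesis by (rule dense_ge)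
qed

subsection \<open>Weighted sums of tensor products\<close>

lemma smooth_fun_mixed_partial:
  assumes "u \<subseteq> {1..s}" "smooth_fun s \<phi>"
  shows "smooth_fun s (mixed_partial u \<phi>)"
proof -
  have "smooth_fun s (foldr partial_deriv is \<phi>)" if "set is \<subseteq> {1..s}" for "is"
    using that by (induction "is") (simp_all add: assms(2) smooth_fun_D(2))
  moreover have "finite u" using assms(1) finite_subset by blast
  ultimately show ?thesis using assms(1) by (simp add: mixed_partial_def)
qed

lemma smooth_fun_cube:
  assumes "smooth_fun s \<phi>"
  shows "\<phi> \<in> borel_measurable (cube_measure {1..s})"
    and "\<exists>B. \<forall>x\<in>unit_cube {1..s}. \<bar>\<phi> x\<bar> \<le> B"
proof -
  have cont: "continuous_on (unit_cube {1..s}) \<phi>"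
    using smooth_fun_D(1)[OF assms] by (rule continuous_on_subset) (auto simp: unit_cube_def)
  show "\<phi> \<in> borel_measurable (cube_measure {1..s})"
    by (rule continuous_on_cube_measurable[OF cont])
  show "\<exists>B. \<forall>x\<in>unit_cube {1..s}. \<bar>\<phi> x\<bar> \<le> B"
    using continuous_on_cube_bounded[OF cont] by metis
qed

text \<open>The difference of two weak derivatives integrates to 0 against every test function, so
  the fundamental lemma applies.\<close>

lemma weak_mixed_deriv_unique:
  assumes "integrable (cube_measure {1..s}) g" "integrable (cube_measure {1..s}) g'"
    "has_weak_mixed_deriv s u f g" "has_weak_mixed_deriv s u f g'"
  shows "AE x in cube_measure {1..s}. g x = g' x"
proof -
  have "AE x in cube_measure {1..s}. g x - g' x = 0"
  proof (rule fundamental_lemma)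
    show "integrable (cube_measure {1..s}) (\<lambda>x. g x - g' x)"
      using assms(1,2) by (rule Bochner_Integration.integrable_diff)
    fix \<phi> assume \<phi>: "test_fun s \<phi>"
    then have sm: "smooth_fun s \<phi>" by (simp add: test_fun_def)
    obtain B where B: "\<And>x. x \<in> unit_cube {1..s} \<Longrightarrow> \<bar>\<phi> x\<bar> \<le> B" using smooth_fun_cube(2)[OF sm] by metis
    note int = integrable_mult_bounded[OF assms(1) smooth_fun_cube(1)[OF sm] B]
      integrable_mult_bounded[OF assms(2) smooth_fun_cube(1)[OF sm] B]
    have "(- 1) ^ card u * (\<integral>x. g x * \<phi> x \<partial>cube_measure {1..s})
        = (- 1) ^ card u * (\<integral>x. g' x * \<phi> x \<partial>cube_measure {1..s})"
      using assms(3,4) \<phi> unfolding has_weak_mixed_deriv_def by metis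
    then have "(\<integral>x. g x * \<phi> x \<partial>cube_measure {1..s}) = (\<integral>x. g' x * \<phi> x \<partial>cube_measure {1..s})" by simp
    then show "(\<integral>x. (g x - g' x) * \<phi> x \<partial>cube_measure {1..s}) = 0"
      unfolding left_diff_distrib by (subst Bochner_Integration.integral_diff[OF int]) simp_all
  qed
  then show ?thesis by simp
qed

text \<open>The shape of the extremal function, whose index set \<open>P\<close> will consist of
  pairs of a coordinate set and a node number.\<close>

definition tensor_sum ::
    "nat set \<Rightarrow> 'p set \<Rightarrow> ('p \<Rightarrow> real) \<Rightarrow> ('p \<Rightarrow> nat \<Rightarrow> real \<Rightarrow> real) \<Rightarrow> (nat \<Rightarrow> real) \<Rightarrow> real" where
  "tensor_sum S P w e y = (\<Sum>p\<in>P. w p * tensor S (e p) y)"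

lemma tensor_sum_bounded_meas:
  assumes "finite S" "\<And>p j. p \<in> P \<Longrightarrow> j \<in> S \<Longrightarrow> bounded_meas (e p j)"
  shows "tensor_sum S P w e \<in> borel_measurable (cube_measure S)"
    and "\<exists>B. \<forall>y\<in>unit_cube S. \<bar>tensor_sum S P w e y\<bar> \<le> B"
proof -
  show "tensor_sum S P w e \<in> borel_measurable (cube_measure S)"
    unfolding tensor_sum_def[abs_def] using assms(2)
    by (intro borel_measurable_sum borel_measurable_times borel_measurable_const
        tensor_bounded_meas_measurable) auto
  have "\<exists>B. \<forall>y\<in>unit_cube S. \<bar>tensor S (e p) y\<bar> \<le> B" if "p \<in> P" for p
    by (rule tensor_bounded_meas[where e = "e p", OF assms(1) assms(2)[OF that]]) blast+
  then obtain B where B: "\<And>p y. p \<in> P \<Longrightarrow> y \<in> unit_cube S \<Longrightarrow> \<bar>tensor S (e p) y\<bar> \<le> B p" by metis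
  have "\<bar>tensor_sum S P w e y\<bar> \<le> (\<Sum>p\<in>P. \<bar>w p\<bar> * B p)" if "y \<in> unit_cube S" for y
    unfolding tensor_sum_def using B that
    by (intro order_trans[OF sum_abs sum_mono]) (simp add: abs_mult mult_left_mono)
  then show "\<exists>B. \<forall>y\<in>unit_cube S. \<bar>tensor_sum S P w e y\<bar> \<le> B" by blast
qed

lemma tensor_sum_square_integrable:
  assumes "\<And>p j. p \<in> P \<Longrightarrow> j \<in> {1..s} \<Longrightarrow> bounded_meas (e p j)"
  shows "square_integrable s (tensor_sum {1..s} P w e)"
proof -
  note meas = tensor_sum_bounded_meas(1)[where S = "{1..s}" and e = e and P = P and w = w, OF finite_atLeastAtMost assms]
  obtain B where B: "\<forall>y\<in>unit_cube {1..s}. \<bar>tensor_sum {1..s} P w e y\<bar> \<le> B"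
    using tensor_sum_bounded_meas(2)[where S = "{1..s}" and e = e and P = P and w = w, OF finite_atLeastAtMost assms] by blast
  have "\<bar>(tensor_sum {1..s} P w e y)\<^sup>2\<bar> \<le> B\<^sup>2" if "y \<in> unit_cube {1..s}" for y
    using power_mono[of "\<bar>tensor_sum {1..s} P w e y\<bar>" B 2] B that by simp
  then have "integrable (cube_measure {1..s}) (\<lambda>y. (tensor_sum {1..s} P w e y)\<^sup>2)"
    using meas by (intro bounded_cube_integrable[where B = "B\<^sup>2"] borel_measurable_power)
  with meas show ?thesis by (simp add: square_integrable_def)
qed

definition mixed_factor :: "nat set \<Rightarrow> ('p \<Rightarrow> nat \<Rightarrow> real \<Rightarrow> real) \<Rightarrow> ('p \<Rightarrow> nat \<Rightarrow> real \<Rightarrow> real) \<Rightarrow> 'p \<Rightarrow> nat \<Rightarrow> real \<Rightarrow> real" where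
  "mixed_factor v e e' p j = (if j \<in> v then e' p j else e p j)"

lemma piecewise_deriv_bounded_meas:
  "piecewise_deriv c c' \<Longrightarrow> bounded_meas c" "piecewise_deriv c c' \<Longrightarrow> bounded_meas c'"
  by (auto simp: piecewise_deriv_def)

lemma mixed_factor_bounded_meas:
  "piecewise_deriv (e p j) (e' p j) \<Longrightarrow> bounded_meas (mixed_factor v e e' p j)"
  by (auto simp: mixed_factor_def piecewise_deriv_bounded_meas)

lemma tensor_sum_weak_deriv:
  assumes "v \<subseteq> {1..s}" "\<And>p j. p \<in> P \<Longrightarrow> j \<in> {1..s} \<Longrightarrow> piecewise_deriv (e p j) (e' p j)"
  shows "has_weak_mixed_deriv s v (tensor_sum {1..s} P w e) (tensor_sum {1..s} P w (mixed_factor v e e'))"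
  unfolding has_weak_mixed_deriv_def
proof (intro allI impI)
  fix \<phi> assume \<phi>: "test_fun s \<phi>"
  let ?M = "cube_measure {1..s}"
  have sm: "smooth_fun s \<phi>" "smooth_fun s (mixed_partial v \<phi>)"
    using \<phi> assms(1) smooth_fun_mixed_partial by (auto simp: test_fun_def)
  have bm: "\<And>j. j \<in> {1..s} \<Longrightarrow> bounded_meas (e p j)"
    "\<And>j. j \<in> {1..s} \<Longrightarrow> bounded_meas (mixed_factor v e e' p j)" if "p \<in> P" for p
    by (rule piecewise_deriv_bounded_meas(1)[OF assms(2)[OF that]], assumption)
       (rule mixed_factor_bounded_meas[where e = e and e' = e' and p = p, OF assms(2)[OF that]], assumption)
  have int: "(\<integral>x. tensor_sum {1..s} P w c x * \<psi> x \<partial>?M) = (\<Sum>p\<in>P. w p * (\<integral>x. tensor {1..s} (c p) x * \<psi> x \<partial>?M))"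
    if "smooth_fun s \<psi>" "\<And>p j. p \<in> P \<Longrightarrow> j \<in> {1..s} \<Longrightarrow> bounded_meas (c p j)" for c \<psi>
  proof -
    have "(\<integral>x. tensor_sum {1..s} P w c x * \<psi> x \<partial>?M) = (\<integral>x. (\<Sum>p\<in>P. w p * (tensor {1..s} (c p) x * \<psi> x)) \<partial>?M)"
      by (simp only: tensor_sum_def sum_distrib_right mult.assoc)
    also have "\<dots> = (\<Sum>p\<in>P. \<integral>x. w p * (tensor {1..s} (c p) x * \<psi> x) \<partial>?M)"
      by (rule Bochner_Integration.integral_sum)
         (rule integrable_mult_right[OF integrable_tensor_vanishing[OF that(2) that(1)]])
    finally show ?thesis by (simp only: integral_mult_right_zero)
  qed
  have "(\<integral>x. tensor_sum {1..s} P w e x * mixed_partial v \<phi> x \<partial>?M)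
      = (\<Sum>p\<in>P. w p * (\<integral>x. tensor {1..s} (e p) x * mixed_partial v \<phi> x \<partial>?M))"
    by (rule int[OF sm(2) bm(1)])
  also have "\<dots> = (\<Sum>p\<in>P. w p * ((- 1) ^ card v * (\<integral>x. tensor {1..s} (mixed_factor v e e' p) x * \<phi> x \<partial>?M)))"
  proof (rule sum.cong[OF refl])
    fix p assume "p \<in> P"
    from tensor_weak_deriv[of v s "e p" "e' p", OF assms(1) assms(2)[OF this]]
    have "has_weak_mixed_deriv s v (tensor {1..s} (e p)) (tensor {1..s} (mixed_factor v e e' p))"
      unfolding mixed_factor_def[abs_def] .
    with \<phi> show "w p * (\<integral>x. tensor {1..s} (e p) x * mixed_partial v \<phi> x \<partial>?M)
        = w p * ((- 1) ^ card v * (\<integral>x. tensor {1..s} (mixed_factor v e e' p) x * \<phi> x \<partial>?M))"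
      by (simp only: has_weak_mixed_deriv_def)
  qed
  also have "\<dots> = (- 1) ^ card v * (\<Sum>p\<in>P. w p * (\<integral>x. tensor {1..s} (mixed_factor v e e' p) x * \<phi> x \<partial>?M))"
    by (simp only: sum_distrib_left mult.left_commute)
  also have "(\<Sum>p\<in>P. w p * (\<integral>x. tensor {1..s} (mixed_factor v e e' p) x * \<phi> x \<partial>?M))
      = (\<integral>x. tensor_sum {1..s} P w (mixed_factor v e e') x * \<phi> x \<partial>?M)"
    by (rule int[OF sm(1) bm(2), symmetric])
  finally show "(\<integral>x. tensor_sum {1..s} P w e x * mixed_partial v \<phi> x \<partial>?M)
      = (- 1) ^ card v * (\<integral>x. tensor_sum {1..s} P w (mixed_factor v e e') x * \<phi> x \<partial>?M)" .
qed

lemma tensor_sum_section: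
  assumes "finite S" "v \<subseteq> S" "\<And>p j. p \<in> P \<Longrightarrow> j \<in> S \<Longrightarrow> piecewise_deriv (e p j) (e' p j)"
  shows "cube_section S v (tensor_sum S P w (mixed_factor v e e')) x
    = (\<Sum>p\<in>P. w p * (tensor v (e' p) x * (\<Prod>j\<in>S - v. integral\<^sup>L unit_measure (e p j))))"
proof -
  have disj: "v \<inter> (S - v) = {}" and fin: "finite v" "finite (S - v)"
    using assms finite_subset by auto
  have split: "tensor S (mixed_factor v e e' p) (merge v (S - v) (x, y)) = tensor v (e' p) x * tensor (S - v) (e p) y" for p y
  proof -
    have "tensor S F q = tensor v F q * tensor (S - v) F q" for F q
      unfolding tensor_def using prod.subset_diff[OF assms(2,1)] by (simp add: mult.commute)
    moreover have "tensor v (mixed_factor v e e' p) = tensor v (e' p)"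
      "tensor (S - v) (mixed_factor v e e' p) = tensor (S - v) (e p)"
      by (auto simp: tensor_def mixed_factor_def fun_eq_iff)
    ultimately show ?thesis by (simp add: tensor_merge[OF disj] tensor_merge'[OF disj])
  qed
  have int: "integrable (cube_measure (S - v)) (tensor (S - v) (e p))" if "p \<in> P" for p
  proof -
    have bm: "bounded_meas (e p j)" if "j \<in> S - v" for j
      by (rule piecewise_deriv_bounded_meas(1)[OF assms(3)[OF \<open>p \<in> P\<close>]]) (use that in simp)
    obtain B where "\<And>y. y \<in> unit_cube (S - v) \<Longrightarrow> \<bar>tensor (S - v) (e p) y\<bar> \<le> B"
      by (rule tensor_bounded_meas[where e = "e p", OF fin(2) bm]) (assumption, rule that)
    moreover have "tensor (S - v) (e p) \<in> borel_measurable (cube_measure (S - v))"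
      by (rule tensor_bounded_meas_measurable[OF order_refl]) (rule bm)
    ultimately show ?thesis using bounded_cube_integrable by metis
  qed
  have "cube_section S v (tensor_sum S P w (mixed_factor v e e')) x
    = (\<integral>y. (\<Sum>p\<in>P. w p * (tensor v (e' p) x * tensor (S - v) (e p) y)) \<partial>cube_measure (S - v))"
    by (simp only: cube_section_def tensor_sum_def split)
  also have "\<dots> = (\<Sum>p\<in>P. \<integral>y. w p * (tensor v (e' p) x * tensor (S - v) (e p) y) \<partial>cube_measure (S - v))"
    by (rule Bochner_Integration.integral_sum) (intro integrable_mult_right int)
  also have "\<dots> = (\<Sum>p\<in>P. w p * (tensor v (e' p) x * (\<Prod>j\<in>S - v. integral\<^sup>L unit_measure (e p j))))"
  proof (rule sum.cong[OF refl])
    fix p assume "p \<in> P"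
    then have "integrable unit_measure (e p j)" if "j \<in> S - v" for j
      by (rule bounded_meas_integrable[OF piecewise_deriv_bounded_meas(1)[OF assms(3)]]) (use that in simp)
    from integral_tensor[OF fin(2) this]
    show "(\<integral>y. w p * (tensor v (e' p) x * tensor (S - v) (e p) y) \<partial>cube_measure (S - v))
        = w p * (tensor v (e' p) x * (\<Prod>j\<in>S - v. integral\<^sup>L unit_measure (e p j)))"
      by (simp only: integral_mult_right_zero)
  qed
  finally show ?thesis .
qed

lemma tensor_sum_sobolev:
  assumes "\<And>p j. p \<in> P \<Longrightarrow> j \<in> {1..s} \<Longrightarrow> piecewise_deriv (e p j) (e' p j)"
    "\<And>p j. p \<in> P \<Longrightarrow> j \<in> {1..s} \<Longrightarrow> continuous_on UNIV (e p j)"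
  shows "tensor_sum {1..s} P w e \<in> sobolev_space s"
  unfolding sobolev_space_def
proof (rule CollectI, rule conjI, goal_cases)
  case 1
  show ?case
    unfolding tensor_sum_def[abs_def]
    by (intro continuous_on_sum continuous_on_mult continuous_on_const continuous_on_tensor
        finite_atLeastAtMost assms(2))
next
  case 2
  show ?case
  proof (intro allI impI exI conjI)
    fix v assume v: "v \<subseteq> {1..s}"
    show "square_integrable s (tensor_sum {1..s} P w (mixed_factor v e e'))"
      by (rule tensor_sum_square_integrable[OF mixed_factor_bounded_meas[where e = e and e' = e', OF assms(1)]])
    show "has_weak_mixed_deriv s v (tensor_sum {1..s} P w e) (tensor_sum {1..s} P w (mixed_factor v e e'))"
      by (intro tensor_sum_weak_deriv v assms(1))
  qed
qed

text \<open>The weak derivative picked by \<open>SOME\<close> is replaced by the explicit one, with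
  which it agrees almost everywhere; this makes the norm of a concrete function computable.\<close>

lemma tensor_sum_weak_section:
  fixes w :: "'p \<Rightarrow> real" and e e' :: "'p \<Rightarrow> nat \<Rightarrow> real \<Rightarrow> real"
  assumes "\<And>p j. p \<in> P \<Longrightarrow> j \<in> {1..s} \<Longrightarrow> piecewise_deriv (e p j) (e' p j)"
    "\<And>p j. p \<in> P \<Longrightarrow> j \<in> {1..s} \<Longrightarrow> continuous_on UNIV (e p j)" "v \<subseteq> {1..s}"
  defines "f \<equiv> tensor_sum {1..s} P w e"
  shows "(\<integral>x. (cube_section {1..s} v (weak_mixed_deriv s v f) x)\<^sup>2 \<partial>cube_measure v)
    = (\<integral>x. (\<Sum>p\<in>P. w p * (tensor v (e' p) x * (\<Prod>j\<in>{1..s} - v. integral\<^sup>L unit_measure (e p j))))\<^sup>2 \<partial>cube_measure v)"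
proof -
  let ?g = "tensor_sum {1..s} P w (mixed_factor v e e')"
  have f: "f \<in> sobolev_space s" unfolding f_def by (rule tensor_sum_sobolev[OF assms(1,2)])
  note D = weak_mixed_deriv_props[OF f assms(3)]
  have g: "square_integrable s ?g"
    by (rule tensor_sum_square_integrable[OF mixed_factor_bounded_meas[where e = e and e' = e', OF assms(1)]])
  have gw: "has_weak_mixed_deriv s v f ?g"
    unfolding f_def by (intro tensor_sum_weak_deriv assms(3) assms(1))
  have meas: "weak_mixed_deriv s v f \<in> borel_measurable (cube_measure {1..s})"
      "?g \<in> borel_measurable (cube_measure {1..s})"
    using D(1) g by (simp_all only: square_integrable_def)
  have "AE x in cube_measure {1..s}. weak_mixed_deriv s v f x = ?g x"
    by (rule weak_mixed_deriv_unique[OF square_integrable_imp_integrable[OF D(1)]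
        square_integrable_imp_integrable[OF g] D(2) gw])
  from cube_section_cong_AE[OF finite_atLeastAtMost assms(3) meas this]
  have AE: "AE x in cube_measure v. (cube_section {1..s} v (weak_mixed_deriv s v f) x)\<^sup>2
      = (cube_section {1..s} v ?g x)\<^sup>2"
    by (rule eventually_mono) simp
  have "(\<integral>x. (cube_section {1..s} v (weak_mixed_deriv s v f) x)\<^sup>2 \<partial>cube_measure v)
      = (\<integral>x. (cube_section {1..s} v ?g x)\<^sup>2 \<partial>cube_measure v)"
    by (rule integral_cong_AE[OF _ _ AE])
       (intro borel_measurable_power measurable_cube_section assms(3) meas)+
  moreover have "cube_section {1..s} v ?g x
      = (\<Sum>p\<in>P. w p * (tensor v (e' p) x * (\<Prod>j\<in>{1..s} - v. integral\<^sup>L unit_measure (e p j))))" for x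
    by (rule tensor_sum_section[OF finite_atLeastAtMost assms(3)]) (rule assms(1))
  ultimately show ?thesis by simp
qed

subsection \<open>The worst-case error\<close>

lemma extremal_function:
  fixes c :: real
  assumes N: "N \<ge> 1" and \<gamma>: "\<And>u. u \<subseteq> {1..s} \<Longrightarrow> \<gamma> u > 0"
    and X: "\<And>k j. k \<in> {1..N} \<Longrightarrow> j \<in> {1..s} \<Longrightarrow> X k j \<in> {0..1}"
  obtains f where "f \<in> sobolev_space s" "sobolev_norm s \<gamma> f = \<bar>c\<bar> * sqrt (sq_error N s \<gamma> X)"
    "rule_error N s X f = c * sq_error N s \<gamma> X"
proof -
  define S where "S = {1..s}"
  have fin: "finite S" by (simp add: S_def)
  \<comment> \<open>The pair (u, k) contributes the factors \<open>eta (X k j)\<close> for j in u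
    and 1 elsewhere; the weight carries \<open>\<gamma> u\<close> and the mean over k. The resulting
    function is c times the representer of the error.\<close>
  define P where "P = (Pow S - {{}}) \<times> {1..N}"
  define w where "w = (\<lambda>(u, k::nat). c * \<gamma> u / real N)"
  define e where "e = (\<lambda>(u, k) j. if j \<in> u then eta (X k j) else (\<lambda>_. 1))"
  define e' where "e' = (\<lambda>(u, k) j. if j \<in> u then kap (X k j) else (\<lambda>_. 0))"
  have pd: "piecewise_deriv (e p j) (e' p j)" if "p \<in> P" "j \<in> {1..s}" for p j
  proof -
    obtain u k where p: "p = (u, k)" by (cases p)
    then have "piecewise_deriv (eta (X k j)) (kap (X k j))"
      using that X[of k j] by (intro piecewise_deriv_eta) (auto simp: P_def)
    then show ?thesis by (simp add: p e_def e'_def piecewise_deriv_one)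
  qed
  have cont: "continuous_on UNIV (e p j)" for p j
    by (auto simp: e_def eta_continuous split: prod.split)
  define f where "f = tensor_sum {1..s} P w e"
  have fS: "f \<in> sobolev_space s" unfolding f_def by (rule tensor_sum_sobolev[OF pd cont])
  have inte: "integral\<^sup>L unit_measure (e (u, k) j) = (if j \<in> u then 0 else 1)"
    if "(u, k) \<in> P" "j \<in> S" for u k j
    using that X unit.prob_space[unfolded space_unit]
    by (auto simp: P_def e_def S_def integral_eta space_unit)
  have sec: "(\<Sum>p\<in>P. w p * (tensor v (e' p) x * (\<Prod>j\<in>S - v. integral\<^sup>L unit_measure (e p j))))
      = (if v = {} then 0 else c * \<gamma> v * mean_kap N X v x)" if v: "v \<subseteq> S" for v x
  proof -
    have fv: "finite v" using v fin finite_subset by blast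
    have pick: "w (u, k) * (tensor v (e' (u, k)) x * (\<Prod>j\<in>S - v. integral\<^sup>L unit_measure (e (u, k) j)))
       = (if u = v then c * \<gamma> v / real N * tensor v (\<lambda>j. kap (X k j)) x else 0)" if p: "(u, k) \<in> P" for u k
    proof (cases "u = v")
      case True
      have "(\<Prod>j\<in>S - v. integral\<^sup>L unit_measure (e (u, k) j)) = 1"
        using True inte[OF p] by (intro prod.neutral) auto
      moreover have "tensor v (e' (u, k)) x = tensor v (\<lambda>j. kap (X k j)) x"
        unfolding tensor_def e'_def using True by (intro prod.cong) auto
      ultimately show ?thesis using True by (simp add: w_def)
    next
      case False
      have u: "u \<subseteq> S" using p by (auto simp: P_def)
      \<comment> \<open>Orthogonality of different sets: a coordinate in v but not in u
        differentiates a constant, and a coordinate in u but not in v integrates \<open>eta\<close>,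
        which has mean 0.\<close>
      consider j where "j \<in> v" "j \<notin> u" | j where "j \<in> u" "j \<notin> v" using False by blast
      then have "tensor v (e' (u, k)) x = 0 \<or> (\<Prod>j\<in>S - v. integral\<^sup>L unit_measure (e (u, k) j)) = 0"
      proof cases
        case 1
        then have "e' (u, k) j (x j) = 0" by (simp add: e'_def)
        with 1 fv show ?thesis by (auto simp: tensor_def)
      next
        case 2
        then have "integral\<^sup>L unit_measure (e (u, k) j) = 0" "j \<in> S - v" using inte[OF p, of j] u by auto
        with fin show ?thesis by (auto intro!: prod_zero)
      qed
      with False show ?thesis by auto
    qed
    have "(\<Sum>p\<in>P. w p * (tensor v (e' p) x * (\<Prod>j\<in>S - v. integral\<^sup>L unit_measure (e p j))))
      = (\<Sum>(u, k)\<in>P. if u = v then c * \<gamma> v / real N * tensor v (\<lambda>j. kap (X k j)) x else 0)"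
      using pick by (intro sum.cong refl) auto
    also have "\<dots> = (\<Sum>u\<in>Pow S - {{}}. \<Sum>k=1..N. if u = v then c * \<gamma> v / real N * tensor v (\<lambda>j. kap (X k j)) x else 0)"
      unfolding P_def by (rule sum.cartesian_product[symmetric])
    also have "\<dots> = (\<Sum>u\<in>Pow S - {{}}. if u = v then \<Sum>k=1..N. c * \<gamma> v / real N * tensor v (\<lambda>j. kap (X k j)) x else 0)"
      by (intro sum.cong refl) auto
    also have "\<dots> = (if v = {} then 0 else c * \<gamma> v * mean_kap N X v x)"
      using fin v by (simp add: sum.delta mean_kap_def sum_distrib_left)
    finally show ?thesis .
  qed
  have norm_term: "inverse (\<gamma> v) * (\<integral>x. (cube_section {1..s} v (weak_mixed_deriv s v f) x)\<^sup>2 \<partial>cube_measure v)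
      = (if v = {} then 0 else c\<^sup>2 * (\<gamma> v * error_form N X v))" if v: "v \<in> Pow {1..s}" for v
  proof -
    have v': "v \<subseteq> {1..s}" "finite v" using v finite_subset by auto
    have g: "\<gamma> v > 0" using \<gamma> v' by blast
    have "(\<integral>x. (cube_section {1..s} v (weak_mixed_deriv s v f) x)\<^sup>2 \<partial>cube_measure v)
      = (\<integral>x. (\<Sum>p\<in>P. w p * (tensor v (e' p) x * (\<Prod>j\<in>{1..s} - v. integral\<^sup>L unit_measure (e p j))))\<^sup>2
          \<partial>cube_measure v)"
      unfolding f_def by (rule tensor_sum_weak_section[where e = e and e' = e', OF pd cont v'(1)])
    also have "\<dots> = (\<integral>x. (if v = {} then 0 else c * \<gamma> v * mean_kap N X v x)\<^sup>2 \<partial>cube_measure v)"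
      by (simp only: sec[OF v'(1)[folded S_def], unfolded S_def])
    also have "\<dots> = (if v = {} then 0 else c\<^sup>2 * (\<gamma> v)\<^sup>2 * error_form N X v)"
    proof -
      have "(\<integral>y. (mean_kap N X v y)\<^sup>2 \<partial>cube_measure v) = error_form N X v"
        using v' X by (intro integral_mean_kap_sq) auto
      then show ?thesis by (simp add: power_mult_distrib)
    qed
    \<comment> \<open>The section carries the factor c \<open>\<gamma> v\<close>; squaring it and
      dividing by the weight leaves c^2 \<open>\<gamma> v\<close>.\<close>
    finally show ?thesis using g by (simp add: power2_eq_square field_simps)
  qed
  have "sobolev_norm s \<gamma> f = sqrt (\<Sum>v\<in>Pow {1..s}. if v = {} then 0 else c\<^sup>2 * (\<gamma> v * error_form N X v))"
    unfolding sobolev_norm_section by (simp only: norm_term cong: sum.cong)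
  also have "(\<Sum>v\<in>Pow {1..s}. if v = {} then 0 else c\<^sup>2 * (\<gamma> v * error_form N X v)) = c\<^sup>2 * sq_error N s \<gamma> X"
    unfolding sq_error_def sum_distrib_left by (intro sum.mono_neutral_cong_right) auto
  finally have norm: "sobolev_norm s \<gamma> f = \<bar>c\<bar> * sqrt (sq_error N s \<gamma> X)"
    by (simp add: real_sqrt_mult)
  have fX: "f (X l) = (\<Sum>u\<in>Pow S - {{}}. \<Sum>k=1..N. c * \<gamma> u / real N * (\<Prod>j\<in>u. eta (X k j) (X l j)))" for l
  proof -
    have "f (X l) = (\<Sum>(u, k)\<in>P. c * \<gamma> u / real N * (\<Prod>j\<in>u. eta (X k j) (X l j)))"
      unfolding f_def tensor_sum_def
    proof (intro sum.cong refl, clarify)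
      fix u k assume "(u, k) \<in> P"
      then have u: "u \<subseteq> {1..s}" by (auto simp: P_def S_def)
      show "w (u, k) * tensor {1..s} (e (u, k)) (X l) = c * \<gamma> u / real N * (\<Prod>j\<in>u. eta (X k j) (X l j))"
        using tensor_restrict[OF finite_atLeastAtMost u, of "\<lambda>j. eta (X k j)"]
        by (simp add: w_def e_def tensor_def)
    qed
    then show ?thesis unfolding P_def by (simp only: sum.cartesian_product)
  qed
  have "cube_integral s f = 0"
  proof -
    have "(\<integral>x. (\<Sum>p\<in>P. w p * tensor {1..s} (e p) x) \<partial>cube_measure {1..s})
        = (\<Sum>p\<in>P. \<integral>x. w p * tensor {1..s} (e p) x \<partial>cube_measure {1..s})"
      by (rule Bochner_Integration.integral_sum)
         (intro integrable_mult_right continuous_on_cube_integrable continuous_on_tensor cont finite_atLeastAtMost)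
    also have "\<dots> = 0"
    proof (rule sum.neutral, rule ballI)
      fix p assume p: "p \<in> P"
      obtain u k where uk: "p = (u, k)" by (cases p)
      then have "u \<subseteq> {1..s}" "u \<noteq> {}" using p by (auto simp: P_def S_def)
      then obtain j where j: "j \<in> u" "j \<in> {1..s}" by blast
      have "(\<integral>x. tensor {1..s} (e p) x \<partial>cube_measure {1..s}) = (\<Prod>j\<in>{1..s}. integral\<^sup>L unit_measure (e p j))"
        by (intro integral_tensor finite_atLeastAtMost bounded_meas_integrable
            piecewise_deriv_bounded_meas(1)[OF pd[OF p]])
      also have "\<dots> = 0"
        using inte[of u k j] j p uk by (intro prod_zero) (auto simp: S_def)
      finally show "(\<integral>x. w p * tensor {1..s} (e p) x \<partial>cube_measure {1..s}) = 0" by simp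
    qed
    finally show ?thesis by (simp add: cube_integral_def f_def tensor_sum_def)
  qed
  then have "rule_error N s X f = (\<Sum>l=1..N. \<Sum>u\<in>Pow S - {{}}. \<Sum>k=1..N.
      c * \<gamma> u / (real N)\<^sup>2 * (\<Prod>j\<in>u. eta (X k j) (X l j)))"
    by (simp add: rule_error_def fX sum_distrib_left power2_eq_square)
  also have "\<dots> = (\<Sum>u\<in>Pow S - {{}}. \<Sum>l=1..N. \<Sum>k=1..N.
      c * \<gamma> u / (real N)\<^sup>2 * (\<Prod>j\<in>u. eta (X k j) (X l j)))"
    by (rule sum.swap)
  also have "\<dots> = (\<Sum>u\<in>Pow S - {{}}. \<Sum>k=1..N. \<Sum>l=1..N.
      c * \<gamma> u / (real N)\<^sup>2 * (\<Prod>j\<in>u. eta (X k j) (X l j)))"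
    by (intro sum.cong refl sum.swap)
  also have "\<dots> = c * sq_error N s \<gamma> X"
    by (simp add: sq_error_def error_form_def sum_distrib_left S_def mult.assoc)
  finally show thesis using that[OF fS norm] by blast
qed

definition lattice_points :: "nat \<Rightarrow> nat \<Rightarrow> (nat \<Rightarrow> nat) \<Rightarrow> (nat \<Rightarrow> real) \<Rightarrow> nat \<Rightarrow> nat \<Rightarrow> real" where
  "lattice_points N s z \<Delta> k = (\<lambda>j\<in>{1..s}. frac (real k * real (z j) / real N + \<Delta> j))"

theorem worst_case_error_eq:
  assumes N: "N \<ge> 1" and \<gamma>: "\<And>u. u \<subseteq> {1..s} \<Longrightarrow> \<gamma> u > 0"
  shows "(worst_case_error N s \<gamma> z \<Delta>)\<^sup>2 = sq_error N s \<gamma> (lattice_points N s z \<Delta>)"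
proof -
  define X where "X = lattice_points N s z \<Delta>"
  have X: "X k \<in> {1..s} \<rightarrow>\<^sub>E {0..<1}" for k
    unfolding X_def lattice_points_def by (auto simp: frac_lt_1)
  have X01: "X k j \<in> {0..1}" if "j \<in> {1..s}" for k j
  proof -
    have "X k j \<in> {0..<1}" using X[of k] that by (rule PiE_mem)
    then show ?thesis by simp
  qed
  define E where "E = sq_error N s \<gamma> X"
  have E: "E \<ge> 0" unfolding E_def by (intro sq_error_nonneg \<gamma> X01)
  \<comment> \<open>Normalizes the extremal function to norm 1. For E = 0 its norm and its error
    both vanish, so the value 1 is a mere default and the supremum 0 is still attained.\<close>
  define c where "c = (if E = 0 then 1 else 1 / sqrt E)"
  obtain f where f: "f \<in> sobolev_space s" "sobolev_norm s \<gamma> f = \<bar>c\<bar> * sqrt E" "rule_error N s X f = c * E"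
    unfolding E_def by (rule extremal_function[where c = c and N = N and s = s and \<gamma> = \<gamma> and X = X, OF N \<gamma> X01])
  have "\<bar>c\<bar> * sqrt E \<le> 1" "\<bar>c * E\<bar> = sqrt E"
    using E by (auto simp: c_def field_simps)
  have "worst_case_error N s \<gamma> z \<Delta>
      = Sup ((\<lambda>f. \<bar>rule_error N s X f\<bar>) ` {f \<in> sobolev_space s. sobolev_norm s \<gamma> f \<le> 1})"
    by (simp only: worst_case_error_def rule_error_def lattice_rule_def X_def lattice_points_def)
  also have "\<dots> = sqrt E"
  proof (rule cSup_eq_maximum)
    show "sqrt E \<in> (\<lambda>f. \<bar>rule_error N s X f\<bar>) ` {f \<in> sobolev_space s. sobolev_norm s \<gamma> f \<le> 1}"
      using f \<open>\<bar>c\<bar> * sqrt E \<le> 1\<close> \<open>\<bar>c * E\<bar> = sqrt E\<close> by (intro image_eqI[of _ _ f]) simp_all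
    fix y assume "y \<in> (\<lambda>f. \<bar>rule_error N s X f\<bar>) ` {f \<in> sobolev_space s. sobolev_norm s \<gamma> f \<le> 1}"
    then obtain h where "y = \<bar>rule_error N s X h\<bar>" "h \<in> sobolev_space s" "sobolev_norm s \<gamma> h \<le> 1" by blast
    then show "y \<le> sqrt E" unfolding E_def using rule_error_le[OF _ _ N \<gamma> X] by simp
  qed
  finally show ?thesis using E by (simp add: E_def X_def)
qed

subsection \<open>Shift averages\<close>

definition shift_kernel :: "nat \<Rightarrow> nat \<Rightarrow> nat \<Rightarrow> real \<Rightarrow> real" where
  "shift_kernel N a b t = eta (frac (real a / real N + t)) (frac (real b / real N + t))"

definition midpoint_sum :: "nat \<Rightarrow> nat \<Rightarrow> nat \<Rightarrow> real" where
  "midpoint_sum N a b = 1 / real N * (\<Sum>i<N. shift_kernel N a b ((2 * real i + 1) / (2 * real N)))"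

lemma frac_01: "frac x \<in> {0..1::real}"
  using frac_lt_1[of x] by (simp add: less_imp_le)

lemma shift_kernel_bound: "\<bar>shift_kernel N a b t\<bar> \<le> 1 / 3"
  unfolding shift_kernel_def by (intro eta_bound frac_01)

lemma shift_kernel_measurable [measurable]: "shift_kernel N a b \<in> borel_measurable borel"
  unfolding shift_kernel_def[abs_def] eta_def frac_def by measurable

lemma shift_kernel_integrable: "integrable unit_measure (shift_kernel N a b)"
  by (rule bounded_unit_integrable[OF measurable_unit[OF shift_kernel_measurable] shift_kernel_bound])

text \<open>Since a is an integer, a/N + t runs from (a + i)/N to just below (a + i + 1)/N, with no
  integer strictly between; the floor is constant and equals the integer quotient.\<close>

lemma frac_on_subinterval:
  assumes "N \<ge> 1" "real i / real N \<le> t" "t < (real i + 1) / real N"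
  shows "frac (real a / real N + t) = t + (real a / real N - real ((a + i) div N))"
proof -
  have N: "real N > 0" using assms(1) by simp
  have "real ((a + i) div N) \<le> (real a + real i) / real N"
  proof -
    have "real ((a + i) div N * N) \<le> real (a + i)" by (simp only: of_nat_le_iff div_times_less_eq_dividend)
    then show ?thesis using N by (simp add: field_simps)
  qed
  then have lo: "real ((a + i) div N) \<le> real a / real N + t"
    using assms(2) by (simp add: add_divide_distrib)
  have "a + i < ((a + i) div N + 1) * N"
    using assms(1) dividend_less_div_times[of N "a + i"] by (simp add: algebra_simps)
  then have "a + i + 1 \<le> ((a + i) div N + 1) * N" by simp
  then have "real (a + i + 1) \<le> real (((a + i) div N + 1) * N)" by (simp only: of_nat_le_iff)
  then have "(real a + real i + 1) / real N \<le> real ((a + i) div N) + 1"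
    using N by (simp add: field_simps)
  then have hi: "real a / real N + t < real ((a + i) div N) + 1"
    using assms(3) by (simp add: add_divide_distrib)
  have "\<lfloor>real a / real N + t\<rfloor> = int ((a + i) div N)"
    using lo hi by (intro floor_unique) simp_all
  then show ?thesis by (simp add: frac_def)
qed

text \<open>The midpoint rule errs by h^3/24 times the second derivative, exactly so for quadratics;
  here that derivative is 2.\<close>

lemma quadratic_midpoint_error:
  fixes h m B C :: real
  assumes "h \<ge> 0"
  shows "((\<lambda>t. t\<^sup>2 + B * t + C) has_integral (h * (m\<^sup>2 + B * m + C) + h ^ 3 / 12)) {m - h / 2..m + h / 2}"
proof -
  define F where "F t = t ^ 3 / 3 + B * t\<^sup>2 / 2 + C * t" for t
  have "((\<lambda>t. t\<^sup>2 + B * t + C) has_integral (F (m + h / 2) - F (m - h / 2))) {m - h / 2..m + h / 2}"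
  proof (rule fundamental_theorem_of_calculus)
    show "(F has_vector_derivative x\<^sup>2 + B * x + C) (at x within {m - h / 2..m + h / 2})" for x
      unfolding F_def[abs_def] has_real_derivative_iff_has_vector_derivative[symmetric]
      by (auto intro!: derivative_eq_intros simp: field_simps)
  qed (use assms in auto)
  moreover have "F (m + h / 2) - F (m - h / 2) = h * (m\<^sup>2 + B * m + C) + h ^ 3 / 12"
    by (simp add: F_def power3_eq_cube power2_eq_square field_simps)
  ultimately show ?thesis by simp
qed

lemma shift_kernel_piece:
  assumes "N \<ge> 1"
  shows "(shift_kernel N a b has_integral
      (1 / real N * shift_kernel N a b ((2 * real i + 1) / (2 * real N)) + (1 / real N) ^ 3 / 12))
      {real i / real N..(real i + 1) / real N}"
proof -
  have N: "real N > 0" using assms by simp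
  define \<alpha> where "\<alpha> = real a / real N - real ((a + i) div N)"
  define \<beta> where "\<beta> = real b / real N - real ((b + i) div N)"
  define q where "q t = t\<^sup>2 + (\<alpha> + \<beta> - 1) * t + ((\<alpha>\<^sup>2 + \<beta>\<^sup>2) / 2 - max \<alpha> \<beta> + 1 / 3)" for t
  define m where "m = (2 * real i + 1) / (2 * real N)"
  have eq: "shift_kernel N a b t = q t" if "real i / real N \<le> t" "t < (real i + 1) / real N" for t
  proof -
    have "shift_kernel N a b t = eta (t + \<alpha>) (t + \<beta>)"
      unfolding shift_kernel_def \<alpha>_def \<beta>_def using frac_on_subinterval[OF assms that] by simp
    \<comment> \<open>Both arguments move with the same t, so their order is fixed on the piece and
      the maximum contributes only a linear term.\<close>
    also have "max (t + \<alpha>) (t + \<beta>) = t + max \<alpha> \<beta>" by simp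
    then have "eta (t + \<alpha>) (t + \<beta>) = q t"
      by (simp add: eta_def q_def power2_eq_square field_simps)
    finally show ?thesis .
  qed
  have m: "m - 1 / real N / 2 = real i / real N" "m + 1 / real N / 2 = (real i + 1) / real N"
    using N by (simp_all add: m_def field_simps)
  have "(q has_integral (1 / real N * q m + (1 / real N) ^ 3 / 12)) {real i / real N..(real i + 1) / real N}"
    using quadratic_midpoint_error[of "1 / real N" "\<alpha> + \<beta> - 1" _ m] unfolding m q_def[abs_def] by simp
  moreover have "q m = shift_kernel N a b m"
    using N by (intro eq[symmetric]) (simp_all add: m_def field_simps)
  ultimately have "(q has_integral (1 / real N * shift_kernel N a b m + (1 / real N) ^ 3 / 12))
      {real i / real N..(real i + 1) / real N}" by simp
  \<comment> \<open>At the right endpoint the floor may jump, so kernel and polynomial are compared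
    only off this single point.\<close>
  then show ?thesis unfolding m_def
    by (rule has_integral_spike_finite[where S = "{(real i + 1) / real N}", rotated -1])
       (auto simp: eq)
qed

lemma shift_kernel_integral:
  assumes "N \<ge> 1"
  shows "integral\<^sup>L unit_measure (shift_kernel N a b) = midpoint_sum N a b + 1 / (12 * (real N)\<^sup>2)"
proof (rule unit_integral_eq)
  let ?v = "\<lambda>i. 1 / real N * shift_kernel N a b ((2 * real i + 1) / (2 * real N)) + (1 / real N) ^ 3 / 12"
  have N: "real N > 0" using assms by simp
  have "(shift_kernel N a b has_integral (\<Sum>i<n. ?v i)) {0..real n / real N}" for n
  proof (induction n)
    case (Suc n)
    have "(shift_kernel N a b has_integral ((\<Sum>i<n. ?v i) + ?v n)) {0..(real n + 1) / real N}"
      using N by (intro has_integral_combine[OF _ _ Suc.IH shift_kernel_piece[OF assms]])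
        (auto simp: divide_right_mono)
    then show ?case by (simp add: add.commute)
  qed (simp add: has_integral_refl)
  from this[of N] have "(shift_kernel N a b has_integral (\<Sum>i<N. ?v i)) {0..1}" using N by simp
  moreover have "(\<Sum>i<N. ?v i) = midpoint_sum N a b + 1 / (12 * (real N)\<^sup>2)"
  proof -
    have "(\<Sum>i<N. (1 / real N) ^ 3 / 12) = 1 / (12 * (real N)\<^sup>2)"
      using N by (simp add: power2_eq_square power3_eq_cube)
    then show ?thesis by (simp only: sum.distrib midpoint_sum_def sum_distrib_left)
  qed
  ultimately show "(shift_kernel N a b has_integral (midpoint_sum N a b + 1 / (12 * (real N)\<^sup>2))) {0..1}" by simp
qed (auto intro!: measurable_unit shift_kernel_bound)

lemma shift_kernel_averages_bound:
  "\<bar>integral\<^sup>L unit_measure (shift_kernel N a b)\<bar> \<le> 1 / 3" "\<bar>midpoint_sum N a b\<bar> \<le> 1 / 3"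
proof -
  have "\<bar>integral\<^sup>L unit_measure (shift_kernel N a b)\<bar> \<le> (\<integral>t. 1 / 3 \<partial>unit_measure)"
    by (rule order_trans[OF integral_abs_bound
          integral_mono[OF integrable_abs[OF shift_kernel_integrable] _ shift_kernel_bound]]) simp
  then show "\<bar>integral\<^sup>L unit_measure (shift_kernel N a b)\<bar> \<le> 1 / 3"
    using unit.prob_space by simp
  have "\<bar>\<Sum>i<N. shift_kernel N a b ((2 * real i + 1) / (2 * real N))\<bar> \<le> (\<Sum>i<N. 1 / 3)"
    by (rule order_trans[OF sum_abs sum_mono]) (rule shift_kernel_bound)
  then have "\<bar>midpoint_sum N a b\<bar> \<le> 1 / real N * (real N / 3)"
    unfolding midpoint_sum_def abs_mult by (intro mult_mono) auto
  also have "\<dots> \<le> 1 / 3" by simp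
  finally show "\<bar>midpoint_sum N a b\<bar> \<le> 1 / 3" .
qed

text \<open>Multiplying every factor by 3 brings it into [-1, 1], where products differ by at most
  the sum of the differences of their factors. Each scaled difference is 3 / (12 N^2) = 1 / (4 N^2);
  undoing the scaling yields (1/3)^|u|.\<close>

lemma prod_averages_diff:
  assumes "finite u" "N \<ge> 1"
  shows "\<bar>(\<Prod>j\<in>u. integral\<^sup>L unit_measure (shift_kernel N (a j) (b j))) - (\<Prod>j\<in>u. midpoint_sum N (a j) (b j))\<bar>
    \<le> 1 / (4 * (real N)\<^sup>2) * ((1 / 3) ^ card u * real (card u))"
proof -
  define I where "I j = integral\<^sup>L unit_measure (shift_kernel N (a j) (b j))" for j
  define M where "M j = midpoint_sum N (a j) (b j)" for j
  have "norm ((\<Prod>j\<in>u. 3 * I j) - (\<Prod>j\<in>u. 3 * M j)) \<le> (\<Sum>j\<in>u. norm (3 * I j - 3 * M j))"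
    by (rule norm_prod_diff) (auto simp: I_def M_def abs_mult field_simps
      intro: order_trans[OF mult_left_mono[OF shift_kernel_averages_bound(1)]]
        order_trans[OF mult_left_mono[OF shift_kernel_averages_bound(2)]])
  also have "\<dots> = (\<Sum>j\<in>u. 1 / (4 * (real N)\<^sup>2))"
    by (intro sum.cong refl) (simp add: I_def M_def shift_kernel_integral[OF assms(2)])
  finally have "3 ^ card u * \<bar>(\<Prod>j\<in>u. I j) - (\<Prod>j\<in>u. M j)\<bar> \<le> real (card u) / (4 * (real N)\<^sup>2)"
    by (simp add: prod.distrib right_diff_distrib[symmetric] abs_mult)
  then have "\<bar>(\<Prod>j\<in>u. I j) - (\<Prod>j\<in>u. M j)\<bar> \<le> real (card u) / (4 * (real N)\<^sup>2) / 3 ^ card u"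
    by (subst pos_le_divide_eq) (simp_all add: mult.commute)
  also have "\<dots> = 1 / (4 * (real N)\<^sup>2) * ((1 / 3) ^ card u * real (card u))"
    by (simp add: power_one_over)
  finally have "\<bar>(\<Prod>j\<in>u. I j) - (\<Prod>j\<in>u. M j)\<bar> \<le> 1 / (4 * (real N)\<^sup>2) * ((1 / 3) ^ card u * real (card u))" .
  then show ?thesis by (simp only: I_def M_def)
qed

section \<open>The squared error averaged over all shifts and over the half shifts\<close>

lemma sq_error_lattice_points:
  "sq_error N s \<gamma> (lattice_points N s z \<Delta>) = (\<Sum>u\<in>Pow {1..s} - {{}}. \<Sum>k=1..N. \<Sum>l=1..N.
     \<gamma> u / (real N)\<^sup>2 * tensor u (\<lambda>j. shift_kernel N (k * z j) (l * z j)) \<Delta>)"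
proof -
  have kernel: "(\<Prod>j\<in>u. eta (lattice_points N s z \<Delta> k j) (lattice_points N s z \<Delta> l j))
      = tensor u (\<lambda>j. shift_kernel N (k * z j) (l * z j)) \<Delta>" if "u \<in> Pow {1..s} - {{}}" for u k l
    unfolding tensor_def using that
    by (intro prod.cong) (auto simp: lattice_points_def shift_kernel_def)
  show ?thesis
    unfolding sq_error_def error_form_def sum_distrib_left
    by (intro sum.cong refl) (simp only: kernel, simp)
qed

lemma shift_kernel_bounded_meas: "bounded_meas (shift_kernel N a b)"
  unfolding bounded_meas_def using shift_kernel_bound[of N a b] by (intro conjI exI[of _ "1 / 3"]) auto

text \<open>Padding with the constant factor 1 turns a product over u into a tensor product over all
  coordinates, whose integral factorizes; the padded coordinates integrate to 1.\<close>

lemma shift_avg_sq_error_eq: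
  assumes N: "N \<ge> 1" and \<gamma>: "\<And>u. u \<subseteq> {1..s} \<Longrightarrow> \<gamma> u > 0"
  shows "shift_avg_sq_error N s \<gamma> z = (\<Sum>u\<in>Pow {1..s} - {{}}. \<Sum>k=1..N. \<Sum>l=1..N.
     \<gamma> u / (real N)\<^sup>2 * (\<Prod>j\<in>u. integral\<^sup>L unit_measure (shift_kernel N (k * z j) (l * z j))))"
proof -
  let ?T = "\<lambda>u k l. tensor u (\<lambda>j. shift_kernel N (k * z j) (l * z j))"
  have T: "integrable (cube_measure {1..s}) (?T u k l)"
    "(\<integral>\<Delta>. ?T u k l \<Delta> \<partial>cube_measure {1..s})
      = (\<Prod>j\<in>u. integral\<^sup>L unit_measure (shift_kernel N (k * z j) (l * z j)))"
    if u: "u \<in> Pow {1..s} - {{}}" for u k l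
  proof -
    let ?F = "\<lambda>j. if j \<in> u then shift_kernel N (k * z j) (l * z j) else (\<lambda>_. 1)"
    have u': "u \<subseteq> {1..s}" using u by blast
    have bm: "bounded_meas (?F j)" for j
      using shift_kernel_bounded_meas piecewise_deriv_bounded_meas(1)[OF piecewise_deriv_one] by simp
    have eq: "?T u k l = tensor {1..s} ?F"
      by (rule tensor_restrict[OF finite_atLeastAtMost u', symmetric])
    obtain B where "\<And>x. x \<in> unit_cube {1..s} \<Longrightarrow> \<bar>tensor {1..s} ?F x\<bar> \<le> B"
      by (rule tensor_bounded_meas[where e = ?F, OF finite_atLeastAtMost bm]) (rule that)
    then show "integrable (cube_measure {1..s}) (?T u k l)" unfolding eq
      by (rule bounded_cube_integrable[OF tensor_bounded_meas_measurable[OF order_refl bm]])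
    have "(\<integral>\<Delta>. ?T u k l \<Delta> \<partial>cube_measure {1..s}) = (\<Prod>j\<in>{1..s}. integral\<^sup>L unit_measure (?F j))"
      unfolding eq by (rule integral_tensor[OF finite_atLeastAtMost bounded_meas_integrable[OF bm]])
    also have "\<dots> = (\<Prod>j\<in>u. integral\<^sup>L unit_measure (shift_kernel N (k * z j) (l * z j)))"
      using u' unit.prob_space[unfolded space_unit]
      by (intro prod.mono_neutral_cong_right) (auto simp: space_unit)
    finally show "(\<integral>\<Delta>. ?T u k l \<Delta> \<partial>cube_measure {1..s})
      = (\<Prod>j\<in>u. integral\<^sup>L unit_measure (shift_kernel N (k * z j) (l * z j)))" .
  qed
  have "shift_avg_sq_error N s \<gamma> z = (\<integral>\<Delta>. (\<Sum>u\<in>Pow {1..s} - {{}}. \<Sum>k=1..N. \<Sum>l=1..N.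
     \<gamma> u / (real N)\<^sup>2 * ?T u k l \<Delta>) \<partial>cube_measure {1..s})"
    unfolding shift_avg_sq_error_def sq_error_lattice_points[symmetric]
    by (intro Bochner_Integration.integral_cong refl worst_case_error_eq N \<gamma>)
  also have "\<dots> = (\<Sum>u\<in>Pow {1..s} - {{}}. \<Sum>k=1..N. \<Sum>l=1..N.
     \<integral>\<Delta>. \<gamma> u / (real N)\<^sup>2 * ?T u k l \<Delta> \<partial>cube_measure {1..s})"
    by (subst Bochner_Integration.integral_sum,
        intro Bochner_Integration.integrable_sum integrable_mult_right T(1), assumption,
        intro sum.cong refl, subst Bochner_Integration.integral_sum,
        intro Bochner_Integration.integrable_sum integrable_mult_right T(1), assumption,
        intro sum.cong refl Bochner_Integration.integral_sum integrable_mult_right T(1))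
  also have "\<dots> = (\<Sum>u\<in>Pow {1..s} - {{}}. \<Sum>k=1..N. \<Sum>l=1..N.
     \<gamma> u / (real N)\<^sup>2 * (\<Prod>j\<in>u. integral\<^sup>L unit_measure (shift_kernel N (k * z j) (l * z j))))"
    by (intro sum.cong refl) (simp only: integral_mult_right_zero T(2))
  finally show ?thesis .
qed

lemma half_shifts_sum:
  assumes "N \<ge> 1"
  shows "(\<Sum>t\<in>half_shifts N. f t) = (\<Sum>i<N. f ((2 * real i + 1) / (2 * real N)))"
proof -
  have "inj_on (\<lambda>k. (2 * real k - 1) / (2 * real N)) {1..N}"
    using assms by (auto simp: inj_on_def)
  then have "(\<Sum>t\<in>half_shifts N. f t) = (\<Sum>k=1..N. f ((2 * real k - 1) / (2 * real N)))"
    unfolding half_shifts_def by (simp add: sum.reindex)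
  also have "\<dots> = (\<Sum>i<N. f ((2 * real i + 1) / (2 * real N)))"
    by (rule sum.reindex_bij_witness[of _ Suc "\<lambda>k. k - 1"]) (auto simp: of_nat_diff algebra_simps)
  finally show ?thesis .
qed

lemma half_shift_avg_sq_error_eq:
  assumes N: "N \<ge> 1" and \<gamma>: "\<And>u. u \<subseteq> {1..s} \<Longrightarrow> \<gamma> u > 0"
  shows "half_shift_avg_sq_error N s \<gamma> z = (\<Sum>u\<in>Pow {1..s} - {{}}. \<Sum>k=1..N. \<Sum>l=1..N.
     \<gamma> u / (real N)\<^sup>2 * (\<Prod>j\<in>u. midpoint_sum N (k * z j) (l * z j)))"
proof -
  let ?T = "\<lambda>u k l. tensor u (\<lambda>j. shift_kernel N (k * z j) (l * z j))"
  let ?H = "{1..s} \<rightarrow>\<^sub>E half_shifts N"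
  have T: "1 / real N ^ s * (\<Sum>\<Delta>\<in>?H. ?T u k l \<Delta>) = (\<Prod>j\<in>u. midpoint_sum N (k * z j) (l * z j))"
    if u: "u \<in> Pow {1..s} - {{}}" for u k l
  proof -
    let ?F = "\<lambda>j. if j \<in> u then shift_kernel N (k * z j) (l * z j) else (\<lambda>_. 1)"
    have u': "u \<subseteq> {1..s}" using u by blast
    have card: "card (half_shifts N) = N"
      using half_shifts_sum[OF N, of "\<lambda>_. 1 :: nat"] by simp
    have "(\<Sum>\<Delta>\<in>?H. ?T u k l \<Delta>) = (\<Sum>\<Delta>\<in>?H. \<Prod>j\<in>{1..s}. ?F j (\<Delta> j))"
      unfolding tensor_restrict[OF finite_atLeastAtMost u', symmetric] tensor_def ..
    also have "\<dots> = (\<Prod>j\<in>{1..s}. \<Sum>t\<in>half_shifts N. ?F j t)"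
      by (rule prod_sum_PiE[symmetric]) (simp_all add: half_shifts_def)
    \<comment> \<open>The prefactor is distributed as one 1/N per coordinate, so a coordinate
      outside u contributes the average of 1.\<close>
    finally have "1 / real N ^ s * (\<Sum>\<Delta>\<in>?H. ?T u k l \<Delta>)
        = (\<Prod>j\<in>{1..s}. 1 / real N * (\<Sum>t\<in>half_shifts N. ?F j t))"
      unfolding prod.distrib by (simp add: power_one_over)
    also have "\<dots> = (\<Prod>j\<in>u. midpoint_sum N (k * z j) (l * z j))"
      using u' N by (intro prod.mono_neutral_cong_right)
        (auto simp: half_shifts_sum[OF N] midpoint_sum_def card)
    finally show ?thesis .
  qed
  have "half_shift_avg_sq_error N s \<gamma> z = 1 / real N ^ s * (\<Sum>\<Delta>\<in>?H. \<Sum>u\<in>Pow {1..s} - {{}}. \<Sum>k=1..N. \<Sum>l=1..N.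
     \<gamma> u / (real N)\<^sup>2 * ?T u k l \<Delta>)"
    unfolding half_shift_avg_sq_error_def sq_error_lattice_points[symmetric]
    by (intro arg_cong2[where f = "(*)"] sum.cong refl worst_case_error_eq N \<gamma>)
  also have "\<dots> = (\<Sum>u\<in>Pow {1..s} - {{}}. \<Sum>k=1..N. \<Sum>l=1..N.
     \<gamma> u / (real N)\<^sup>2 * (1 / real N ^ s * (\<Sum>\<Delta>\<in>?H. ?T u k l \<Delta>)))"
    unfolding sum_distrib_left sum.swap[of _ _ ?H] mult.left_commute[of "1 / real N ^ s"] ..
  also have "\<dots> = (\<Sum>u\<in>Pow {1..s} - {{}}. \<Sum>k=1..N. \<Sum>l=1..N.
     \<gamma> u / (real N)\<^sup>2 * (\<Prod>j\<in>u. midpoint_sum N (k * z j) (l * z j)))"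
    by (intro sum.cong refl) (simp only: T)
  finally show ?thesis .
qed

theorem theorem2p1:
  fixes s N :: nat and \<gamma> :: "nat set \<Rightarrow> real" and z :: "nat \<Rightarrow> nat"
  assumes "s \<ge> 1" and "N \<ge> 1"
    and "\<And>u. u \<subseteq> {1..s} \<Longrightarrow> \<gamma> u > 0"
    and "\<gamma> {} = 1"
    and "\<And>j. j \<in> {1..s} \<Longrightarrow> z j \<in> {1..N - 1}"
  shows "\<bar>shift_avg_sq_error N s \<gamma> z - half_shift_avg_sq_error N s \<gamma> z\<bar>
         \<le> 1 / (4 * (real N)\<^sup>2) *
           (\<Sum>u\<in>Pow {1..s} - {{}}. \<gamma> u * (1 / 3) ^ card u * real (card u))"
proof -
  let ?I = "\<lambda>u k l. \<Prod>j\<in>u. integral\<^sup>L unit_measure (shift_kernel N (k * z j) (l * z j))"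
  let ?M = "\<lambda>u k l. \<Prod>j\<in>u. midpoint_sum N (k * z j) (l * z j)"
  let ?b = "\<lambda>u. 1 / (4 * (real N)\<^sup>2) * ((1 / 3) ^ card u * real (card u))"
  have eq: "shift_avg_sq_error N s \<gamma> z - half_shift_avg_sq_error N s \<gamma> z
      = (\<Sum>u\<in>Pow {1..s} - {{}}. \<Sum>k=1..N. \<Sum>l=1..N. \<gamma> u / (real N)\<^sup>2 * (?I u k l - ?M u k l))"
    by (simp only: shift_avg_sq_error_eq[OF assms(2,3)] half_shift_avg_sq_error_eq[OF assms(2,3)]
        sum_subtractf right_diff_distrib)
  have "\<bar>shift_avg_sq_error N s \<gamma> z - half_shift_avg_sq_error N s \<gamma> z\<bar>
      \<le> (\<Sum>u\<in>Pow {1..s} - {{}}. \<Sum>k=1..N. \<Sum>l=1..N. \<bar>\<gamma> u / (real N)\<^sup>2 * (?I u k l - ?M u k l)\<bar>)"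
    unfolding eq by (intro order_trans[OF sum_abs] sum_mono order_refl)
  \<comment> \<open>The bound is uniform in the pair (k, l); no cancellation between pairs of nodes
    is exploited.\<close>
  also have "\<dots> \<le> (\<Sum>u\<in>Pow {1..s} - {{}}. \<Sum>k=1..N. \<Sum>l=1..N. \<gamma> u / (real N)\<^sup>2 * ?b u)"
  proof (intro sum_mono)
    fix u k l assume "u \<in> Pow {1..s} - {{}}"
    then have u: "u \<subseteq> {1..s}" "finite u" using finite_subset by auto
    have "\<gamma> u > 0" by (rule assms(3)[OF u(1)])
    then show "\<bar>\<gamma> u / (real N)\<^sup>2 * (?I u k l - ?M u k l)\<bar> \<le> \<gamma> u / (real N)\<^sup>2 * ?b u"
      unfolding abs_mult by (intro mult_mono prod_averages_diff[OF u(2) assms(2)]) auto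
  qed
  \<comment> \<open>The N^2 pairs of nodes cancel the factor 1/N^2 of the quadratic form, so only
    the 1/N^2 of the midpoint error remains.\<close>
  also have "\<dots> = (\<Sum>u\<in>Pow {1..s} - {{}}. \<gamma> u * ?b u)"
    using assms(2) by (intro sum.cong refl) (simp add: power2_eq_square field_simps)
  also have "\<dots> = 1 / (4 * (real N)\<^sup>2) * (\<Sum>u\<in>Pow {1..s} - {{}}. \<gamma> u * (1 / 3) ^ card u * real (card u))"
    unfolding sum_distrib_left by (intro sum.cong refl) (simp only: mult_ac)
  finally show ?thesis .
qed

end
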